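(* Let $d\ge2$, let the conductances $(\mu_e)_{e\in E_d}$ be i.i.d. random variables on $(\Omega,\mathbb{P})$ with values in $[1,\infty)$, and let $\eta\in(0,1)$. There exist a constant $C_H$, constants $c_1,c_2\in(0,\infty)$ and random variables $U_x$, $x\in\mathbb{Z}^d$, with $$\mathbb{P}(U_x(\omega)\ge n)\le c_1\exp(-c_2n^\eta),$$ such that ($\mathbb{P}$-a.s.) if $R\ge U_x$, then an elliptic Harnack inequality with constant $C_H$ holds for $B(x,R)$: if $h\ge0$ is harmonic in $B(x,R)$, then $$\sup_{y\in B(x,R/2)}h(y)\le C_H\inf_{y\in B(x,R/2)}h(y).$$
   Context: $E_d$ is the set of nonoriented nearest-neighbour edges of $\mathbb{Z}^d$. Write $\mu_{xy}=\mu_{\{x,y\}}$ if $x\sim y$, $\mu_{xy}=0$ otherwise, and $\mathcal{L}_Vf(x)=\sum_y\mu_{xy}(f(y)-f(x))$. $d(x,y)$ is the graph distance on $\mathbb{Z}^d$ and $B(x,r)=\{y:d(x,y)<r\}$. For $A\subset\mathbb{Z}^d$, $\overline A$ is the union of $A$ with the set of vertices adjacent to some vertex of $A$. A function $h$ is harmonic in $A$ if it is defined on $\overline A$ and $\mathcal{L}_Vh(x)=0$ for all $x\in A$; "$h\ge0$" means nonnegative on $\overline A$. *)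

theory Defs
  imports "HOL-Probability.Probability"
begin

definition lattice_adj :: "int ^ 'd::finite \<Rightarrow> int ^ 'd \<Rightarrow> bool" where
  "lattice_adj x y \<longleftrightarrow> (\<Sum>i\<in>UNIV. \<bar>x $ i - y $ i\<bar>) = 1"

definition lattice_edges :: "(int ^ 'd::finite) set set" where
  "lattice_edges = {{x, y} | x y. lattice_adj x y}"

text \<open>The lattice is connected, so the minimum below is over a nonempty set of walk lengths.\<close>

definition graph_dist :: "int ^ 'd::finite \<Rightarrow> int ^ 'd \<Rightarrow> nat" where
  "graph_dist x y = (LEAST n. (lattice_adj ^^ n) x y)"

definition graph_ball :: "int ^ 'd::finite \<Rightarrow> real \<Rightarrow> (int ^ 'd) set" where
  "graph_ball x r = {y. real (graph_dist x y) < r}"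

definition graph_closure :: "(int ^ 'd::finite) set \<Rightarrow> (int ^ 'd) set" where
  "graph_closure A = A \<union> {y. \<exists>x\<in>A. lattice_adj x y}"

definition conductance ::
    "((int ^ 'd::finite) set \<Rightarrow> real) \<Rightarrow> int ^ 'd \<Rightarrow> int ^ 'd \<Rightarrow> real" where
  "conductance \<mu> x y = (if lattice_adj x y then \<mu> {x, y} else 0)"

text \<open>The sum has at most \<open>2 * CARD('d)\<close> nonzero terms.\<close>

definition generator ::
    "((int ^ 'd::finite) set \<Rightarrow> real) \<Rightarrow> (int ^ 'd \<Rightarrow> real) \<Rightarrow> int ^ 'd \<Rightarrow> real" where
  "generator \<mu> f x = (\<Sum>\<^sub>\<infinity>y\<in>UNIV. conductance \<mu> x y * (f y - f x))"

text \<open>A function on \<open>graph_closure A\<close> is represented by a total function; its values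
  outside \<open>graph_closure A\<close> do not affect harmonicity in \<open>A\<close>.\<close>

definition harmonic_in ::
    "((int ^ 'd::finite) set \<Rightarrow> real) \<Rightarrow> (int ^ 'd) set \<Rightarrow> (int ^ 'd \<Rightarrow> real) \<Rightarrow> bool" where
  "harmonic_in \<mu> A h \<longleftrightarrow> (\<forall>x\<in>A. generator \<mu> h x = 0)"

text \<open>For \<open>R > 0\<close> the ball \<open>graph_ball x (R/2)\<close> is finite and contains \<open>x\<close>, so the real
  supremum and infimum are the genuine ones; for \<open>R \<le> 0\<close> they range over the empty set
  and carry no meaning.\<close>

definition elliptic_harnack ::
    "((int ^ 'd::finite) set \<Rightarrow> real) \<Rightarrow> real \<Rightarrow> int ^ 'd \<Rightarrow> real \<Rightarrow> bool" where
  "elliptic_harnack \<mu> C x R \<longleftrightarrow>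
     (\<forall>h. (\<forall>y\<in>graph_closure (graph_ball x R). 0 \<le> h y) \<longrightarrow>
          harmonic_in \<mu> (graph_ball x R) h \<longrightarrow>
          (SUP y\<in>graph_ball x (R / 2). h y) \<le> C * (INF y\<in>graph_ball x (R / 2). h y))"

end

theory Submission
  imports Defs
begin

text \<open>Cutting at a large threshold \<open>K\<close>, let \<open>\<rho>\<close> be the first passage distance from a vertex in which edges of
  conductance above \<open>K\<close> have length \<open>0\<close> and all others length \<open>1\<close>. Functions of \<open>\<rho>\<close> are constant across the
  bad edges, so they are cutoff functions whose energy is bounded by \<open>K\<close> alone, and \<open>\<mu> \<ge> 1\<close> gives the
  Faber-Krahn and Poincare inequalities of the lattice. If \<open>K\<close> is large, a union bound over self-avoiding paths
  shows that \<open>\<rho>\<close> is comparable with the graph distance at scales at least \<open>n\<close>, except with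
  probability exponentially small in \<open>n\<close>.

  The Harnack inequality is then derived at a single scale \<open>n\<close>. De Giorgi iteration bounds subharmonic
  functions by their means. Applied to \<open>- ln v\<close>, together with the logarithmic energy estimate, it shows that a
  positive superharmonic function which is at least \<open>t\<close> on a positive fraction of a box is at least a multiple of
  \<open>t\<close> everywhere in a smaller box. This yields the lower bound \<open>c * n powr (2 - d)\<close> for the Green function
  \<open>G\<close> with pole \<open>y\<close>, and comparing \<open>G\<close> with the potential of a box in Green's identity bounds the mean of a
  nonnegative harmonic \<open>h\<close> by \<open>h y\<close>. The mean value estimate bounds \<open>h\<close> by its mean.\<close>

section \<open>Finite networks\<close>

text \<open>The obstacle is that the conductances have no upper bound and no moments, so a cutoff
  built from the graph distance may have unbounded energy. The gradient bound for \<rho> holds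
  across every edge, but its comparison with the graph distance only from scale \<open>n\<close> on.
  Arguments that descend to small cubes, such as coverings by cubes of decreasing size or the
  John-Nirenberg step of Moser's method, would need the comparison at those scales as well. This is
  why the mean of \<open>h\<close> is tied to \<open>h y\<close> through the Green function: its
  symmetry turns bounds for potentials of small sets into information on \<open>G\<close> without
  using any smaller scale. The De Giorgi iteration may run through small radii because there only
  the gradient of \<rho> enters. Working in finite networks makes all summations by parts finite and
  free of boundary terms. The tail obtained is exponential, which is stronger than the stretched
  exponential one for \<eta> below one.\<close>

locale network =
  fixes F :: "'a set" and c :: "'a \<Rightarrow> 'a \<Rightarrow> real"
  assumes finite_F: "finite F"
    and c_sym: "c x y = c y x"
    and c_nonneg: "0 \<le> c x y"
begin

text \<open>Only neighbours in \<open>F\<close> are seen. At vertices with all neighbours in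
  \<open>F\<close> this is the generator; near the rim of \<open>F\<close> it differs, and in return
  summation by parts has no boundary term.\<close>

definition lap :: "('a \<Rightarrow> real) \<Rightarrow> 'a \<Rightarrow> real" where
  "lap f x = (\<Sum>y\<in>F. c x y * (f y - f x))"

text \<open>The sum runs over ordered pairs, so each edge counts twice; hence the factor 1/2 in
  \<open>sum_mult_lap\<close>.\<close>

definition en :: "('a \<Rightarrow> real) \<Rightarrow> ('a \<Rightarrow> real) \<Rightarrow> real" where
  "en f g = (\<Sum>x\<in>F. \<Sum>y\<in>F. c x y * ((f x - f y) * (g x - g y)))"

lemma en_sym: "en f g = en g f"
  unfolding en_def by (simp add: mult.commute)

lemma en_nonneg: "0 \<le> en f f"
  unfolding en_def by (intro sum_nonneg mult_nonneg_nonneg[OF c_nonneg]) simp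

lemma sum_mult_lap: "(\<Sum>x\<in>F. g x * lap f x) = - en f g / 2"
proof -
  have sw: "(\<Sum>x\<in>F. \<Sum>y\<in>F. c x y * (f y - f x) * g x) = (\<Sum>x\<in>F. \<Sum>y\<in>F. c x y * (f x - f y) * g y)"
    by (subst sum.swap) (simp add: c_sym)
  have "en f g = - (\<Sum>x\<in>F. \<Sum>y\<in>F. c x y * (f y - f x) * g x)
      - (\<Sum>x\<in>F. \<Sum>y\<in>F. c x y * (f x - f y) * g y)"
    unfolding en_def sum_negf[symmetric] sum_subtractf[symmetric]
    by (intro sum.cong refl) (simp add: algebra_simps)
  also have "... = - 2 * (\<Sum>x\<in>F. \<Sum>y\<in>F. c x y * (f y - f x) * g x)"
    using sw by simp
  also have "(\<Sum>x\<in>F. \<Sum>y\<in>F. c x y * (f y - f x) * g x) = (\<Sum>x\<in>F. g x * lap f x)"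
    unfolding lap_def by (simp add: sum_distrib_left mult_ac)
  finally show ?thesis by simp
qed

lemma green_identity: "(\<Sum>x\<in>F. g x * lap f x) = (\<Sum>x\<in>F. f x * lap g x)"
  by (simp add: sum_mult_lap en_sym[of f g])

lemma lap_linear: "lap (\<lambda>x. a * f x + b * g x) x = a * lap f x + b * lap g x"
  unfolding lap_def by (simp add: sum_distrib_left sum.distrib[symmetric] algebra_simps)

lemma lap_add_const: "lap (\<lambda>x. f x + b) x = lap f x"
  unfolding lap_def by simp

lemma lap_scale: "lap (\<lambda>x. a * f x) x = a * lap f x"
  unfolding lap_def by (simp add: sum_distrib_left algebra_simps)

lemma lap_uminus: "lap (\<lambda>x. - f x) x = - lap f x"
  using lap_scale[of "-1" f x] by simp

lemma lap_const: "lap (\<lambda>x. b) x = 0"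
  unfolding lap_def by simp

text \<open>At \<open>x\<close> the maximum equals one of the two functions, and elsewhere it
  dominates that one.\<close>

lemma lap_max_nonneg:
  assumes "0 \<le> lap f x" "0 \<le> lap g x"
  shows "0 \<le> lap (\<lambda>y. max (f y) (g y)) x"
proof (cases "g x \<le> f x")
  case True
  have "lap f x \<le> lap (\<lambda>y. max (f y) (g y)) x" unfolding lap_def
    by (intro sum_mono mult_left_mono c_nonneg) (use True in auto)
  with assms show ?thesis by simp
next
  case False
  have "lap g x \<le> lap (\<lambda>y. max (f y) (g y)) x" unfolding lap_def
    by (intro sum_mono mult_left_mono c_nonneg) (use False in auto)
  with assms show ?thesis by simp
qed

lemma lap_pos_part_nonneg: "0 \<le> lap u x \<Longrightarrow> 0 \<le> lap (\<lambda>y. max (u y - k) 0) x"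
  using lap_max_nonneg[of "\<lambda>y. u y - k" x "\<lambda>_. 0"] lap_add_const[of u "-k" x] lap_const[of 0 x]
  by simp

text \<open>Concavity of the logarithm: the tangent bound \<open>ln s \<le> s - 1\<close> at
  \<open>s = v y / v x\<close> compares the increments of \<open>- ln v\<close> at \<open>x\<close>
  with those of \<open>- v / v x\<close>.\<close>

lemma lap_minus_ln_nonneg:
  assumes x: "x \<in> F" and pos: "\<And>y. y \<in> F \<Longrightarrow> 0 < v y" and le: "lap v x \<le> 0"
  shows "0 \<le> lap (\<lambda>y. - ln (v y)) x"
proof -
  have "lap v x / v x \<le> 0" using le pos[OF x] by (simp add: divide_le_0_iff)
  moreover have "- (lap v x / v x) \<le> lap (\<lambda>y. - ln (v y)) x"
    unfolding lap_def sum_divide_distrib sum_negf[symmetric]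
  proof (intro sum_mono)
    fix y assume y: "y \<in> F"
    have "ln (v y / v x) \<le> v y / v x - 1" using pos x y by (intro ln_le_minus_one) simp
    then have "- ((v y - v x) / v x) \<le> - ln (v y) - - ln (v x)"
      using pos[OF x] pos[OF y] by (simp add: ln_div diff_divide_distrib)
    from mult_left_mono[OF this c_nonneg[of x y]]
    show "- (c x y * (v y - v x) / v x) \<le> c x y * (- ln (v y) - - ln (v x))" by simp
  qed
  ultimately show ?thesis by simp
qed

text \<open>Edgewise, the squared increment of \<open>\<phi> * u\<close> is the increment of
  \<open>u\<close> times that of \<open>\<phi>^2 * u\<close>, plus the term on the right. The first
  part sums to \<open>en u (\<phi>^2 * u)\<close>, which subharmonicity makes nonpositive.\<close>

lemma caccioppoli:
  assumes u: "\<And>x. x \<in> F \<Longrightarrow> 0 \<le> u x"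
    and sub: "\<And>x. x \<in> F \<Longrightarrow> \<phi> x \<noteq> 0 \<Longrightarrow> 0 \<le> lap u x"
  shows "en (\<lambda>x. \<phi> x * u x) (\<lambda>x. \<phi> x * u x) \<le> (\<Sum>x\<in>F. \<Sum>y\<in>F. c x y * (u x * u y * (\<phi> x - \<phi> y)^2))"
proof -
  have "en (\<lambda>x. \<phi> x * u x) (\<lambda>x. \<phi> x * u x) =
     en u (\<lambda>x. (\<phi> x)^2 * u x) + (\<Sum>x\<in>F. \<Sum>y\<in>F. c x y * (u x * u y * (\<phi> x - \<phi> y)^2))"
    unfolding en_def sum.distrib[symmetric]
    by (intro sum.cong refl) (simp add: algebra_simps power2_eq_square)
  moreover have "en u (\<lambda>x. (\<phi> x)^2 * u x) = - 2 * (\<Sum>x\<in>F. ((\<phi> x)^2 * u x) * lap u x)"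
    by (simp add: sum_mult_lap)
  moreover have "0 \<le> (\<Sum>x\<in>F. ((\<phi> x)^2 * u x) * lap u x)"
  proof (rule sum_nonneg)
    fix x assume "x \<in> F"
    then show "0 \<le> (\<phi> x)^2 * u x * lap u x" using u sub by (cases "\<phi> x = 0") auto
  qed
  ultimately show ?thesis by simp
qed

text \<open>The conductances enter only through the gradient of \<open>\<phi>\<close>; this is why
  cutoffs that are flat across large conductances give uniform bounds.\<close>

lemma caccioppoli_bound:
  assumes u: "\<And>x. x \<in> F \<Longrightarrow> 0 \<le> u x"
    and sub: "\<And>x. x \<in> F \<Longrightarrow> \<phi> x \<noteq> 0 \<Longrightarrow> 0 \<le> lap u x"
    and B: "\<And>x. x \<in> F \<Longrightarrow> (\<Sum>y\<in>F. c x y * (\<phi> x - \<phi> y)^2) \<le> (if x \<in> S then B else 0)"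
  shows "en (\<lambda>x. \<phi> x * u x) (\<lambda>x. \<phi> x * u x) \<le> B * (\<Sum>x\<in>F \<inter> S. (u x)^2)"
proof -
  have "en (\<lambda>x. \<phi> x * u x) (\<lambda>x. \<phi> x * u x) \<le> (\<Sum>x\<in>F. \<Sum>y\<in>F. c x y * (u x * u y * (\<phi> x - \<phi> y)^2))"
    by (rule caccioppoli[OF u sub])
  also have "... \<le> (\<Sum>x\<in>F. \<Sum>y\<in>F. (u x)^2/2 * (c x y * (\<phi> x - \<phi> y)^2) + (u y)^2/2 * (c x y * (\<phi> x - \<phi> y)^2))"
  proof (intro sum_mono)
    fix x y
    have "u x * u y \<le> (u x)^2/2 + (u y)^2/2"
      using sum_squares_bound[of "u x" "u y"] by (simp add: field_simps)
    from mult_right_mono[OF this, of "c x y * (\<phi> x - \<phi> y)^2"]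
    show "c x y * (u x * u y * (\<phi> x - \<phi> y)^2)
        \<le> (u x)^2/2 * (c x y * (\<phi> x - \<phi> y)^2) + (u y)^2/2 * (c x y * (\<phi> x - \<phi> y)^2)"
      using c_nonneg[of x y] by (simp add: algebra_simps)
  qed
  also have "... = (\<Sum>x\<in>F. \<Sum>y\<in>F. (u x)^2/2 * (c x y * (\<phi> x - \<phi> y)^2))
      + (\<Sum>x\<in>F. \<Sum>y\<in>F. (u y)^2/2 * (c x y * (\<phi> x - \<phi> y)^2))"
    by (simp add: sum.distrib)
  also have "(\<Sum>x\<in>F. \<Sum>y\<in>F. (u y)^2/2 * (c x y * (\<phi> x - \<phi> y)^2))
      = (\<Sum>x\<in>F. \<Sum>y\<in>F. (u x)^2/2 * (c x y * (\<phi> x - \<phi> y)^2))"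
    by (subst sum.swap) (simp add: c_sym power2_commute)
  also have "(\<Sum>x\<in>F. \<Sum>y\<in>F. (u x)^2/2 * (c x y * (\<phi> x - \<phi> y)^2)) + (\<Sum>x\<in>F. \<Sum>y\<in>F. (u x)^2/2 * (c x y * (\<phi> x - \<phi> y)^2))
      = (\<Sum>x\<in>F. (u x)^2 * (\<Sum>y\<in>F. c x y * (\<phi> x - \<phi> y)^2))"
    by (simp add: sum.distrib[symmetric] sum_distrib_left mult_ac)
  also have "... \<le> (\<Sum>x\<in>F. (u x)^2 * (if x \<in> S then B else 0))"
    by (intro sum_mono mult_left_mono B) auto
  also have "... = B * (\<Sum>x\<in>F \<inter> S. (u x)^2)"
    by (simp add: sum.inter_restrict[OF finite_F] sum_distrib_left if_distrib mult.commute cong: if_cong)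
  finally show ?thesis .
qed

end

section \<open>Logarithmic energy of superharmonic functions\<close>

lemma ln_square_le:
  fixes t :: real
  assumes "0 < t"
  shows "(ln t)^2 \<le> 4 * (t + 1/t - 2)"
proof -
  \<comment> \<open>\<open>t + 1/t - 2\<close> is the square of \<open>s - 1/s\<close> for
    \<open>s = sqrt t\<close>. Both sides are invariant under inverting \<open>t\<close>, so this
    range suffices.\<close>
  have *: "(ln t)^2 \<le> 4 * (t + 1/t - 2)" if "1 \<le> t" for t :: real
  proof -
    define s where "s = sqrt t"
    have s: "1 \<le> s" "t = s^2" using that by (auto simp: s_def)
    define r where "r = inverse s"
    have r: "r \<le> 1" using s by (simp add: r_def inverse_le_1_iff)
    have "ln t = 2 * ln s" using s by (simp add: ln_realpow)
    moreover have "ln s \<le> s - 1" using s by (intro ln_le_minus_one) simp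
    ultimately have ub: "ln t \<le> 2 * (s - r)" using r by argo
    have "0 \<le> ln t" using that by simp
    with ub have "(ln t)^2 \<le> (2 * (s - r))^2" by (intro power_mono) auto
    also have "... = 4 * (t + 1/t - 2)" using s by (simp add: r_def power2_eq_square field_simps)
    finally show ?thesis .
  qed
  show ?thesis
  proof (cases "1 \<le> t")
    case True then show ?thesis by (rule *)
  next
    case False
    then have "(ln (1/t))^2 \<le> 4 * (1/t + 1/(1/t) - 2)" using assms by (intro *) simp
    then show ?thesis using assms by (simp add: ln_div)
  qed
qed

text \<open>Edgewise form of testing superharmonicity of \<open>v\<close> with
  \<open>\<phi>^2 / v\<close>: \<open>a\<close>, \<open>b\<close> are the values of \<open>v\<close>
  and \<open>\<alpha>\<close>, \<open>\<beta>\<close> those of \<open>\<phi>\<close> at the two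
  ends. Giving the logarithmic term the smaller weight makes the statement symmetric in the
  ends.\<close>

lemma log_test_ineq:
  fixes a b \<alpha> \<beta> :: real
  assumes "0 < a" "0 < b" "0 \<le> \<alpha>" "0 \<le> \<beta>"
  shows "(b - a) * (\<beta>^2/b - \<alpha>^2/a) \<le> - ((min \<alpha> \<beta>)^2 * (ln b - ln a)^2 / 8) + 3 * (\<beta> - \<alpha>)^2"
proof -
  have *: "(b - a) * (\<beta>^2/b - \<alpha>^2/a) \<le> - ((min \<alpha> \<beta>)^2 * (ln b - ln a)^2 / 8) + 3 * (\<beta> - \<alpha>)^2"
    if "0 < a" "0 < b" "0 \<le> \<alpha>" "\<alpha> \<le> \<beta>" for a b \<alpha> \<beta> :: real
  proof -
    define t where "t = b / a"
    have t: "0 < t" using that by (simp add: t_def)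
    define q where "q = t + 1/t - 2"
    have lnq: "(ln b - ln a)^2 \<le> 4 * q"
      using ln_square_le[OF t] that by (simp add: t_def q_def ln_div)
    have q0: "0 \<le> q" using lnq by (smt (verit) zero_le_power2)
    have eq: "(b - a) * (\<beta>^2/b - \<alpha>^2/a) = - (\<alpha>^2 * q) + (\<beta>^2 - \<alpha>^2) * (1 - 1/t)"
      using that by (simp add: t_def q_def field_simps power2_eq_square)
    have d: "(\<beta>^2 - \<alpha>^2) * (1 - 1/t) \<le> \<alpha>^2 * q / 2 + 3 * (\<beta> - \<alpha>)^2"
    proof (cases "1 \<le> t")
      case False
      then have "1 - 1/t \<le> 0" using t by simp
      moreover have "0 \<le> \<beta>^2 - \<alpha>^2" using that by (simp add: power_mono)
      ultimately have "(\<beta>^2 - \<alpha>^2) * (1 - 1/t) \<le> 0" by (simp add: mult_nonneg_nonpos)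
      moreover have "0 \<le> \<alpha>^2 * q / 2 + 3 * (\<beta> - \<alpha>)^2" using q0 by simp
      ultimately show ?thesis by linarith
    next
      case True
      \<comment> \<open>Here \<open>r^2 \<le> q\<close>, so Young's inequality absorbs the cross
        term into half of \<open>\<alpha>^2 * q\<close>.\<close>
      define r where "r = 1 - 1/t"
      have r: "0 \<le> r" "r \<le> 1" using True by (auto simp: r_def)
      have "r^2 * t = q" using t by (simp add: r_def q_def field_simps power2_eq_square)
      moreover have "r^2 * 1 \<le> r^2 * t" using True by (intro mult_left_mono) auto
      ultimately have rq: "r^2 \<le> q" by simp
      have "(\<beta>^2 - \<alpha>^2) * r = 2 * (\<beta> - \<alpha>) * (\<alpha> * r) + (\<beta> - \<alpha>)^2 * r"
        by (simp add: algebra_simps power2_eq_square)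
      also have "2 * (\<beta> - \<alpha>) * (\<alpha> * r) \<le> 2 * (\<beta> - \<alpha>)^2 + (\<alpha> * r)^2 / 2"
      proof -
        have "0 \<le> (2 * (\<beta> - \<alpha>) - \<alpha> * r)^2" by simp
        then show ?thesis by (simp add: power2_eq_square algebra_simps)
      qed
      also have "(\<beta> - \<alpha>)^2 * r \<le> (\<beta> - \<alpha>)^2" using r by (simp add: mult_left_le)
      also have "(\<alpha> * r)^2 \<le> \<alpha>^2 * q" unfolding power_mult_distrib using rq by (intro mult_left_mono) auto
      finally show ?thesis by (simp add: r_def)
    qed
    have "\<alpha>^2 * (ln b - ln a)^2 \<le> \<alpha>^2 * (4 * q)" using lnq by (intro mult_left_mono) auto
    then have "- (\<alpha>^2 * q / 2) \<le> - (\<alpha>^2 * (ln b - ln a)^2 / 8)" by simp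
    moreover have "min \<alpha> \<beta> = \<alpha>" using that by simp
    ultimately show ?thesis using eq d by linarith
  qed
  show ?thesis
  proof (cases "\<alpha> \<le> \<beta>")
    case True then show ?thesis using assms * by blast
  next
    case False
    then have "(a - b) * (\<alpha>^2/a - \<beta>^2/b) \<le> - ((min \<beta> \<alpha>)^2 * (ln a - ln b)^2 / 8) + 3 * (\<alpha> - \<beta>)^2"
      using assms by (intro *) auto
    moreover have "(b - a) * (X - Y) = (a - b) * (Y - X)" for X Y :: real
      by (simp add: algebra_simps)
    ultimately show ?thesis
      by (simp only: min.commute[of \<beta> \<alpha>] power2_commute[of "ln a"] power2_commute[of \<alpha>])
  qed
qed

context network
begin

text \<open>Testing with \<open>\<phi>^2 / v\<close> makes \<open>en v (\<phi>^2 / v)\<close>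
  nonnegative, and \<open>log_test_ineq\<close> bounds its integrand; 24 is 3 times 8.\<close>

lemma log_energy:
  assumes v: "\<And>x. x \<in> F \<Longrightarrow> 0 < v x" and \<phi>: "\<And>x. x \<in> F \<Longrightarrow> 0 \<le> \<phi> x"
    and sup: "\<And>x. x \<in> F \<Longrightarrow> \<phi> x \<noteq> 0 \<Longrightarrow> lap v x \<le> 0"
  shows "(\<Sum>x\<in>F. \<Sum>y\<in>F. c x y * ((min (\<phi> x) (\<phi> y))^2 * (ln (v x) - ln (v y))^2)) \<le> 24 * en \<phi> \<phi>"
proof -
  have "(\<Sum>x\<in>F. ((\<phi> x)^2 / v x) * lap v x) \<le> 0"
  proof (rule sum_nonpos)
    fix x assume "x \<in> F"
    then show "(\<phi> x)^2 / v x * lap v x \<le> 0" using v[of x] sup[of x]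
      by (cases "\<phi> x = 0") (auto intro!: mult_nonneg_nonpos simp del: times_divide_eq_left)
  qed
  then have "0 \<le> en v (\<lambda>x. (\<phi> x)^2 / v x)" unfolding sum_mult_lap by simp
  also have "... \<le> (\<Sum>x\<in>F. \<Sum>y\<in>F. 3 * (c x y * ((\<phi> x - \<phi> y) * (\<phi> x - \<phi> y)))
       - c x y * ((min (\<phi> x) (\<phi> y))^2 * (ln (v x) - ln (v y))^2) / 8)"
    unfolding en_def
  proof (intro sum_mono)
    fix x y assume "x \<in> F" "y \<in> F"
    then have "(v x - v y) * ((\<phi> x)^2 / v x - (\<phi> y)^2 / v y)
       \<le> - ((min (\<phi> y) (\<phi> x))^2 * (ln (v x) - ln (v y))^2 / 8) + 3 * (\<phi> x - \<phi> y)^2"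
      using v \<phi> by (intro log_test_ineq) auto
    from mult_left_mono[OF this c_nonneg[of x y]]
    show "c x y * ((v x - v y) * ((\<phi> x)^2 / v x - (\<phi> y)^2 / v y))
      \<le> 3 * (c x y * ((\<phi> x - \<phi> y) * (\<phi> x - \<phi> y)))
       - c x y * ((min (\<phi> x) (\<phi> y))^2 * (ln (v x) - ln (v y))^2) / 8"
      by (simp add: algebra_simps power2_eq_square min.commute)
  qed
  also have "... = 3 * en \<phi> \<phi> - (\<Sum>x\<in>F. \<Sum>y\<in>F. c x y * ((min (\<phi> x) (\<phi> y))^2 * (ln (v x) - ln (v y))^2)) / 8"
    unfolding en_def by (simp add: sum_subtractf sum_distrib_left sum_divide_distrib)
  finally show ?thesis by simp
qed

lemma en_add_scale: "en (\<lambda>x. f x + t * g x) (\<lambda>x. f x + t * g x) = en f f + 2 * t * en f g + t^2 * en g g"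
  unfolding en_def sum_distrib_left sum.distrib[symmetric]
  by (intro sum.cong refl) (simp add: algebra_simps power2_eq_square)

lemma en_cauchy_schwarz: "(en f g)^2 \<le> en f f * en g g"
proof -
  have quad: "0 \<le> en f f + 2 * t * en f g + t^2 * en g g" for t
    using en_nonneg[of "\<lambda>x. f x + t * g x"] by (simp add: en_add_scale)
  show ?thesis
  proof (cases "en g g = 0")
    case True
    have "en f g = 0"
    proof (rule ccontr)
      assume "en f g \<noteq> 0"
      \<comment> \<open>The quadratic in \<open>t\<close> is affine in this case, and the chosen
        \<open>t\<close> gives it the value -1.\<close>
      then show False using quad[of "- (en f f + 1) / (2 * en f g)"] True by (simp add: field_simps)
    qed
    then show ?thesis by (simp add: True)
  next
    case False
    then have p: "0 < en g g" using en_nonneg[of g] by linarith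
    have "0 \<le> (en f f + 2 * (- en f g / en g g) * en f g + (- en f g / en g g)^2 * en g g) * en g g"
      using quad[of "- en f g / en g g"] p by (intro mult_nonneg_nonneg) auto
    also have "... = en f f * en g g - (en f g)^2" using p by (simp add: field_simps power2_eq_square)
    finally show ?thesis by simp
  qed
qed

lemma en_pos_part_le: "en (\<lambda>x. max (f x - k) 0) (\<lambda>x. max (f x - k) 0) \<le> en f (\<lambda>x. max (f x - k) 0)"
  unfolding en_def
proof (intro sum_mono mult_left_mono c_nonneg)
  fix x y
  show "(max (f x - k) 0 - max (f y - k) 0) * (max (f x - k) 0 - max (f y - k) 0)
      \<le> (f x - f y) * (max (f x - k) 0 - max (f y - k) 0)"
  proof (cases "k \<le> f x"; cases "k \<le> f y")
    assume "k \<le> f x" "\<not> k \<le> f y"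
    then show ?thesis by (auto simp: max_def intro!: mult_right_mono)
  next
    assume "\<not> k \<le> f x" "k \<le> f y"
    then have "(f y - k) * (f y - k) \<le> (f y - f x) * (f y - k)" by (intro mult_right_mono) auto
    with \<open>\<not> k \<le> f x\<close> \<open>k \<le> f y\<close> show ?thesis by (auto simp: max_def algebra_simps)
  qed (auto simp: max_def)
qed

end

section \<open>Maximum principle, Dirichlet problem and Stampacchia's bound from a Faber-Krahn
  inequality\<close>

locale network_fk = network F c for F :: "'a set" and c +
  fixes \<Omega> :: "'a set" and A :: real and d :: nat
  assumes \<Omega>_sub: "\<Omega> \<subseteq> F" and A_pos: "0 < A" and d_pos: "1 \<le> d"
    and faber_krahn: "\<And>f S. S \<subseteq> \<Omega> \<Longrightarrow> (\<And>x. x \<in> F - S \<Longrightarrow> f x = 0) \<Longrightarrow>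
        (\<Sum>x\<in>F. (f x)^2) \<le> A * real (card S) powr (2 / real d) * en f f"
begin

lemma finite_\<Omega>: "finite \<Omega>" using \<Omega>_sub finite_F finite_subset by blast

lemma en_zero_imp:
  assumes "\<And>x. x \<in> F - \<Omega> \<Longrightarrow> f x = 0" "en f f = 0" "x \<in> F"
  shows "f x = 0"
proof -
  have "(\<Sum>x\<in>F. (f x)^2) \<le> 0" using faber_krahn[of \<Omega> f] assms by simp
  then have "(\<Sum>x\<in>F. (f x)^2) = 0" by (smt (verit) sum_nonneg zero_le_power2)
  then show ?thesis using assms(3) finite_F by (subst (asm) sum_nonneg_eq_0_iff) auto
qed

text \<open>The positive part of \<open>u\<close> has zero energy, and the Faber-Krahn inequality,
  in the role of connectedness, makes it vanish.\<close>

lemma max_principle: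
  assumes S: "S \<subseteq> \<Omega>" and sub: "\<And>x. x \<in> S \<Longrightarrow> 0 \<le> lap u x"
    and bd: "\<And>x. x \<in> F - S \<Longrightarrow> u x \<le> 0" and x: "x \<in> F"
  shows "u x \<le> 0"
proof -
  let ?p = "\<lambda>x. max (u x - 0) 0"
  have "0 \<le> (\<Sum>x\<in>F. ?p x * lap u x)"
  proof (rule sum_nonneg)
    fix x assume "x \<in> F"
    then show "0 \<le> ?p x * lap u x" using sub[of x] bd[of x] by (cases "x \<in> S") auto
  qed
  then have "en u ?p \<le> 0" by (simp add: sum_mult_lap)
  with en_pos_part_le[of u 0] have "en ?p ?p \<le> 0" by simp
  then have "en ?p ?p = 0" using en_nonneg[of ?p] by linarith
  moreover have "?p y = 0" if "y \<in> F - \<Omega>" for y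
    using that S bd[of y] by (cases "y \<in> S") auto
  ultimately have "?p x = 0" using en_zero_imp[of ?p x] x by blast
  then show ?thesis by simp
qed

text \<open>Existence is proved by adding one vertex at a time, as in Gaussian elimination.\<close>

lemma dirichlet_problem_ex:
  assumes "S \<subseteq> \<Omega>"
  shows "\<exists>u. (\<forall>x. x \<notin> S \<longrightarrow> u x = 0) \<and> (\<forall>x\<in>S. lap u x = g x)"
proof -
  have "finite S" using assms finite_\<Omega> finite_subset by blast
  then show ?thesis using assms
  proof (induction S arbitrary: g rule: finite_induct)
    case empty
    then show ?case by (intro exI[of _ "\<lambda>_. 0"]) simp
  next
    case (insert p S)
    obtain u where u: "\<forall>x. x \<notin> S \<longrightarrow> u x = 0" "\<forall>x\<in>S. lap u x = g x"
      using insert.IH[of g] insert.prems by auto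
    define e where "e = (\<lambda>x. if x = p then 1 else 0 :: real)"
    obtain w where w: "\<forall>x. x \<notin> S \<longrightarrow> w x = 0" "\<forall>x\<in>S. lap w x = - lap e x"
      using insert.IH[of "\<lambda>x. - lap e x"] insert.prems by auto
    \<comment> \<open>\<open>v\<close> is harmonic on \<open>S\<close> with value one at
      \<open>p\<close>, so a multiple of it corrects the equation at \<open>p\<close> without
      disturbing those on \<open>S\<close>. The pivot \<open>lap v p\<close> is nonzero, since
      otherwise \<open>v\<close> would have zero energy.\<close>
    define v where "v = (\<lambda>x. 1 * e x + 1 * w x)"
    have v: "\<forall>x\<in>S. lap v x = 0" "v p = 1" "\<forall>x. x \<notin> insert p S \<longrightarrow> v x = 0"
      using w insert.hyps unfolding v_def lap_linear by (auto simp: e_def)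
    have nz: "lap v p \<noteq> 0"
    proof
      assume z: "lap v p = 0"
      have "(\<Sum>x\<in>F. v x * lap v x) = 0"
        by (intro sum.neutral ballI) (metis insertE mult_eq_0_iff v(1,3) z)
      then have "en v v = 0" by (simp add: sum_mult_lap)
      then have "v p = 0" using v(3) insert.prems \<Omega>_sub en_zero_imp[of v p] by blast
      with v(2) show False by simp
    qed
    define t where "t = (g p - lap u p) / lap v p"
    have "lap (\<lambda>x. 1 * u x + t * v x) x = g x" if "x \<in> insert p S" for x
      unfolding lap_linear using that u v nz by (auto simp: t_def)
    then show ?case using u v by (intro exI[of _ "\<lambda>x. 1 * u x + t * v x"]) auto
  qed
qed

lemma green_ex:
  assumes g: "\<And>x. 0 \<le> g x"
  shows "\<exists>u. (\<forall>x. x \<notin> \<Omega> \<longrightarrow> u x = 0) \<and> (\<forall>x\<in>\<Omega>. lap u x = - g x) \<and> (\<forall>x. 0 \<le> u x)"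
proof -
  obtain u where u: "\<forall>x. x \<notin> \<Omega> \<longrightarrow> u x = 0" "\<forall>x\<in>\<Omega>. lap u x = - g x"
    using dirichlet_problem_ex[of \<Omega> "\<lambda>x. - g x"] by auto
  have "- u x \<le> 0" if "x \<in> F" for x
    using max_principle[of \<Omega> "\<lambda>x. - u x" x] u g that by (auto simp: lap_uminus)
  then have "0 \<le> u x" for x using u(1) \<Omega>_sub by (cases "x \<in> \<Omega>") auto
  with u show ?thesis by auto
qed


text \<open>Stampacchia's truncation argument. The ratio \<open>q = 2 powr (-d/2)\<close> is chosen so that the
  factor \<open>2 ^ (j + 1)\<close> from the shrinking level gaps is absorbed.\<close>

lemma stampacchia_bound:
  assumes f0: "\<And>x. x \<in> F - \<Omega> \<Longrightarrow> f x = 0" and sub: "\<And>x. x \<in> \<Omega> \<Longrightarrow> - 1 \<le> lap f x"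
    and k0: "0 \<le> k0" and a0: "real (card {x\<in>\<Omega>. k0 < f x}) \<le> a0" and x: "x \<in> \<Omega>"
  shows "f x \<le> k0 + 4 * A * 2 ^ d * a0 powr (2 / real d)"
proof -
  define \<alpha> where "\<alpha> = 2 / real d"
  have \<alpha>: "0 < \<alpha>" using d_pos by (simp add: \<alpha>_def)
  define S where "S k = {x\<in>\<Omega>. k < f x}" for k
  define a where "a k = real (card (S k))" for k
  have S_sub: "S k \<subseteq> \<Omega>" for k by (auto simp: S_def)
  have finS: "finite (S k)" for k using S_sub finite_\<Omega> finite_subset by blast
  \<comment> \<open>Testing with \<open>p\<close> bounds its energy by twice its sum
    \<open>I\<close>; Faber-Krahn and Cauchy-Schwarz on \<open>S k\<close> then bound
    \<open>I\<close>, and Chebyshev at level \<open>l\<close> gives the claim.\<close>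
  have level: "(l - k) * a l \<le> 2 * A * (a k powr \<alpha> * a k)" if k: "0 \<le> k" "k < l" for k l
  proof -
    define p where "p = (\<lambda>x. max (f x - k) 0)"
    have p0: "p x = 0" if "x \<in> F - S k" for x
      using that f0[of x] k by (cases "x \<in> \<Omega>") (auto simp: p_def S_def)
    have pnn: "0 \<le> p x" for x by (simp add: p_def)
    have restr: "(\<Sum>x\<in>F. p x ^ j) = (\<Sum>x\<in>S k. p x ^ j)" if "0 < j" for j
      by (rule sum.mono_neutral_right[OF finite_F]) (use S_sub \<Omega>_sub p0 that in \<open>auto simp: power_0_left\<close>)
    define I where "I = (\<Sum>x\<in>S k. p x)"
    have I0: "0 \<le> I" unfolding I_def using pnn by (intro sum_nonneg) auto
    have "en p p \<le> en f p" unfolding p_def by (rule en_pos_part_le)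
    also have "... = 2 * (\<Sum>x\<in>F. p x * - lap f x)"
      using sum_mult_lap[of p f] by (simp add: sum_negf)
    also have "(\<Sum>x\<in>F. p x * - lap f x) \<le> (\<Sum>x\<in>F. p x)"
    proof (rule sum_mono)
      fix x assume x: "x \<in> F"
      show "p x * - lap f x \<le> p x"
      proof (cases "x \<in> \<Omega>")
        case True
        then show ?thesis using mult_left_mono[OF _ pnn[of x], of "- lap f x" 1] sub[OF True] by simp
      next
        case False
        then have "p x = 0" using p0[of x] x S_sub[of k] by auto
        then show ?thesis by simp
      qed
    qed
    finally have enp: "en p p \<le> 2 * I" using restr[of 1] by (simp add: I_def)
    have "(\<Sum>x\<in>S k. p x ^ 2) \<le> A * a k powr \<alpha> * en p p"
      using faber_krahn[of "S k" p, OF S_sub p0] restr[of 2] by (simp add: a_def \<alpha>_def)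
    also have "... \<le> A * a k powr \<alpha> * (2 * I)"
      using enp A_pos by (intro mult_left_mono) auto
    finally have sq: "(\<Sum>x\<in>S k. p x ^ 2) \<le> A * a k powr \<alpha> * (2 * I)" .
    have "I^2 \<le> (\<Sum>x\<in>S k. p x ^ 2) * (\<Sum>x\<in>S k. 1 ^ 2)"
      using Cauchy_Schwarz_ineq_sum[of p "\<lambda>_. 1" "S k"] by (simp add: I_def)
    also have "... \<le> A * a k powr \<alpha> * (2 * I) * a k"
      using sq by (auto simp: a_def intro!: mult_right_mono)
    finally have "I * I \<le> (2 * A * (a k powr \<alpha> * a k)) * I" by (simp add: power2_eq_square algebra_simps)
    then have I_le: "I \<le> 2 * A * (a k powr \<alpha> * a k)"
      using I0 A_pos by (cases "I = 0") (auto simp: a_def)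
    have "(l - k) * a l = (\<Sum>x\<in>S l. l - k)" by (simp add: a_def)
    also have "... \<le> (\<Sum>x\<in>S l. p x)" by (intro sum_mono) (auto simp: S_def p_def)
    also have "... \<le> I" unfolding I_def
      using k by (intro sum_mono2 finS pnn) (auto simp: S_def)
    finally show ?thesis using I_le by linarith
  qed
  show ?thesis
  proof (cases "a k0 = 0")
    case True
    then have "S k0 = {}" using finS by (simp add: a_def)
    then have "f x \<le> k0" using x by (auto simp: S_def)
    moreover have "0 \<le> 4 * A * 2 ^ d * a0 powr (2 / real d)" using A_pos by simp
    ultimately show ?thesis by linarith
  next
    case False
    have a0': "0 < a k0" "a k0 \<le> a0" using False a0 by (auto simp: a_def S_def)
    define b where "b = a k0"
    \<comment> \<open>With this \<open>T\<close> the recursion below has the factor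
      \<open>4 * A * b powr \<alpha> / T = 1 / 2 ^ d\<close>, which is at most
      \<open>q\<close>.\<close>
    define T where "T = 4 * A * 2 ^ d * b powr \<alpha>"
    have T: "0 < T" using A_pos a0' by (simp add: T_def b_def)
    define q :: real where "q = 2 powr (- real d / 2)"
    have q: "0 < q" "q < 1" using d_pos by (auto simp: q_def powr_less_one)
    have q_pow: "(q ^ j) powr \<alpha> * 2 ^ j = 1" for j
    proof -
      have "(q ^ j) powr \<alpha> = 2 powr (- real j)"
        unfolding powr_realpow[OF q(1), symmetric] using d_pos by (simp add: q_def \<alpha>_def powr_powr)
      also have "... = inverse (2 ^ j)" by (simp add: powr_minus powr_realpow)
      finally show ?thesis by simp
    qed
    have q_low: "1 / 2 ^ d \<le> q"
    proof -
      have "1 / 2 ^ d = (2::real) powr (- real d)" by (simp add: powr_minus powr_realpow divide_inverse)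
      also have "... \<le> q" unfolding q_def by (intro powr_mono) auto
      finally show ?thesis .
    qed
    define k where "k j = k0 + T * (1 - 1 / 2 ^ j)" for j :: nat
    have k_nn: "0 \<le> k j" for j using k0 T by (simp add: k_def)
    have k_diff: "k (Suc j) - k j = T / 2 ^ (Suc j)" for j
      by (simp add: k_def field_simps)
    have decay: "a (k j) \<le> b * q ^ j" for j
    proof (induction j)
      case 0 show ?case by (simp add: k_def b_def)
    next
      case (Suc j)
      have lt: "k j < k (Suc j)" using k_diff[of j] T by (smt (verit) zero_less_divide_iff zero_less_power)
      have "T / 2 ^ (Suc j) * a (k (Suc j)) \<le> 2 * A * (a (k j) powr \<alpha> * a (k j))"
        using level[OF k_nn lt] k_diff[of j] by simp
      also have "... \<le> 2 * A * ((b * q ^ j) powr \<alpha> * (b * q ^ j))"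
        using Suc.IH A_pos \<alpha> a0'(1) q by (intro mult_left_mono mult_mono powr_mono2) (auto simp: a_def b_def)
      also have "(b * q ^ j) powr \<alpha> = b powr \<alpha> * (q ^ j) powr \<alpha>"
        using a0' q by (simp add: powr_mult b_def)
      finally have "a (k (Suc j)) \<le> 2 ^ Suc j / T * (2 * A * (b powr \<alpha> * (q ^ j) powr \<alpha> * (b * q ^ j)))"
        using T by (simp add: field_simps)
      also have "... = (4 * A * b powr \<alpha> / T) * (b * q ^ j) * ((q ^ j) powr \<alpha> * 2 ^ j)"
        by (simp add: mult_ac)
      also have "... = (4 * A * b powr \<alpha> / T) * (b * q ^ j)" by (simp add: q_pow)
      also have "4 * A * b powr \<alpha> / T = 1 / 2 ^ d"
        using A_pos a0' by (simp add: T_def b_def)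
      also have "1 / 2 ^ d * (b * q ^ j) \<le> q * (b * q ^ j)"
        using q_low a0' q by (intro mult_right_mono) (auto simp: b_def)
      finally show ?case by (simp add: mult_ac)
    qed
    have "\<exists>j. b * q ^ j < 1"
    proof -
      have "(\<lambda>j. b * q ^ j) \<longlonglongrightarrow> b * 0" using q by (intro tendsto_intros LIMSEQ_realpow_zero) auto
      then have "\<forall>\<^sub>F j in sequentially. b * q ^ j < 1" by (simp add: order_tendstoD)
      then show ?thesis by (auto simp: eventually_sequentially)
    qed
    then obtain j where "b * q ^ j < 1" by blast
    \<comment> \<open>\<open>a\<close> counts vertices, so a value below one means that the level
      set is empty.\<close>
    with decay[of j] have "a (k j) < 1" by linarith
    then have "S (k j) = {}" using finS by (simp add: a_def)
    then have "f x \<le> k j" using x by (auto simp: S_def)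
    also have "... \<le> k0 + T" using T by (simp add: k_def algebra_simps)
    also have "T \<le> 4 * A * 2 ^ d * a0 powr \<alpha>"
      unfolding T_def using a0' \<alpha> A_pos by (intro mult_left_mono powr_mono2) (auto simp: b_def)
    finally show ?thesis by (simp add: \<alpha>_def)
  qed
qed

end

section \<open>De Giorgi iteration\<close>

text \<open>The function \<open>\<rho>\<close> plays the role of a distance that does not see edges of large
  conductance: its gradient is of order \<open>1 / sqrt (c x y)\<close>.\<close>

locale harnack_network = network_fk F c \<Omega> A d
  for F :: "'a set" and c and \<Omega> and A :: real and d :: nat +
  fixes \<rho> :: "'a \<Rightarrow> real" and K :: real and D :: nat and \<epsilon> :: real
  assumes K_pos: "0 < K"
    and \<rho>_lip: "\<And>x y. x \<in> F \<Longrightarrow> y \<in> F \<Longrightarrow> c x y * (\<rho> x - \<rho> y)^2 \<le> K"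
    and c_ge: "\<And>x y. c x y = 0 \<or> 1 \<le> c x y"
    and degree: "\<And>x. x \<in> F \<Longrightarrow> card {y\<in>F. c x y \<noteq> 0} \<le> D"
    and \<epsilon>_pos: "0 < \<epsilon>"
    and \<epsilon>_small: "16 * A * real D * K * 4 powr (2 / real d) * \<epsilon> powr (2 / real d) * 2 ^ (d + 2) \<le> 1"
    and \<epsilon>_small': "\<epsilon> * (4 * sqrt K) ^ d \<le> 1"
begin

definition cutoff :: "real \<Rightarrow> real \<Rightarrow> 'a \<Rightarrow> real" where
  "cutoff t g x = max 0 (min 1 ((t - \<rho> x) / g))"

lemma cutoff_bounds: "0 \<le> cutoff t g x" "cutoff t g x \<le> 1"
  by (auto simp: cutoff_def)

lemma cutoff_eq_1: "0 < g \<Longrightarrow> \<rho> x \<le> t - g \<Longrightarrow> cutoff t g x = 1"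
  by (simp add: cutoff_def field_simps)

lemma cutoff_eq_0: "0 < g \<Longrightarrow> t \<le> \<rho> x \<Longrightarrow> cutoff t g x = 0"
  by (simp add: cutoff_def divide_nonpos_pos)

lemma cutoff_diff: "0 < g \<Longrightarrow> (cutoff t g x - cutoff t g y)^2 \<le> (\<rho> x - \<rho> y)^2 / g^2"
proof -
  assume g: "0 < g"
  have *: "\<bar>max 0 (min 1 a) - max 0 (min 1 b)\<bar> \<le> \<bar>a - b\<bar>" for a b :: real
    by (auto simp: max_def min_def)
  have "\<bar>cutoff t g x - cutoff t g y\<bar> \<le> \<bar>(t - \<rho> x) / g - (t - \<rho> y) / g\<bar>"
    unfolding cutoff_def by (rule *)
  also have "(t - \<rho> x) / g - (t - \<rho> y) / g = (\<rho> y - \<rho> x) / g" by (simp add: diff_divide_distrib)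
  finally have "(cutoff t g x - cutoff t g y)^2 \<le> ((\<rho> y - \<rho> x) / g)^2" by (rule abs_le_square_iff[THEN iffD1])
  then show ?thesis by (simp add: power_divide power2_commute)
qed

lemma \<rho>_neighbour:
  assumes "x \<in> F" "y \<in> F" "c x y \<noteq> 0"
  shows "\<bar>\<rho> x - \<rho> y\<bar> \<le> sqrt K"
proof -
  have "1 * (\<rho> x - \<rho> y)^2 \<le> c x y * (\<rho> x - \<rho> y)^2"
    using c_ge[of x y] assms by (intro mult_right_mono) auto
  with \<rho>_lip[of x y] assms have "(\<rho> x - \<rho> y)^2 \<le> K" by simp
  then show ?thesis by (simp add: real_le_rsqrt)
qed

text \<open>The Lipschitz bound for \<rho> cancels the conductance. Since nonzero conductances are
  at least one, an edge changes \<rho> by at most \<open>sqrt K\<close>; beyond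
  \<open>t + sqrt K\<close> all neighbours therefore lie where the cutoff vanishes.\<close>

lemma cutoff_energy_at:
  assumes x: "x \<in> F" and g: "0 < g"
  shows "(\<Sum>y\<in>F. c x y * (cutoff t g x - cutoff t g y)^2)
     \<le> (if x \<in> {z. \<rho> z < t + sqrt K} then real D * K / g^2 else 0)"
proof -
  have restr: "(\<Sum>y\<in>F. c x y * (cutoff t g x - cutoff t g y)^2) =
     (\<Sum>y\<in>{y\<in>F. c x y \<noteq> 0}. c x y * (cutoff t g x - cutoff t g y)^2)"
    by (rule sum.mono_neutral_right) (use finite_F in auto)
  show ?thesis
  proof (cases "\<rho> x < t + sqrt K")
    case True
    have "(\<Sum>y\<in>{y\<in>F. c x y \<noteq> 0}. c x y * (cutoff t g x - cutoff t g y)^2)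
       \<le> (\<Sum>y\<in>{y\<in>F. c x y \<noteq> 0}. K / g^2)"
    proof (rule sum_mono)
      fix y assume y: "y \<in> {y\<in>F. c x y \<noteq> 0}"
      have "c x y * (cutoff t g x - cutoff t g y)^2 \<le> c x y * ((\<rho> x - \<rho> y)^2 / g^2)"
        by (intro mult_left_mono cutoff_diff g c_nonneg)
      also have "... = (c x y * (\<rho> x - \<rho> y)^2) / g^2" by simp
      also have "... \<le> K / g^2" using \<rho>_lip[OF x] y by (intro divide_right_mono) auto
      finally show "c x y * (cutoff t g x - cutoff t g y)^2 \<le> K / g^2" .
    qed
    also have "... = real (card {y\<in>F. c x y \<noteq> 0}) * (K / g^2)" by simp
    also have "... \<le> real D * (K / g^2)" using degree[OF x] K_pos by (intro mult_right_mono) auto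
    finally show ?thesis using True restr by simp
  next
    case False
    have "(\<Sum>y\<in>{y\<in>F. c x y \<noteq> 0}. c x y * (cutoff t g x - cutoff t g y)^2) = 0"
    proof (intro sum.neutral ballI)
      fix y assume y: "y \<in> {y\<in>F. c x y \<noteq> 0}"
      have sK: "0 \<le> sqrt K" using K_pos by simp
      have "\<bar>\<rho> x - \<rho> y\<bar> \<le> sqrt K" using \<rho>_neighbour[OF x] y by auto
      then have "t \<le> \<rho> y" "t \<le> \<rho> x" using False sK by linarith+
      then show "c x y * (cutoff t g x - cutoff t g y)^2 = 0" using g by (simp add: cutoff_eq_0)
    qed
    then show ?thesis using False restr by simp
  qed
qed

lemma cutoff_energy:
  assumes g: "0 < g"
  shows "en (cutoff t g) (cutoff t g) \<le> real (card F) * (real D * K / g^2)"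
proof -
  have "en (cutoff t g) (cutoff t g) \<le> (\<Sum>x\<in>F. real D * K / g^2)"
    unfolding en_def
  proof (rule sum_mono)
    fix x assume x: "x \<in> F"
    have "0 \<le> real D * K / g^2" using K_pos by simp
    then show "(\<Sum>y\<in>F. c x y * ((cutoff t g x - cutoff t g y) * (cutoff t g x - cutoff t g y))) \<le> real D * K / g^2"
      using cutoff_energy_at[OF x g, of t] by (auto simp: power2_eq_square split: if_splits)
  qed
  then show ?thesis by simp
qed

lemma powr_pow_swap: "0 < x \<Longrightarrow> ((x::real) ^ d) powr (2 / real d) = x^2"
proof -
  assume x: "0 < x"
  then have "x ^ d = x powr (real d)" by (simp add: powr_realpow)
  then have "(x ^ d) powr (2 / real d) = x powr 2" using d_pos by (simp add: powr_powr)
  then show ?thesis using x by (simp add: powr_numeral)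
qed

text \<open>De Giorgi iteration over levels \<open>M (1 - 2 ^ (- k))\<close> and radii \<open>s + g 2 ^ (- k)\<close>. It is stopped
  when the gap between consecutive radii reaches the lattice scale; by then the remaining
  square mass is so small that it controls the supremum.\<close>

lemma de_giorgi:
  assumes g: "0 < g" and sub_\<Omega>: "{x\<in>F. \<rho> x < s + g} \<subseteq> \<Omega>"
    and u: "\<And>x. x \<in> F \<Longrightarrow> 0 \<le> u x"
    and subharm: "\<And>x. x \<in> F \<Longrightarrow> \<rho> x < s + g \<Longrightarrow> 0 \<le> lap u x"
    and x: "x \<in> F" "\<rho> x \<le> s"
  shows "(u x)^2 \<le> 4 / (\<epsilon> * g ^ d) * (\<Sum>y\<in>{y\<in>F. \<rho> y < s + g}. (u y)^2)"
proof -
  define \<alpha> where "\<alpha> = 2 / real d"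
  have \<alpha>: "0 < \<alpha>" using d_pos by (simp add: \<alpha>_def)
  define S where "S k = {x\<in>F. \<rho> x < s + g / 2 ^ k}" for k :: nat
  have finS: "finite (S k)" for k using finite_F by (simp add: S_def)
  have S0: "S k \<subseteq> {x\<in>F. \<rho> x < s + g}" for k
  proof -
    have "g / 2 ^ k \<le> g / 1" using g by (intro divide_left_mono) auto
    then show ?thesis by (auto simp: S_def)
  qed
  define I where "I = (\<Sum>y\<in>S 0. (u y)^2)"
  have I0: "0 \<le> I" by (simp add: I_def sum_nonneg)
  have xS: "x \<in> S k" for k using x g by (auto simp: S_def intro: le_less_trans)
  have goal_eq: "(\<Sum>y\<in>{y\<in>F. \<rho> y < s + g}. (u y)^2) = I" by (simp add: I_def S_def)
  show ?thesis
  proof (cases "I = 0")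
    case True
    then have "(u x)^2 = 0" using xS[of 0] finS[of 0] unfolding I_def
      by (subst (asm) sum_nonneg_eq_0_iff) auto
    then show ?thesis using goal_eq True by simp
  next
    case False
    \<comment> \<open>Normalised so that the initial square mass \<open>I\<close> is
      \<open>\<epsilon>\<close> times \<open>M^2 * g ^ d\<close>.\<close>
    define M where "M = sqrt (I / (\<epsilon> * g ^ d))"
    have M: "0 < M" "M^2 * (\<epsilon> * g ^ d) = I" using False I0 g \<epsilon>_pos by (auto simp: M_def)
    define l where "l k = M * (1 - 1 / 2 ^ k)" for k :: nat
    have l_diff: "l (Suc k) - l k = M / 2 ^ Suc k" for k by (simp add: l_def field_simps)
    have l_nn: "0 \<le> l k" for k using M by (simp add: l_def)
    have l_le: "l k \<le> M" for k using M by (simp add: l_def algebra_simps)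
    define w where "w k = (\<lambda>x. max (u x - l k) 0)" for k
    define Y where "Y k = (\<Sum>x\<in>S k. (w k x)^2)" for k
    have Y_nn: "0 \<le> Y k" for k by (simp add: Y_def sum_nonneg)
    \<comment> \<open>The rate for which \<open>(4 * q) powr \<alpha> = 1 / 4\<close>. Per step the
      shrinking level gaps cost a factor 4 under the power \<alpha>, and the steeper cutoff costs
      another 4; this rate compensates both.\<close>
    define q :: real where "q = 1 / 2 ^ (d + 2)"
    have q: "0 < q" by (simp add: q_def)
    have q_pow: "(q ^ k * 4 ^ k) powr \<alpha> * 4 ^ k = 1" for k
    proof -
      have "q ^ k * 4 ^ k = ((1 / 2 ^ k) ^ d :: real)"
      proof -
        have "q * 4 = 1 / 2 ^ d" by (simp add: q_def field_simps power_add)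
        then have "q ^ k * 4 ^ k = (1 / 2 ^ d) ^ k" by (simp add: power_mult_distrib[symmetric])
        then show ?thesis by (simp add: power_divide power_mult[symmetric] mult.commute)
      qed
      then have "(q ^ k * 4 ^ k) powr \<alpha> = (1 / 2 ^ k)^2" using powr_pow_swap[of "1 / 2 ^ k"] by (simp add: \<alpha>_def)
      also have "... * 4 ^ k = 1" by (simp add: power_divide power_mult[symmetric] mult.commute[of k] power_mult)
      finally show ?thesis by simp
    qed
    have step: "Y (Suc k) \<le> q * Y k"
      if gap: "sqrt K \<le> g / 2 ^ (k + 2)" and IH: "Y k \<le> I * q ^ k" for k
    proof -
      \<comment> \<open>A quarter of \<open>g / 2 ^ k\<close>: the cutoff falls to zero within one
        quarter, and the next one contains the overshoot \<open>sqrt K\<close> of its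
        gradient.\<close>
      define h where "h = g / 2 ^ (k + 2)"
      have h: "0 < h" "sqrt K \<le> h" using g gap by (auto simp: h_def)
      define t where "t = s + g / 2 ^ Suc k + h"
      have t_le: "t + h = s + g / 2 ^ k" by (simp add: t_def h_def field_simps)
      define \<phi> where "\<phi> = cutoff t h"
      define f where "f = (\<lambda>x. \<phi> x * w (Suc k) x)"
      define V where "V = {x\<in>S k. l (Suc k) < u x}"
      have \<phi>0: "\<phi> x = 0" if "t \<le> \<rho> x" for x using that h by (simp add: \<phi>_def cutoff_eq_0)
      have f0: "f x = 0" if "x \<in> F - V" for x
        using that \<phi>0[of x] t_le h by (auto simp: f_def V_def S_def w_def)
      have w_sub: "0 \<le> lap (w (Suc k)) x" if "x \<in> F" "\<phi> x \<noteq> 0" for x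
      proof -
        have "\<rho> x < s + g / 2 ^ k" using \<phi>0[of x] that t_le h by linarith
        with S0[of k] that have "\<rho> x < s + g" by (auto simp: S_def)
        then show ?thesis unfolding w_def by (intro lap_pos_part_nonneg subharm that)
      qed
      have "Y (Suc k) = (\<Sum>x\<in>S (Suc k). (f x)^2)"
        unfolding Y_def
      proof (intro sum.cong refl)
        fix x assume "x \<in> S (Suc k)"
        then have "\<phi> x = 1" using h by (auto simp: \<phi>_def S_def t_def intro!: cutoff_eq_1)
        then show "(w (Suc k) x)^2 = (f x)^2" by (simp add: f_def)
      qed
      also have "... \<le> (\<Sum>x\<in>F. (f x)^2)"
        by (intro sum_mono2 finite_F) (auto simp: S_def)
      also have "... \<le> A * real (card V) powr \<alpha> * en f f"
        unfolding \<alpha>_def by (rule faber_krahn) (use S0 sub_\<Omega> f0 in \<open>auto simp: V_def\<close>)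
      also have "... \<le> A * (g^2 * \<epsilon> powr \<alpha> * (4 powr \<alpha> * (q ^ k * 4 ^ k) powr \<alpha>)) * (real D * K / h^2 * Y k)"
      proof (intro mult_mono mult_left_mono)
        \<comment> \<open>Chebyshev: on \<open>V\<close> the truncation \<open>w k\<close> is at
          least the level gap.\<close>
        have "real (card V) * (M / 2 ^ Suc k)^2 = (\<Sum>x\<in>V. (l (Suc k) - l k)^2)" by (simp add: l_diff)
        also have "... \<le> (\<Sum>x\<in>V. (w k x)^2)"
        proof (intro sum_mono power_mono)
          fix x assume "x \<in> V"
          then show "l (Suc k) - l k \<le> w k x" by (simp add: V_def w_def le_max_iff_disj)
          show "0 \<le> l (Suc k) - l k" using l_diff M by simp
        qed
        also have "... \<le> Y k" unfolding Y_def by (intro sum_mono2 finS) (auto simp: V_def)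
        also have "... \<le> M^2 * (\<epsilon> * g ^ d) * q ^ k" using IH M by simp
        also have "(M / 2 ^ Suc k)^2 = M^2 / (4 * 4 ^ k)"
          by (simp add: power_divide power_mult_distrib power_mult[symmetric] mult.commute[of k] power_mult)
        finally have "real (card V) \<le> g ^ d * (\<epsilon> * (4 * (q ^ k * 4 ^ k)))"
          using M(1) by (simp add: field_simps)
        then have "real (card V) powr \<alpha> \<le> (g ^ d * (\<epsilon> * (4 * (q ^ k * 4 ^ k)))) powr \<alpha>"
          using \<alpha> by (intro powr_mono2) auto
        also have "... = g^2 * \<epsilon> powr \<alpha> * (4 powr \<alpha> * (q ^ k * 4 ^ k) powr \<alpha>)"
          using g \<epsilon>_pos q powr_pow_swap[OF g] by (simp add: powr_mult \<alpha>_def)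
        finally show "real (card V) powr \<alpha> \<le> g^2 * \<epsilon> powr \<alpha> * (4 powr \<alpha> * (q ^ k * 4 ^ k) powr \<alpha>)" .
        have "en f f \<le> real D * K / h^2 * (\<Sum>x\<in>F \<inter> {z. \<rho> z < t + sqrt K}. (w (Suc k) x)^2)"
          unfolding f_def \<phi>_def
          by (rule caccioppoli_bound) (use w_sub h cutoff_energy_at in \<open>auto simp: w_def \<phi>_def\<close>)
        also have "... \<le> real D * K / h^2 * Y k"
        proof (rule mult_left_mono)
          have "(\<Sum>x\<in>F \<inter> {z. \<rho> z < t + sqrt K}. (w (Suc k) x)^2) \<le> (\<Sum>x\<in>S k. (w (Suc k) x)^2)"
            by (intro sum_mono2 finS) (use h t_le in \<open>auto simp: S_def\<close>)
          also have "... \<le> Y k" unfolding Y_def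
          proof (intro sum_mono power_mono)
            fix x
            have "l k \<le> l (Suc k)" using l_diff[of k] M by (smt (verit) zero_less_divide_iff zero_less_power)
            then show "w (Suc k) x \<le> w k x" by (auto simp: w_def)
            show "0 \<le> w (Suc k) x" by (simp add: w_def)
          qed
          finally show "(\<Sum>x\<in>F \<inter> {z. \<rho> z < t + sqrt K}. (w (Suc k) x)^2) \<le> Y k" .
          show "0 \<le> real D * K / h^2" using K_pos by simp
        qed
        finally show "en f f \<le> real D * K / h^2 * Y k" .
      qed (use A_pos en_nonneg in auto)
      also have "... = (16 * A * real D * K * 4 powr \<alpha> * \<epsilon> powr \<alpha>) * (((q ^ k * 4 ^ k) powr \<alpha>) * 4 ^ k) * Y k"
      proof -
        have "h^2 = g^2 / (16 * 4 ^ k)"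
          by (simp add: h_def power_divide power_add power_mult_distrib power_mult[symmetric] mult.commute[of k] power_mult)
        then have e: "g^2 = 16 * 4 ^ k * h^2" by simp
        show ?thesis unfolding e using h(1) by (simp add: field_simps)
      qed
      also have "... = (16 * A * real D * K * 4 powr \<alpha> * \<epsilon> powr \<alpha>) * Y k" by (simp add: q_pow)
      also have "... \<le> q * Y k"
        using \<epsilon>_small Y_nn[of k] by (intro mult_right_mono) (auto simp: q_def \<alpha>_def field_simps)
      finally show ?thesis .
    qed
    have "\<exists>k. g / 2 ^ (k + 2) < sqrt K"
    proof -
      have "(\<lambda>k. (g / 4) * (1/2) ^ k) \<longlonglongrightarrow> g / 4 * 0"
        by (intro tendsto_intros LIMSEQ_realpow_zero) auto
      then have "\<forall>\<^sub>F k in sequentially. (g / 4) * (1/2) ^ k < sqrt K"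
        using K_pos by (intro order_tendstoD[where y = "g / 4 * 0"]) auto
      then obtain k where "(g / 4) * (1/2) ^ k < sqrt K" by (auto simp: eventually_sequentially)
      then show ?thesis by (intro exI[of _ k]) (simp add: power_divide mult.commute)
    qed
    \<comment> \<open>The first index at which the gap condition of \<open>step\<close> fails; there
      \<open>g / 2 ^ k < 4 * sqrt K\<close>.\<close>
    define k where "k = (LEAST k. g / 2 ^ (k + 2) < sqrt K)"
    have k: "g / 2 ^ (k + 2) < sqrt K" unfolding k_def using \<open>\<exists>k. g / 2 ^ (k + 2) < sqrt K\<close> by (rule LeastI_ex)
    have k_min: "sqrt K \<le> g / 2 ^ (j + 2)" if "j < k" for j
      using not_less_Least[of j "\<lambda>k. g / 2 ^ (k + 2) < sqrt K"] that by (simp add: k_def not_less)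
    have Y_le: "j \<le> k \<Longrightarrow> Y j \<le> I * q ^ j" for j
    proof (induction j)
      case 0
      have "Y 0 \<le> I" unfolding Y_def I_def
        by (intro sum_mono power_mono) (use u in \<open>auto simp: w_def l_def S_def\<close>)
      then show ?case by simp
    next
      case (Suc j)
      then have "Y (Suc j) \<le> q * Y j" by (intro step k_min) auto
      also have "... \<le> q * (I * q ^ j)" using Suc q by (intro mult_left_mono) auto
      finally show ?case by (simp add: mult_ac)
    qed
    \<comment> \<open>At the stopping index a single vertex is bounded by the whole sum, and
      \<open>\<epsilon>_small'\<close> makes this at most \<open>M^2\<close>.\<close>
    have "(w k x)^2 \<le> Y k" unfolding Y_def by (rule member_le_sum) (use xS finS in auto)
    also have "... \<le> M^2 * (\<epsilon> * g ^ d) * q ^ k" using Y_le[of k] M by simp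
    also have "... \<le> M^2 * (\<epsilon> * (4 * sqrt K) ^ d)"
    proof -
      have "g ^ d * q ^ k \<le> g ^ d * (1 / 2 ^ k) ^ d"
      proof (rule mult_left_mono)
        have "q ^ k \<le> (1 / 2 ^ d) ^ k" by (rule power_mono) (auto simp: q_def field_simps)
        then show "q ^ k \<le> (1 / 2 ^ k) ^ d" by (simp add: power_divide power_mult[symmetric] mult.commute)
      qed (use g in auto)
      also have "... = (g / 2 ^ k) ^ d" by (simp add: power_divide)
      also have "... \<le> (4 * sqrt K) ^ d"
        using k g by (intro power_mono) (auto simp: field_simps power_add)
      finally have "\<epsilon> * (g ^ d * q ^ k) \<le> \<epsilon> * (4 * sqrt K) ^ d"
        by (rule mult_left_mono) (use \<epsilon>_pos in simp)
      then have "M^2 * (\<epsilon> * (g ^ d * q ^ k)) \<le> M^2 * (\<epsilon> * (4 * sqrt K) ^ d)" by (rule mult_left_mono) simp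
      then show ?thesis by (simp add: mult_ac)
    qed
    also have "... \<le> M^2" using \<epsilon>_small' by (simp add: mult_left_le)
    finally have "(w k x)^2 \<le> M^2" .
    then have "w k x \<le> M" by (rule power2_le_imp_le) (use M in simp)
    then have "u x \<le> 2 * M" using l_le[of k] by (simp add: w_def)
    then have "(u x)^2 \<le> (2 * M)^2" using u x by (intro power_mono) auto
    also have "... = 4 * I / (\<epsilon> * g ^ d)" using M(2) \<epsilon>_pos g by (simp add: field_simps)
    finally show ?thesis using goal_eq by simp
  qed
qed

end

context harnack_network
begin

text \<open>Square means are replaced by means by applying De Giorgi's estimate around a maximum
  of \<open>u x * (2 * r - \<rho> x) ^ d\<close>.\<close>

lemma mean_value:
  assumes r: "0 < r" and sub_\<Omega>: "{x\<in>F. \<rho> x < 2 * r} \<subseteq> \<Omega>"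
    and u: "\<And>x. x \<in> F \<Longrightarrow> 0 \<le> u x"
    and subharm: "\<And>x. x \<in> F \<Longrightarrow> \<rho> x < 2 * r \<Longrightarrow> 0 \<le> lap u x"
    and x: "x \<in> F" "\<rho> x \<le> r"
  shows "u x \<le> 4 ^ (d + 1) / (\<epsilon> * r ^ d) * (\<Sum>y\<in>{y\<in>F. \<rho> y < 2 * r}. u y)"
proof -
  define V where "V = {y\<in>F. \<rho> y < 2 * r}"
  have finV: "finite V" using finite_F by (simp add: V_def)
  have xV: "x \<in> V" using x r by (simp add: V_def)
  define \<Phi> where "\<Phi> y = u y * (2 * r - \<rho> y) ^ d" for y
  have "Max (\<Phi> ` V) \<in> \<Phi> ` V" using finV xV by (intro Max_in) auto
  then obtain z where "z \<in> V" "\<Phi> z = Max (\<Phi> ` V)" by auto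
  then have z: "z \<in> V" "\<And>y. y \<in> V \<Longrightarrow> \<Phi> y \<le> \<Phi> z" using finV by auto
  \<comment> \<open>Half the distance of \<open>\<rho> z\<close> from the outer level. On
    \<open>W\<close> the weight is at least \<open>g ^ d\<close>, against \<open>(2 * g) ^ d\<close>
    at \<open>z\<close>, so maximality of \<open>z\<close> gives \<open>u \<le> 2 ^ d * u z\<close>
    there.\<close>
  define g where "g = (2 * r - \<rho> z) / 2"
  have g: "0 < g" using z(1) by (simp add: g_def V_def)
  define I where "I = (\<Sum>y\<in>V. u y)"
  have uV: "0 \<le> u y" if "y \<in> V" for y using u that by (simp add: V_def)
  have I0: "0 \<le> I" unfolding I_def by (intro sum_nonneg uV)
  define W where "W = {y\<in>F. \<rho> y < \<rho> z + g}"
  have WV: "W \<subseteq> V" using g by (auto simp: W_def V_def g_def field_simps)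
  have bound: "u y \<le> 2 ^ d * u z" if y: "y \<in> W" for y
  proof -
    have "u y * g ^ d \<le> u y * (2 * r - \<rho> y) ^ d"
      using y g WV uV by (intro mult_left_mono power_mono) (auto simp: W_def g_def field_simps)
    also have "... \<le> \<Phi> z" using z(2)[of y] y WV by (auto simp: \<Phi>_def)
    also have "\<Phi> z = 2 ^ d * u z * g ^ d" by (simp add: \<Phi>_def g_def power_divide field_simps)
    finally show ?thesis using g by simp
  qed
  have uz: "u z * g ^ d \<le> 4 * 2 ^ d / \<epsilon> * I"
  proof (cases "u z = 0")
    case True then show ?thesis using I0 \<epsilon>_pos by simp
  next
    case False
    then have uz0: "0 < u z" using uV[OF z(1)] by linarith
    have "(u z)^2 \<le> 4 / (\<epsilon> * g ^ d) * (\<Sum>y\<in>{y\<in>F. \<rho> y < \<rho> z + g}. (u y)^2)"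
    proof (rule de_giorgi[OF g])
      show "{y\<in>F. \<rho> y < \<rho> z + g} \<subseteq> \<Omega>" using WV sub_\<Omega> by (auto simp: W_def V_def)
      show "0 \<le> lap u y" if "y \<in> F" "\<rho> y < \<rho> z + g" for y
        using that WV by (intro subharm) (auto simp: W_def V_def)
    qed (use u z(1) in \<open>auto simp: V_def\<close>)
    also have "... \<le> 4 / (\<epsilon> * g ^ d) * (2 ^ d * u z * I)"
    proof (rule mult_left_mono)
      \<comment> \<open>One factor \<open>u\<close> is replaced by its bound
        \<open>2 ^ d * u z\<close>, and \<open>u z\<close> is cancelled afterwards; this trades the
        square mean for the mean.\<close>
      have "(\<Sum>y\<in>W. (u y)^2) \<le> (\<Sum>y\<in>W. (2 ^ d * u z) * u y)"
        unfolding power2_eq_square using bound WV uV by (intro sum_mono mult_right_mono) auto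
      also have "... = 2 ^ d * u z * (\<Sum>y\<in>W. u y)" by (simp add: sum_distrib_left)
      also have "... \<le> 2 ^ d * u z * I" unfolding I_def
        using uz0 WV finV uV by (intro mult_left_mono sum_mono2) auto
      finally show "(\<Sum>y\<in>{y\<in>F. \<rho> y < \<rho> z + g}. (u y)^2) \<le> 2 ^ d * u z * I" by (simp add: W_def)
      show "0 \<le> 4 / (\<epsilon> * g ^ d)" using \<epsilon>_pos g by simp
    qed
    also have "... = (4 / (\<epsilon> * g ^ d) * (2 ^ d * I)) * u z" by simp
    finally have "u z * u z \<le> (4 / (\<epsilon> * g ^ d) * (2 ^ d * I)) * u z"
      unfolding power2_eq_square .
    then have "u z \<le> 4 / (\<epsilon> * g ^ d) * (2 ^ d * I)" using uz0 by (rule mult_right_le_imp_le)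
    then have "u z * g ^ d \<le> 4 / (\<epsilon> * g ^ d) * (2 ^ d * I) * g ^ d" using g by (intro mult_right_mono) auto
    also have "... = 4 * 2 ^ d / \<epsilon> * I" using g \<epsilon>_pos by (simp add: field_simps)
    finally show ?thesis .
  qed
  have "u x * r ^ d \<le> u x * (2 * r - \<rho> x) ^ d"
    using x r u by (intro mult_left_mono power_mono) auto
  also have "... \<le> \<Phi> z" using z(2)[OF xV] by (simp add: \<Phi>_def)
  also have "\<Phi> z = 2 ^ d * (u z * g ^ d)" by (simp add: \<Phi>_def g_def power_divide field_simps)
  also have "... \<le> 2 ^ d * (4 * 2 ^ d / \<epsilon> * I)" using uz by (intro mult_left_mono) auto
  also have "... = 4 ^ (d + 1) / \<epsilon> * I" by (simp add: power_mult_distrib[symmetric])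
  finally have "u x * r ^ d \<le> 4 ^ (d + 1) / \<epsilon> * I" .
  then have "u x \<le> 4 ^ (d + 1) / \<epsilon> * I / r ^ d"
    unfolding pos_le_divide_eq[OF zero_less_power[OF r]] .
  then show ?thesis by (simp add: I_def V_def)
qed

end

text \<open>Poincare's inequality wants cubes, cutoffs want sublevel sets of \<rho>. The two are
  interlaced: a cutoff falling from \<open>r\<^sub>i\<close> to \<open>2 * r\<^sub>i\<close> is one
  on \<open>W\<^sub>i\<close> and vanishes outside the next set of the chain
  \<open>W\<^sub>0\<close>, \<open>W\<^sub>1\<close>, \<open>W\<^sub>2\<close>,
  \<open>\<Omega>\<close>.\<close>

locale harnack_scale = harnack_network F c \<Omega> A d \<rho> K D \<epsilon>
  for F :: "'a set" and c and \<Omega> and A :: real and d :: nat and \<rho> and K :: real and D :: nat and \<epsilon> :: real +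
  fixes n :: real and W\<^sub>0 W\<^sub>1 W\<^sub>2 :: "'a set" and r\<^sub>0 r\<^sub>1 r\<^sub>2 A\<^sub>0 P :: real
  assumes n_pos: "0 < n"
    and D_pos: "1 \<le> D" and P_pos: "0 < P" and A0_pos: "0 < A\<^sub>0"
    and r_ge: "n \<le> r\<^sub>0" "n \<le> r\<^sub>1" "n \<le> r\<^sub>2"
    and W0_sub: "W\<^sub>0 \<subseteq> {x\<in>F. \<rho> x \<le> r\<^sub>0}" and V0_sub: "{x\<in>F. \<rho> x < 2 * r\<^sub>0} \<subseteq> W\<^sub>1"
    and W1_sub: "W\<^sub>1 \<subseteq> {x\<in>F. \<rho> x \<le> r\<^sub>1}" and V1_sub: "{x\<in>F. \<rho> x < 2 * r\<^sub>1} \<subseteq> W\<^sub>2"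
    and W2_sub: "W\<^sub>2 \<subseteq> {x\<in>F. \<rho> x \<le> r\<^sub>2}" and V2_sub: "{x\<in>F. \<rho> x < 2 * r\<^sub>2} \<subseteq> \<Omega>"
    and card_F: "real (card F) \<le> A\<^sub>0 * n ^ d"
    and card_W1: "n ^ d \<le> real (card W\<^sub>1)"
    and poincare: "\<And>u. (\<Sum>x\<in>W\<^sub>2. \<Sum>y\<in>W\<^sub>2. (u x - u y)^2) \<le>
        P * n ^ (d + 2) * (\<Sum>x\<in>W\<^sub>2. \<Sum>y\<in>W\<^sub>2. c x y * (u x - u y)^2)"
begin

lemma W_subs: "W\<^sub>0 \<subseteq> W\<^sub>1" "W\<^sub>1 \<subseteq> W\<^sub>2" "W\<^sub>2 \<subseteq> \<Omega>" "W\<^sub>1 \<subseteq> F" "W\<^sub>2 \<subseteq> F" "W\<^sub>1 \<subseteq> \<Omega>"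
proof -
  have r: "0 < r\<^sub>0" "0 < r\<^sub>1" "0 < r\<^sub>2" using r_ge n_pos by linarith+
  show a: "W\<^sub>0 \<subseteq> W\<^sub>1" using W0_sub r by (intro subset_trans[OF _ V0_sub]) auto
  show b: "W\<^sub>1 \<subseteq> W\<^sub>2" using W1_sub r by (intro subset_trans[OF _ V1_sub]) auto
  show e: "W\<^sub>2 \<subseteq> \<Omega>" using W2_sub r by (intro subset_trans[OF _ V2_sub]) auto
  show "W\<^sub>1 \<subseteq> F" "W\<^sub>2 \<subseteq> F" "W\<^sub>1 \<subseteq> \<Omega>" using b e \<Omega>_sub by auto
qed

lemma finite_W: "finite W\<^sub>1" "finite W\<^sub>2"
  using W_subs finite_F finite_subset by blast+

lemma card_subset_bound: "S \<subseteq> F \<Longrightarrow> real (card S) \<le> A\<^sub>0 * n ^ d"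
  using card_mono[OF finite_F, of S] card_F by linarith

text \<open>The bound for \<open>- ln (v / t)\<close> in \<open>growth_positive\<close>. Under the
  root stand the logarithmic energy after Poincare's inequality and one more
  \<open>A\<^sub>0\<close> from Cauchy-Schwarz; the prefactor is that of
  \<open>mean_value\<close>.\<close>

definition \<Lambda> :: "real \<Rightarrow> real" where
  "\<Lambda> \<theta> = 4 ^ (d + 1) / \<epsilon> * sqrt (24 * P * A\<^sub>0 * real D * K / \<theta> * A\<^sub>0)"

text \<open>For superharmonic \<open>v\<close> the function \<open>max (- ln (v / t)) 0\<close> is subharmonic, has small energy, and
  vanishes on a substantial set; Poincare's inequality and the mean value bound apply to it.\<close>

lemma growth_positive:
  assumes v: "\<And>x. x \<in> F \<Longrightarrow> 0 < v x" and super: "\<And>x. x \<in> \<Omega> \<Longrightarrow> lap v x \<le> 0"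
    and t: "0 < t" and \<theta>: "0 < \<theta>" and big: "\<theta> * n ^ d \<le> real (card {x\<in>W\<^sub>2. t \<le> v x})"
    and x: "x \<in> W\<^sub>1"
  shows "t * exp (- \<Lambda> \<theta>) \<le> v x"
proof -
  define L where "L = (\<lambda>x. ln (v x / t))"
  define w where "w = (\<lambda>x. max (- L x) 0)"
  have super': "lap (\<lambda>x. v x / t) x \<le> 0" if "x \<in> \<Omega>" for x
    using lap_scale[of "1/t" v x] super[OF that] t by (simp add: divide_nonpos_pos)
  have w_sub: "0 \<le> lap w x" if "x \<in> \<Omega>" for x
  proof -
    have "0 \<le> lap (\<lambda>y. - L y) x" unfolding L_def
      using v t that \<Omega>_sub super'[OF that] by (intro lap_minus_ln_nonneg) auto
    from lap_pos_part_nonneg[OF this, of 0] show ?thesis by (simp add: w_def)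
  qed
  define \<phi> where "\<phi> = cutoff (2 * r\<^sub>2) r\<^sub>2"
  have r2: "0 < r\<^sub>2" using r_ge n_pos by linarith
  have \<phi>1: "\<phi> y = 1" if "y \<in> W\<^sub>2" for y
    using that W2_sub r2 by (auto simp: \<phi>_def intro!: cutoff_eq_1)
  have "(\<Sum>x\<in>W\<^sub>2. \<Sum>y\<in>W\<^sub>2. c x y * (w x - w y)^2)
      \<le> (\<Sum>x\<in>W\<^sub>2. \<Sum>y\<in>W\<^sub>2. c x y * ((min (\<phi> x) (\<phi> y))^2 * (ln (v x / t) - ln (v y / t))^2))"
  proof (intro sum_mono mult_left_mono c_nonneg)
    fix x y assume "x \<in> W\<^sub>2" "y \<in> W\<^sub>2"
    then have "min (\<phi> x) (\<phi> y) = 1" using \<phi>1 by simp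
    moreover have "\<bar>w x - w y\<bar> \<le> \<bar>L x - L y\<bar>" by (auto simp: w_def max_def)
    ultimately show "(w x - w y)^2 \<le> (min (\<phi> x) (\<phi> y))^2 * (ln (v x / t) - ln (v y / t))^2"
      by (simp add: L_def abs_le_square_iff)
  qed
  also have "... \<le> (\<Sum>x\<in>F. \<Sum>y\<in>F. c x y * ((min (\<phi> x) (\<phi> y))^2 * (ln (v x / t) - ln (v y / t))^2))"
  proof -
    have *: "(\<Sum>y\<in>W\<^sub>2. c x y * ((min (\<phi> x) (\<phi> y))^2 * (ln (v x / t) - ln (v y / t))^2))
        \<le> (\<Sum>y\<in>F. c x y * ((min (\<phi> x) (\<phi> y))^2 * (ln (v x / t) - ln (v y / t))^2))" for x
      by (intro sum_mono2 finite_F W_subs mult_nonneg_nonneg c_nonneg) auto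
    have "(\<Sum>x\<in>W\<^sub>2. \<Sum>y\<in>W\<^sub>2. c x y * ((min (\<phi> x) (\<phi> y))^2 * (ln (v x / t) - ln (v y / t))^2))
      \<le> (\<Sum>x\<in>W\<^sub>2. \<Sum>y\<in>F. c x y * ((min (\<phi> x) (\<phi> y))^2 * (ln (v x / t) - ln (v y / t))^2))"
      by (intro sum_mono *)
    also have "... \<le> (\<Sum>x\<in>F. \<Sum>y\<in>F. c x y * ((min (\<phi> x) (\<phi> y))^2 * (ln (v x / t) - ln (v y / t))^2))"
      by (intro sum_mono2 finite_F W_subs sum_nonneg mult_nonneg_nonneg c_nonneg) auto
    finally show ?thesis .
  qed
  also have "... \<le> 24 * en \<phi> \<phi>"
  proof (rule log_energy)
    fix x assume x: "x \<in> F"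
    show "0 < v x / t" using v[OF x] t by simp
    show "0 \<le> \<phi> x" by (simp add: \<phi>_def cutoff_bounds)
    assume "\<phi> x \<noteq> 0"
    then have "\<rho> x < 2 * r\<^sub>2" using r2 cutoff_eq_0[of r\<^sub>2 "2 * r\<^sub>2" x] by (force simp: \<phi>_def)
    then show "lap (\<lambda>x. v x / t) x \<le> 0" using V2_sub x by (intro super') auto
  qed
  also have "en \<phi> \<phi> \<le> real (card F) * (real D * K / r\<^sub>2^2)"
    unfolding \<phi>_def by (rule cutoff_energy[OF r2])
  also have "... \<le> (A\<^sub>0 * n ^ d) * (real D * K / n^2)"
    using card_F r_ge n_pos K_pos A0_pos D_pos
    by (intro mult_mono divide_left_mono power_mono) auto
  finally have energy: "(\<Sum>x\<in>W\<^sub>2. \<Sum>y\<in>W\<^sub>2. c x y * (w x - w y)^2) \<le> 24 * ((A\<^sub>0 * n ^ d) * (real D * K / n^2))"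
    by simp
  define Z where "Z = {x\<in>W\<^sub>2. t \<le> v x}"
  define J where "J = (\<Sum>x\<in>W\<^sub>2. (w x)^2)"
  have J0: "0 \<le> J" by (simp add: J_def sum_nonneg)
  have wZ: "w y = 0" if "y \<in> Z" for y
  proof -
    have "0 \<le> L y" using that t by (simp add: Z_def L_def)
    then show ?thesis by (simp add: w_def)
  qed
  \<comment> \<open>As \<open>w\<close> vanishes on \<open>Z\<close>, the pairs with second entry in
    \<open>Z\<close> already contain \<open>card Z\<close> copies of \<open>J\<close>, so no mean
    has to be subtracted in Poincare's inequality.\<close>
  have "J * (\<theta> * n ^ d) \<le> J * real (card Z)"
    using big J0 by (intro mult_left_mono) (auto simp: Z_def)
  also have "... = (\<Sum>x\<in>W\<^sub>2. \<Sum>y\<in>Z. (w x - w y)^2)"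
    by (simp add: wZ J_def sum_distrib_left mult.commute)
  also have "... \<le> (\<Sum>x\<in>W\<^sub>2. \<Sum>y\<in>W\<^sub>2. (w x - w y)^2)"
    by (intro sum_mono sum_mono2 finite_W) (auto simp: Z_def)
  also have "... \<le> P * n ^ (d + 2) * (\<Sum>x\<in>W\<^sub>2. \<Sum>y\<in>W\<^sub>2. c x y * (w x - w y)^2)" by (rule poincare)
  also have "... \<le> P * n ^ (d + 2) * (24 * ((A\<^sub>0 * n ^ d) * (real D * K / n^2)))"
    using energy P_pos n_pos by (intro mult_left_mono) auto
  also have "... = (24 * P * A\<^sub>0 * real D * K * n ^ d) * n ^ d"
    using n_pos by (simp add: power_add power2_eq_square)
  finally have "J \<le> 24 * P * A\<^sub>0 * real D * K / \<theta> * n ^ d"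
    using n_pos \<theta> by (simp add: field_simps)
  then have J_le: "J * (A\<^sub>0 * n ^ d) \<le> 24 * P * A\<^sub>0 * real D * K / \<theta> * n ^ d * (A\<^sub>0 * n ^ d)"
    using A0_pos n_pos by (intro mult_right_mono) auto
  have "(\<Sum>x\<in>W\<^sub>2. w x)^2 \<le> J * real (card W\<^sub>2)"
    using Cauchy_Schwarz_ineq_sum[of w "\<lambda>_. 1" W\<^sub>2] by (simp add: J_def)
  also have "... \<le> J * (A\<^sub>0 * n ^ d)" using J0 card_subset_bound[of W\<^sub>2] W_subs by (intro mult_left_mono) auto
  also note J_le
  also have "24 * P * A\<^sub>0 * real D * K / \<theta> * n ^ d * (A\<^sub>0 * n ^ d) =
     (24 * P * A\<^sub>0 * real D * K / \<theta> * A\<^sub>0) * (n ^ d)^2" by (simp add: power2_eq_square)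
  finally have "(\<Sum>x\<in>W\<^sub>2. w x) \<le> sqrt ((24 * P * A\<^sub>0 * real D * K / \<theta> * A\<^sub>0) * (n ^ d)^2)"
    by (rule real_le_rsqrt)
  also have "... = sqrt (24 * P * A\<^sub>0 * real D * K / \<theta> * A\<^sub>0) * n ^ d"
    using n_pos by (subst real_sqrt_mult) simp
  finally have sum_w: "(\<Sum>x\<in>W\<^sub>2. w x) \<le> sqrt (24 * P * A\<^sub>0 * real D * K / \<theta> * A\<^sub>0) * n ^ d" .
  have r1: "0 < r\<^sub>1" using r_ge n_pos by linarith
  have "w x \<le> 4 ^ (d + 1) / (\<epsilon> * r\<^sub>1 ^ d) * (\<Sum>y\<in>{y\<in>F. \<rho> y < 2 * r\<^sub>1}. w y)"
  proof (rule mean_value[OF r1])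
    show "{y\<in>F. \<rho> y < 2 * r\<^sub>1} \<subseteq> \<Omega>" using V1_sub W_subs by blast
    then show "0 \<le> lap w y" if "y \<in> F" "\<rho> y < 2 * r\<^sub>1" for y using that by (intro w_sub) auto
  qed (use x W1_sub in \<open>auto simp: w_def\<close>)
  also have "... \<le> 4 ^ (d + 1) / (\<epsilon> * n ^ d) * (\<Sum>y\<in>W\<^sub>2. w y)"
    using r_ge n_pos \<epsilon>_pos V1_sub finite_W
    by (intro mult_mono divide_left_mono mult_left_mono power_mono sum_mono2 sum_nonneg) (auto simp: w_def)
  also have "... \<le> 4 ^ (d + 1) / (\<epsilon> * n ^ d) * (sqrt (24 * P * A\<^sub>0 * real D * K / \<theta> * A\<^sub>0) * n ^ d)"
    using sum_w \<epsilon>_pos n_pos by (intro mult_left_mono) auto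
  also have "... = \<Lambda> \<theta>" using n_pos by (simp add: \<Lambda>_def)
  finally have "- L x \<le> \<Lambda> \<theta>" by (simp add: w_def)
  then have "exp (- \<Lambda> \<theta>) \<le> exp (L x)" by simp
  also have "exp (L x) = v x / t" using v[of x] t x W_subs by (auto simp: L_def)
  finally show ?thesis using t by (simp add: field_simps)
qed

text \<open>A constant is added and sent to zero, because Green functions vanish outside \<Omega>
  and have no logarithm there.\<close>

lemma growth:
  assumes v: "\<And>x. x \<in> F \<Longrightarrow> 0 \<le> v x" and super: "\<And>x. x \<in> \<Omega> \<Longrightarrow> lap v x \<le> 0"
    and t: "0 < t" and \<theta>: "0 < \<theta>" and big: "\<theta> * n ^ d \<le> real (card {x\<in>W\<^sub>2. t \<le> v x})"
    and x: "x \<in> W\<^sub>1"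
  shows "t * exp (- \<Lambda> \<theta>) \<le> v x"
proof (rule field_le_epsilon)
  fix e :: real assume e: "0 < e"
  show "t * exp (- \<Lambda> \<theta>) \<le> v x + e"
  proof (rule growth_positive[OF _ _ t \<theta> _ x])
    show "0 < v y + e" if "y \<in> F" for y using v[OF that] e by simp
    show "lap (\<lambda>x. v x + e) y \<le> 0" if "y \<in> \<Omega>" for y using super[OF that] by (simp add: lap_add_const)
    have "card {x\<in>W\<^sub>2. t \<le> v x} \<le> card {x\<in>W\<^sub>2. t \<le> v x + e}"
      using e finite_W by (intro card_mono) auto
    with big show "\<theta> * n ^ d \<le> real (card {x\<in>W\<^sub>2. t \<le> v x + e})" by linarith
  qed
qed

end

section \<open>Green functions and the Harnack inequality\<close>

context harnack_scale
begin

text \<open>Scale free constants. \<open>\<tau> * n^2\<close> bounds potentials of indicators;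
  \<open>\<sigma> * n ^ d * n^2\<close> is a lower bound for the total over \<open>W\<^sub>2\<close>
  of the potential of \<open>W\<^sub>2\<close>, and \<open>\<beta> * n^2\<close> for that potential
  on \<open>W\<^sub>1\<close>; sets of size at most \<open>\<delta> * n ^ d\<close> have potential
  at most half of this; \<open>\<gamma>\<close> is the constant in the lower bound for the Green
  function. None of them involves \<open>c\<close>, \<open>\<rho>\<close> or
  \<open>n\<close>.\<close>

definition \<tau> :: real where "\<tau> = 4 * A * 2 ^ d * A\<^sub>0 powr (2 / real d)"
definition \<sigma> :: real where "\<sigma> = 2 / (A\<^sub>0 * (real D * K))"
definition \<beta> :: real where "\<beta> = \<sigma> / (2 * A\<^sub>0) * exp (- \<Lambda> (\<sigma> / (2 * \<tau>)))"
definition \<delta> :: real where "\<delta> = \<beta> / (4 * \<tau>) * (\<beta> / (16 * A * 2 ^ d)) powr (real d / 2)"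
definition \<gamma> :: real where "\<gamma> = \<beta> / (4 * A\<^sub>0) * exp (- \<Lambda> \<delta>)"
definition C_harnack :: real where "C_harnack = 4 ^ (d + 1) / \<epsilon> * (\<tau> / \<gamma>)"

lemma const_pos: "0 < \<tau>" "0 < \<sigma>" "0 < \<beta>" "0 < \<delta>" "0 < \<gamma>"
proof -
  show \<tau>: "0 < \<tau>" using A_pos A0_pos by (simp add: \<tau>_def)
  show \<sigma>: "0 < \<sigma>" using A0_pos D_pos K_pos by (simp add: \<sigma>_def)
  show \<beta>: "0 < \<beta>" using \<sigma> A0_pos by (simp add: \<beta>_def)
  show \<delta>: "0 < \<delta>" using \<beta> \<tau> A_pos by (simp add: \<delta>_def)
  show "0 < \<gamma>" using \<beta> A0_pos by (simp add: \<gamma>_def)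
qed

lemma powr_scale: "0 \<le> a \<Longrightarrow> (a * n ^ d) powr (2 / real d) = a powr (2 / real d) * n^2"
  using n_pos powr_pow_swap[OF n_pos] by (simp add: powr_mult)

text \<open>In probabilistic terms \<open>u\<close> is the expected time integral of
  \<open>g\<close> along the walk generated by \<open>lap\<close> and killed on leaving
  \<Omega>.\<close>

definition green_of :: "('a \<Rightarrow> real) \<Rightarrow> ('a \<Rightarrow> real) \<Rightarrow> bool" where
  "green_of g u \<longleftrightarrow> (\<forall>x. x \<notin> \<Omega> \<longrightarrow> u x = 0) \<and> (\<forall>x\<in>\<Omega>. lap u x = - g x) \<and> (\<forall>x. 0 \<le> u x)"

lemma green_ofD:
  assumes "green_of g u"
  shows "x \<notin> \<Omega> \<Longrightarrow> u x = 0" "x \<in> \<Omega> \<Longrightarrow> lap u x = - g x" "0 \<le> u x"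
  using assms by (auto simp: green_of_def)

lemma green_of_ex: "(\<And>x. 0 \<le> g x) \<Longrightarrow> \<exists>u. green_of g u"
  using green_ex[of g] by (auto simp: green_of_def)

text \<open>Symmetry of the Green function, in integrated form.\<close>

lemma green_of_sym:
  assumes "green_of g u" "green_of h v"
  shows "(\<Sum>x\<in>\<Omega>. h x * u x) = (\<Sum>x\<in>\<Omega>. g x * v x)"
proof -
  have restr: "(\<Sum>x\<in>F. w x * lap z x) = (\<Sum>x\<in>\<Omega>. w x * lap z x)" if "\<And>x. x \<notin> \<Omega> \<Longrightarrow> w x = 0" for w z
    by (rule sum.mono_neutral_right[OF finite_F \<Omega>_sub]) (use that in auto)
  have "(\<Sum>x\<in>\<Omega>. u x * lap v x) = (\<Sum>x\<in>\<Omega>. v x * lap u x)"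
    using green_identity[of u v] restr green_ofD(1)[OF assms(1)] green_ofD(1)[OF assms(2)] by simp
  then show ?thesis using green_ofD(2)[OF assms(1)] green_ofD(2)[OF assms(2)]
    by (simp add: sum_negf mult.commute)
qed

lemma sum_indicator_mult: "S \<subseteq> \<Omega> \<Longrightarrow> (\<Sum>x\<in>\<Omega>. indicator S x * g x) = (\<Sum>x\<in>S. g x :: real)"
  using finite_\<Omega> by (intro sum.mono_neutral_cong_right) (auto simp: indicator_def)

text \<open>Stampacchia's bound from level zero, with the trivial bound for the size of that level
  set.\<close>

lemma green_indicator_bound:
  assumes u: "green_of (indicator S) u"
  shows "u x \<le> \<tau> * n^2"
proof (cases "x \<in> \<Omega>")
  case True
  have "u x \<le> 0 + 4 * A * 2 ^ d * (A\<^sub>0 * n ^ d) powr (2 / real d)"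
  proof (rule stampacchia_bound)
    show "real (card {x \<in> \<Omega>. 0 < u x}) \<le> A\<^sub>0 * n ^ d"
      using \<Omega>_sub by (intro card_subset_bound) auto
    show "- 1 \<le> lap u x" if "x \<in> \<Omega>" for x using green_ofD(2)[OF u that] by (simp add: indicator_def)
  qed (use green_ofD(1)[OF u] True in auto)
  then show ?thesis using A0_pos by (simp add: powr_scale \<tau>_def)
next
  case False
  then show ?thesis using green_ofD(1)[OF u] const_pos(1) by simp
qed

text \<open>By symmetry the total of \<open>u\<close> is the integral over \<open>S\<close> of the
  potential of \<Omega>, hence small; so \<open>u\<close> exceeds \<open>\<beta> / 4 * n^2\<close>
  on few vertices. Stampacchia's bound is started from that level, and \<open>\<delta>\<close> is
  chosen so that it adds exactly another \<open>\<beta> / 4 * n^2\<close>.\<close>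

lemma green_indicator_small:
  assumes u: "green_of (indicator S) u" and S: "S \<subseteq> \<Omega>" and card: "real (card S) \<le> \<delta> * n ^ d"
    and x: "x \<in> \<Omega>"
  shows "u x \<le> \<beta> / 2 * n^2"
proof -
  obtain v where v: "green_of (indicator \<Omega>) v" using green_of_ex[of "indicator \<Omega>"] by auto
  have "(\<Sum>x\<in>\<Omega>. u x) = (\<Sum>x\<in>\<Omega>. indicator \<Omega> x * u x)" by (intro sum.cong) auto
  also have "... = (\<Sum>x\<in>\<Omega>. indicator S x * v x)" by (rule green_of_sym[OF u v])
  also have "... \<le> (\<Sum>x\<in>\<Omega>. indicator S x * (\<tau> * n^2))"
    by (intro sum_mono mult_left_mono green_indicator_bound[OF v]) auto
  also have "... = real (card S) * (\<tau> * n^2)"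
    by (simp only: sum_indicator_mult[OF S]) simp
  also have "... \<le> (\<delta> * n ^ d) * (\<tau> * n^2)"
    using card const_pos(1) by (intro mult_right_mono) auto
  finally have sum_u: "(\<Sum>x\<in>\<Omega>. u x) \<le> (\<delta> * n ^ d) * (\<tau> * n^2)" .
  define k where "k = \<beta> / 4 * n^2"
  have k: "0 < k" using const_pos n_pos by (simp add: k_def)
  define Z where "Z = {x\<in>\<Omega>. k < u x}"
  have "k * real (card Z) = (\<Sum>x\<in>Z. k)" by simp
  also have "... \<le> (\<Sum>x\<in>Z. u x)" by (intro sum_mono) (auto simp: Z_def)
  also have "... \<le> (\<Sum>x\<in>\<Omega>. u x)" using green_ofD(3)[OF u] finite_\<Omega> by (intro sum_mono2) (auto simp: Z_def)
  finally have "k * real (card Z) \<le> (\<delta> * n ^ d) * (\<tau> * n^2)" using sum_u by simp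
  then have cardZ: "real (card Z) \<le> (4 * \<delta> * \<tau> / \<beta>) * n ^ d"
    using n_pos const_pos by (simp add: k_def field_simps)
  have "u x \<le> k + 4 * A * 2 ^ d * ((4 * \<delta> * \<tau> / \<beta>) * n ^ d) powr (2 / real d)"
  proof (rule stampacchia_bound)
    show "real (card {x \<in> \<Omega>. k < u x}) \<le> (4 * \<delta> * \<tau> / \<beta>) * n ^ d" using cardZ by (simp add: Z_def)
    show "- 1 \<le> lap u x" if "x \<in> \<Omega>" for x using green_ofD(2)[OF u that] by (simp add: indicator_def)
  qed (use green_ofD(1)[OF u] x k in auto)
  also have "((4 * \<delta> * \<tau> / \<beta>) * n ^ d) powr (2 / real d) = (\<beta> / (16 * A * 2 ^ d)) * n^2"
  proof -
    have "4 * \<delta> * \<tau> / \<beta> = (\<beta> / (16 * A * 2 ^ d)) powr (real d / 2)"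
      using const_pos by (simp add: \<delta>_def)
    then have "(4 * \<delta> * \<tau> / \<beta>) powr (2 / real d) = \<beta> / (16 * A * 2 ^ d)"
      using const_pos A_pos d_pos by (simp add: powr_powr)
    then show ?thesis using const_pos by (subst powr_scale) auto
  qed
  also have "k + 4 * A * 2 ^ d * (\<beta> / (16 * A * 2 ^ d) * n^2) = \<beta> / 2 * n^2"
    using A_pos by (simp add: k_def field_simps)
  finally show ?thesis .
qed

text \<open>By Cauchy-Schwarz the energy of a cutoff function bounds the sum of \<open>f\<close> over \<open>W\<^sub>2\<close> from below; since
  \<open>f \<le> \<tau> * n^2\<close>, this makes \<open>f\<close> large on a substantial set.\<close>

lemma green_W2_lower:
  assumes f: "green_of (indicator W\<^sub>2) f" and x: "x \<in> W\<^sub>1"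
  shows "\<beta> * n^2 \<le> f x"
proof -
  define \<phi> where "\<phi> = cutoff (2 * r\<^sub>1) r\<^sub>1"
  have r1: "0 < r\<^sub>1" using r_ge n_pos by linarith
  have \<phi>1: "\<phi> y = 1" if "y \<in> W\<^sub>1" for y
    using that W1_sub r1 by (auto simp: \<phi>_def intro!: cutoff_eq_1)
  have \<phi>0: "\<phi> y = 0" if "y \<in> F - W\<^sub>2" for y
    using that V1_sub r1 by (auto simp: \<phi>_def intro!: cutoff_eq_0)
  define I where "I = (\<Sum>x\<in>W\<^sub>2. f x)"
  have I0: "0 \<le> I" unfolding I_def by (intro sum_nonneg green_ofD(3)[OF f])
  have sumF: "(\<Sum>x\<in>F. w x * lap f x) = - (\<Sum>x\<in>W\<^sub>2. w x)" if w: "\<And>x. x \<in> F - \<Omega> \<Longrightarrow> w x = 0" for w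
  proof -
    have "(\<Sum>x\<in>F. w x * lap f x) = (\<Sum>x\<in>W\<^sub>2. w x * lap f x)"
    proof (rule sum.mono_neutral_right[OF finite_F W_subs(5)], rule ballI)
      fix x assume x: "x \<in> F - W\<^sub>2"
      then show "w x * lap f x = 0" using green_ofD(2)[OF f, of x] w[of x] by (cases "x \<in> \<Omega>") auto
    qed
    also have "... = (\<Sum>x\<in>W\<^sub>2. - w x)"
      using green_ofD(2)[OF f] W_subs(3) by (intro sum.cong) auto
    finally show ?thesis by (simp add: sum_negf)
  qed
  have enff: "en f f = 2 * I"
    using sumF[of f] green_ofD(1)[OF f] sum_mult_lap[of f f] by (simp add: I_def)
  have enf\<phi>: "en f \<phi> = 2 * (\<Sum>x\<in>W\<^sub>2. \<phi> x)"
  proof -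
    have "\<phi> x = 0" if "x \<in> F - \<Omega>" for x using that \<phi>0[of x] W_subs(3) by auto
    from sumF[OF this] show ?thesis using sum_mult_lap[of \<phi> f] by simp
  qed
  have "n ^ d \<le> (\<Sum>x\<in>W\<^sub>1. \<phi> x)" using card_W1 by (simp add: \<phi>1)
  also have "... \<le> (\<Sum>x\<in>W\<^sub>2. \<phi> x)"
    by (intro sum_mono2 finite_W W_subs) (auto simp: \<phi>_def cutoff_bounds)
  finally have "(2 * n ^ d)^2 \<le> (en f \<phi>)^2" unfolding enf\<phi>
    using n_pos by (intro power_mono) auto
  also have "... \<le> en f f * en \<phi> \<phi>" by (rule en_cauchy_schwarz)
  also have "... \<le> (2 * I) * ((A\<^sub>0 * n ^ d) * (real D * K / n^2))"
    unfolding enff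
  proof (rule mult_left_mono)
    have "en \<phi> \<phi> \<le> real (card F) * (real D * K / r\<^sub>1^2)"
      unfolding \<phi>_def by (rule cutoff_energy[OF r1])
    also have "... \<le> (A\<^sub>0 * n ^ d) * (real D * K / n^2)"
      using card_F r_ge n_pos K_pos A0_pos D_pos
      by (intro mult_mono divide_left_mono power_mono) auto
    finally show "en \<phi> \<phi> \<le> (A\<^sub>0 * n ^ d) * (real D * K / n^2)" .
  qed (use I0 in auto)
  finally have "\<sigma> * n ^ d * n^2 \<le> I"
    using A0_pos D_pos K_pos n_pos by (simp add: \<sigma>_def field_simps power2_eq_square)
  \<comment> \<open>Chosen so that the vertices with \<open>f < t\<close> carry at most half of the
    lower bound for \<open>I\<close>.\<close>
  define t where "t = \<sigma> / (2 * A\<^sub>0) * n^2"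
  have t: "0 < t" using const_pos A0_pos n_pos by (simp add: t_def)
  define Z where "Z = {x\<in>W\<^sub>2. t \<le> f x}"
  have "I \<le> (\<Sum>x\<in>W\<^sub>2. t + \<tau> * n^2 * indicator Z x)" unfolding I_def
  proof (rule sum_mono)
    fix x assume "x \<in> W\<^sub>2"
    then show "f x \<le> t + \<tau> * n^2 * indicator Z x"
      using green_indicator_bound[OF f, of x] t by (auto simp: Z_def indicator_def)
  qed
  also have "... = real (card W\<^sub>2) * t + \<tau> * n^2 * real (card Z)"
  proof -
    have "(\<Sum>x\<in>W\<^sub>2. indicator Z x) = (\<Sum>x\<in>Z. 1 :: real)"
      using finite_W(2) by (intro sum.mono_neutral_cong_right) (auto simp: Z_def)
    then show ?thesis by (simp add: sum.distrib sum_distrib_left[symmetric])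
  qed
  also have "real (card W\<^sub>2) * t \<le> (A\<^sub>0 * n ^ d) * t"
    using t W_subs by (intro mult_right_mono card_subset_bound) auto
  also have "(A\<^sub>0 * n ^ d) * t = \<sigma> / 2 * n ^ d * n^2" using A0_pos by (simp add: t_def)
  finally have "\<sigma> * n ^ d * n^2 \<le> \<sigma> / 2 * n ^ d * n^2 + \<tau> * n^2 * real (card Z)"
    using \<open>\<sigma> * n ^ d * n^2 \<le> I\<close> by linarith
  then have "(\<sigma> / 2 * n ^ d) * n^2 \<le> (\<tau> * real (card Z)) * n^2" by (simp add: algebra_simps)
  then have "\<sigma> / 2 * n ^ d \<le> \<tau> * real (card Z)" using n_pos by simp
  then have big: "\<sigma> / (2 * \<tau>) * n ^ d \<le> real (card Z)" using const_pos by (simp add: field_simps)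
  have "t * exp (- \<Lambda> (\<sigma> / (2 * \<tau>))) \<le> f x"
  proof (rule growth[OF _ _ t _ _ x])
    show "0 \<le> f y" for y by (rule green_ofD(3)[OF f])
    show "lap f y \<le> 0" if "y \<in> \<Omega>" for y using green_ofD(2)[OF f that] by simp
    show "0 < \<sigma> / (2 * \<tau>)" using const_pos by simp
    show "\<sigma> / (2 * \<tau>) * n ^ d \<le> real (card {x \<in> W\<^sub>2. t \<le> f x})" using big by (simp add: Z_def)
  qed
  then show ?thesis by (simp add: t_def \<beta>_def mult_ac)
qed

text \<open>The sum of \<open>G\<close> over a set is the potential of that set at \<open>y\<close>.
  If \<open>G\<close> were large only on a set of small size, that set would contribute at most
  \<open>\<beta> / 2 * n^2\<close> and the rest of \<open>W\<^sub>2\<close> at most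
  \<open>\<beta> / 4 * n^2\<close>, against the lower bound \<open>\<beta> * n^2\<close>. So
  \<open>G\<close> is large on a substantial set, and \<open>growth\<close> spreads this to
  \<open>W\<^sub>1\<close>.\<close>

lemma green_point_lower:
  assumes G: "green_of (indicator {y}) G" and y: "y \<in> W\<^sub>1" and x: "x \<in> W\<^sub>1"
  shows "\<gamma> * (n^2 / n ^ d) \<le> G x"
proof -
  have y\<Omega>: "y \<in> \<Omega>" using y W_subs by auto
  have pair: "(\<Sum>x\<in>S. G x) = u y" if u: "green_of (indicator S) u" and S: "S \<subseteq> \<Omega>" for S u
  proof -
    have "(\<Sum>x\<in>S. G x) = (\<Sum>x\<in>\<Omega>. indicator S x * G x)"
      by (simp only: sum_indicator_mult[OF S])
    also have "... = (\<Sum>x\<in>\<Omega>. indicator {y} x * u x)" by (rule green_of_sym[OF G u])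
    also have "... = u y" using y\<Omega> by (subst sum_indicator_mult) auto
    finally show ?thesis .
  qed
  define t where "t = \<beta> / (4 * A\<^sub>0) * (n^2 / n ^ d)"
  have t: "0 < t" using const_pos A0_pos n_pos by (simp add: t_def)
  define Z where "Z = {x\<in>W\<^sub>2. t \<le> G x}"
  have Z\<Omega>: "Z \<subseteq> \<Omega>" using W_subs by (auto simp: Z_def)
  have "\<delta> * n ^ d \<le> real (card Z)"
  proof (rule ccontr)
    assume "\<not> \<delta> * n ^ d \<le> real (card Z)"
    then have small: "real (card Z) \<le> \<delta> * n ^ d" by simp
    obtain f where f: "green_of (indicator W\<^sub>2) f" using green_of_ex[of "indicator W\<^sub>2"] by auto
    obtain u where u: "green_of (indicator Z) u" using green_of_ex[of "indicator Z"] by auto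
    have "\<beta> * n^2 \<le> f y" by (rule green_W2_lower[OF f y])
    also have "f y = (\<Sum>x\<in>W\<^sub>2. G x)" using pair[OF f] W_subs by simp
    also have "... = (\<Sum>x\<in>Z. G x) + (\<Sum>x\<in>W\<^sub>2 - Z. G x)"
      using finite_W by (simp add: sum.subset_diff[of Z W\<^sub>2] Z_def)
    also have "(\<Sum>x\<in>Z. G x) \<le> \<beta> / 2 * n^2"
      using pair[OF u Z\<Omega>] green_indicator_small[OF u Z\<Omega> small y\<Omega>] by simp
    also have "(\<Sum>x\<in>W\<^sub>2 - Z. G x) \<le> (\<Sum>x\<in>W\<^sub>2 - Z. t)" by (intro sum_mono) (auto simp: Z_def)
    also have "... = real (card (W\<^sub>2 - Z)) * t" by simp
    also have "... \<le> (A\<^sub>0 * n ^ d) * t"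
      using t W_subs by (intro mult_right_mono card_subset_bound) auto
    also have "... = \<beta> / 4 * n^2" using A0_pos n_pos by (simp add: t_def)
    finally have "\<beta> * n^2 \<le> 3 / 4 * (\<beta> * n^2)" by simp
    moreover have "0 < \<beta> * n^2" using const_pos n_pos by simp
    ultimately show False by linarith
  qed
  then have "t * exp (- \<Lambda> \<delta>) \<le> G x"
    by (intro growth[OF _ _ t _ _ x])
      (use green_ofD(2)[OF G] green_ofD(3)[OF G] const_pos in \<open>auto simp: Z_def\<close>)
  then show ?thesis by (simp add: t_def \<gamma>_def mult_ac)
qed

text \<open>By Green's identity the mass of \<open>h\<close> in \<open>W\<^sub>1\<close> and the value \<open>h y\<close> are integrals of \<open>h\<close> over the exterior
  boundary of \<open>\<Omega>\<close>, with densities given by the normal derivatives of \<open>f\<close> and of the Green function \<open>G\<close>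
  with pole \<open>y\<close>. The densities are compared through \<open>f \<le> C * G\<close>.\<close>

lemma mass_le_value:
  assumes h: "\<And>x. x \<in> F \<Longrightarrow> 0 \<le> h x" and harm: "\<And>x. x \<in> \<Omega> \<Longrightarrow> lap h x = 0" and y: "y \<in> W\<^sub>1"
  shows "(\<Sum>x\<in>W\<^sub>1. h x) \<le> \<tau> / \<gamma> * n ^ d * h y"
proof -
  define a where "a = \<tau> / \<gamma> * n ^ d"
  have a: "0 < a" using const_pos n_pos by (simp add: a_def)
  have y\<Omega>: "y \<in> \<Omega>" using y W_subs by auto
  obtain f where f: "green_of (indicator W\<^sub>1) f" using green_of_ex[of "indicator W\<^sub>1"] by auto
  obtain G where G: "green_of (indicator {y}) G" using green_of_ex[of "indicator {y}"] by auto
  \<comment> \<open>The multiple \<open>a\<close> is the one for which the upper bound of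
    \<open>f\<close> meets the lower bound of \<open>a * G\<close> on \<open>W\<^sub>1\<close>; the
    maximum principle carries \<open>q \<le> 0\<close> to the rest of \<Omega>.\<close>
  define q where "q = (\<lambda>x. 1 * f x + (- a) * G x)"
  have lap_q: "lap q x = - indicator W\<^sub>1 x + a * indicator {y} x" if "x \<in> \<Omega>" for x
    unfolding q_def lap_linear using green_ofD(2)[OF f that] green_ofD(2)[OF G that] by simp
  have q0: "q x = 0" if "x \<notin> \<Omega>" for x
    using green_ofD(1)[OF f that] green_ofD(1)[OF G that] by (simp add: q_def)
  have q_neg: "q x \<le> 0" if xF: "x \<in> F" for x
  proof (rule max_principle[where S = "\<Omega> - W\<^sub>1"])
    show "0 \<le> lap q x" if "x \<in> \<Omega> - W\<^sub>1" for x
      using lap_q[of x] that a by (auto simp: indicator_def)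
    show "q x \<le> 0" if "x \<in> F - (\<Omega> - W\<^sub>1)" for x
    proof (cases "x \<in> W\<^sub>1")
      case True
      have "f x \<le> \<tau> * n^2" by (rule green_indicator_bound[OF f])
      also have "... = a * (\<gamma> * (n^2 / n ^ d))" using const_pos n_pos by (simp add: a_def)
      also have "... \<le> a * G x" using a by (intro mult_left_mono green_point_lower[OF G y True]) auto
      finally show ?thesis by (simp add: q_def)
    qed (use q0 that in auto)
  qed (use xF in auto)
  have "(\<Sum>x\<in>F. q x * lap h x) = 0"
    using q0 harm by (intro sum.neutral) (metis mult_eq_0_iff)
  then have "0 = (\<Sum>x\<in>F. h x * lap q x)" by (simp add: green_identity[of q h])
  also have "... = (\<Sum>x\<in>F - \<Omega>. h x * lap q x) + (\<Sum>x\<in>\<Omega>. h x * lap q x)"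
    using sum.subset_diff[OF \<Omega>_sub finite_F] by simp
  also have "(\<Sum>x\<in>F - \<Omega>. h x * lap q x) \<le> 0"
  proof (rule sum_nonpos)
    fix x assume x: "x \<in> F - \<Omega>"
    \<comment> \<open>Outside \<Omega> the function \<open>q\<close> attains its maximum zero. The
      resulting sign is the comparison of the boundary densities.\<close>
    have "lap q x \<le> 0" unfolding lap_def
      using q0 x q_neg by (intro sum_nonpos mult_nonneg_nonpos c_nonneg) auto
    then show "h x * lap q x \<le> 0" using h x by (simp add: mult_nonneg_nonpos)
  qed
  also have "(\<Sum>x\<in>\<Omega>. h x * lap q x) = (\<Sum>x\<in>\<Omega>. a * (indicator {y} x * h x) - indicator W\<^sub>1 x * h x)"
    using lap_q by (intro sum.cong) (auto simp: lap_q right_diff_distrib mult_ac)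
  also have "... = a * (\<Sum>x\<in>\<Omega>. indicator {y} x * h x) - (\<Sum>x\<in>\<Omega>. indicator W\<^sub>1 x * h x)"
    by (simp add: sum_subtractf sum_distrib_left)
  also have "(\<Sum>x\<in>\<Omega>. indicator {y} x * h x) = h y"
    using y\<Omega> by (subst sum_indicator_mult) auto
  also have "(\<Sum>x\<in>\<Omega>. indicator W\<^sub>1 x * h x) = (\<Sum>x\<in>W\<^sub>1. h x)"
    by (rule sum_indicator_mult[OF W_subs(6)])
  finally show ?thesis by (simp add: a_def)
qed

theorem harnack:
  assumes h: "\<And>x. x \<in> F \<Longrightarrow> 0 \<le> h x" and harm: "\<And>x. x \<in> \<Omega> \<Longrightarrow> lap h x = 0"
    and x: "x \<in> W\<^sub>0" and y: "y \<in> W\<^sub>1"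
  shows "h x \<le> C_harnack * h y"
proof -
  have r0: "0 < r\<^sub>0" using r_ge n_pos by linarith
  have "h x \<le> 4 ^ (d + 1) / (\<epsilon> * r\<^sub>0 ^ d) * (\<Sum>y\<in>{y\<in>F. \<rho> y < 2 * r\<^sub>0}. h y)"
  proof (rule mean_value[OF r0])
    show "{y\<in>F. \<rho> y < 2 * r\<^sub>0} \<subseteq> \<Omega>" using V0_sub W_subs by blast
    then show "0 \<le> lap h y" if "y \<in> F" "\<rho> y < 2 * r\<^sub>0" for y
      using that harm[of y] by auto
  qed (use x W0_sub h in auto)
  also have "... \<le> 4 ^ (d + 1) / (\<epsilon> * n ^ d) * (\<Sum>y\<in>W\<^sub>1. h y)"
    using r_ge n_pos \<epsilon>_pos V0_sub finite_W h W_subs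
    by (intro mult_mono divide_left_mono mult_left_mono power_mono sum_mono2 sum_nonneg) auto
  also have "... \<le> 4 ^ (d + 1) / (\<epsilon> * n ^ d) * (\<tau> / \<gamma> * n ^ d * h y)"
    using mass_le_value[OF h harm y] \<epsilon>_pos n_pos by (intro mult_left_mono) auto
  also have "... = C_harnack * h y" using n_pos \<epsilon>_pos by (simp add: C_harnack_def)
  finally show ?thesis .
qed

end

section \<open>Functional inequalities on the lattice\<close>

lemma sum_le_inj:
  fixes f :: "'b \<Rightarrow> real"
  assumes "inj_on g T" "g ` T \<subseteq> S" "finite S" "\<And>y. y \<in> S \<Longrightarrow> 0 \<le> f y"
  shows "(\<Sum>x\<in>T. f (g x)) \<le> (\<Sum>y\<in>S. f y)"
proof -
  have "(\<Sum>x\<in>T. f (g x)) = (\<Sum>y\<in>g ` T. f y)" using assms(1) by (simp add: sum.reindex)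
  also have "... \<le> (\<Sum>y\<in>S. f y)" using assms by (intro sum_mono2) auto
  finally show ?thesis .
qed

lemma sum_power2_le:
  fixes a :: "'b \<Rightarrow> real"
  shows "(\<Sum>x\<in>T. a x)^2 \<le> real (card T) * (\<Sum>x\<in>T. (a x)^2)"
  using Cauchy_Schwarz_ineq_sum[of a "\<lambda>_. 1" T] by (simp add: mult.commute)

lemma card_vec_set:
  fixes S :: "'n::finite \<Rightarrow> 'a set"
  assumes fin: "\<And>i. finite (S i)"
  shows "finite {y :: 'a ^ 'n. \<forall>i. y $ i \<in> S i}"
    and "card {y :: 'a ^ 'n. \<forall>i. y $ i \<in> S i} = (\<Prod>i\<in>UNIV. card (S i))"
proof -
  have bij: "bij_betw vec_lambda (PiE UNIV S) {y :: 'a ^ 'n. \<forall>i. y $ i \<in> S i}"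
    by (rule bij_betwI[where g = vec_nth]) (auto simp: PiE_def Pi_def)
  have finP: "finite (PiE UNIV S)" using fin by (intro finite_PiE) auto
  show "finite {y :: 'a ^ 'n. \<forall>i. y $ i \<in> S i}" using bij finP by (metis bij_betw_finite)
  show "card {y :: 'a ^ 'n. \<forall>i. y $ i \<in> S i} = (\<Prod>i\<in>UNIV. card (S i))"
    using bij_betw_same_card[OF bij] by (simp add: card_PiE)
qed

text \<open>Sup norm balls are used for the functional inequalities because, with two points, they
  contain every point that takes each coordinate from one of the two.\<close>

definition cube :: "int ^ 'd::finite \<Rightarrow> nat \<Rightarrow> (int ^ 'd) set" where
  "cube z k = {y. \<forall>i. \<bar>y $ i - z $ i\<bar> \<le> int k}"

lemma cube_alt: "cube z k = {y. \<forall>i. y $ i \<in> {z $ i - int k..z $ i + int k}}"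
  unfolding cube_def by (intro Collect_cong all_cong1) auto

lemma finite_cube [simp]: "finite (cube z k)"
  unfolding cube_alt by (rule card_vec_set) simp

lemma card_cube: "card (cube (z :: int ^ 'd::finite) k) = (2 * k + 1) ^ CARD('d)"
proof -
  have "card (cube z k) = (\<Prod>i\<in>(UNIV :: 'd set). card {z $ i - int k..z $ i + int k})"
    unfolding cube_alt by (rule card_vec_set) simp
  also have "... = (\<Prod>i\<in>(UNIV :: 'd set). 2 * k + 1)" by (intro prod.cong) auto
  finally show ?thesis by simp
qed

lemma cube_mono: "k \<le> l \<Longrightarrow> cube z k \<subseteq> cube z l"
  unfolding cube_def by (auto intro: order_trans)

lemma cube_shift: "x \<in> cube z k \<Longrightarrow> y \<in> cube x l \<Longrightarrow> y \<in> cube z (k + l)"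
  unfolding cube_def
proof clarify
  fix i assume "\<forall>i. \<bar>x $ i - z $ i\<bar> \<le> int k" "\<forall>i. \<bar>y $ i - x $ i\<bar> \<le> int l"
  then have "\<bar>x $ i - z $ i\<bar> \<le> int k" "\<bar>y $ i - x $ i\<bar> \<le> int l" by auto
  then show "\<bar>y $ i - z $ i\<bar> \<le> int (k + l)" by linarith
qed

lemma cube_refl [simp]: "z \<in> cube z k" by (simp add: cube_def)

lemma lattice_adj_sym: "lattice_adj x y \<longleftrightarrow> lattice_adj y x"
  by (simp add: lattice_adj_def abs_minus_commute)

lemma lattice_adj_cube:
  assumes "lattice_adj x y" shows "y \<in> cube x 1"
  unfolding cube_def
proof clarify
  fix i
  have "\<bar>x $ i - y $ i\<bar> \<le> (\<Sum>i\<in>UNIV. \<bar>x $ i - y $ i\<bar>)" by (rule member_le_sum) auto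
  then show "\<bar>y $ i - x $ i\<bar> \<le> int 1" using assms by (simp add: lattice_adj_def abs_minus_commute)
qed

lemma lattice_adj_axis:
  assumes "\<bar>s\<bar> = (1::int)"
  shows "lattice_adj x (x + axis i s)"
proof -
  have "(\<Sum>j\<in>UNIV. \<bar>x $ j - (x + axis i s) $ j\<bar>) = (\<Sum>j\<in>UNIV. if j = i then 1 else 0)"
    using assms by (intro sum.cong) (auto simp: axis_def)
  then show ?thesis by (simp add: lattice_adj_def)
qed

definition grad_energy :: "(int ^ 'd::finite) set \<Rightarrow> (int ^ 'd \<Rightarrow> real) \<Rightarrow> real" where
  "grad_energy W u = (\<Sum>x\<in>W. \<Sum>y\<in>W. if lattice_adj x y then (u x - u y)^2 else 0)"

lemma grad_energy_nonneg: "0 \<le> grad_energy W u"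
  unfolding grad_energy_def by (intro sum_nonneg) auto

lemma step_energy:
  assumes W: "finite W" and s: "\<bar>s\<bar> = (1::int)"
  shows "(\<Sum>y\<in>{y\<in>W. y + axis i s \<in> W}. (u y - u (y + axis i s))^2) \<le> grad_energy W u"
proof -
  have "(\<Sum>y\<in>{y\<in>W. y + axis i s \<in> W}. (u y - u (y + axis i s))^2)
      \<le> (\<Sum>y\<in>{y\<in>W. y + axis i s \<in> W}. \<Sum>z\<in>W. if lattice_adj y z then (u y - u z)^2 else 0)"
  proof (rule sum_mono)
    fix y assume y: "y \<in> {y\<in>W. y + axis i s \<in> W}"
    have "(u y - u (y + axis i s))^2 = (\<Sum>z\<in>{y + axis i s}. if lattice_adj y z then (u y - u z)^2 else 0)"
      by (simp add: lattice_adj_axis[OF s])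
    also have "... \<le> (\<Sum>z\<in>W. if lattice_adj y z then (u y - u z)^2 else 0)"
      using W y by (intro sum_mono2) auto
    finally show "(u y - u (y + axis i s))^2 \<le> (\<Sum>z\<in>W. if lattice_adj y z then (u y - u z)^2 else 0)" .
  qed
  also have "... \<le> grad_energy W u" unfolding grad_energy_def
    using W by (intro sum_mono2) (auto intro!: sum_nonneg)
  finally show ?thesis .
qed

text \<open>Telescoping along the axis: Cauchy-Schwarz costs one factor \<open>k\<close>, the number
  of steps the other, since each single step maps the summation set injectively and so uses every
  edge at most once in its direction.\<close>

lemma shift_axis_energy:
  fixes z :: "int ^ 'd::finite" and N :: nat
  assumes t: "\<bar>t\<bar> \<le> int m"
  defines "W \<equiv> cube z N"
  shows "(\<Sum>x\<in>{x\<in>W. x + axis i t \<in> W}. (u x - u (x + axis i t))^2) \<le> (real m)^2 * grad_energy W u"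
proof -
  define k where "k = nat \<bar>t\<bar>"
  define s where "s = (if 0 \<le> t then 1 else - 1 :: int)"
  have s: "\<bar>s\<bar> = 1" and t_eq: "t = s * int k" by (auto simp: s_def k_def)
  have km: "k \<le> m" using t by (simp add: k_def)
  define T where "T = {x\<in>W. x + axis i t \<in> W}"
  have finT: "finite T" by (simp add: T_def W_def)
  define p where "p j x = x + axis i (s * int j)" for j :: nat and x :: "int ^ 'd"
  have p_in: "p j x \<in> W" if "x \<in> T" "j \<le> k" for j x
    unfolding W_def cube_def
  proof clarify
    fix l
    have *: "\<bar>x $ l - z $ l\<bar> \<le> int N" "\<bar>(x + axis i t) $ l - z $ l\<bar> \<le> int N"
      using that(1) by (auto simp: T_def W_def cube_def)
    show "\<bar>p j x $ l - z $ l\<bar> \<le> int N"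
    proof (cases "l = i")
      case True
      then show ?thesis using * that(2) unfolding t_eq by (auto simp: p_def axis_def s_def split: if_splits)
    next
      case False then show ?thesis using * by (simp add: p_def axis_def)
    qed
  qed
  have p_Suc: "p (Suc j) x = p j x + axis i s" for j x
    by (simp add: p_def vec_eq_iff axis_def algebra_simps)
  have "(\<Sum>x\<in>T. (u x - u (x + axis i t))^2) \<le> (\<Sum>x\<in>T. real k * (\<Sum>j<k. (u (p j x) - u (p j x + axis i s))^2))"
  proof (rule sum_mono)
    fix x
    have "p 0 x = x" by (simp add: p_def vec_eq_iff axis_def)
    moreover have "p k x = x + axis i t" by (simp add: p_def t_eq)
    ultimately have "u x - u (x + axis i t) = u (p 0 x) - u (p k x)" by simp
    also have "... = (\<Sum>j<k. u (p j x) - u (p (Suc j) x))" by (rule sum_lessThan_telescope'[symmetric])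
    finally show "(u x - u (x + axis i t))^2 \<le> real k * (\<Sum>j<k. (u (p j x) - u (p j x + axis i s))^2)"
      using sum_power2_le[of "\<lambda>j. u (p j x) - u (p (Suc j) x)" "{..<k}"] by (simp add: p_Suc)
  qed
  also have "... = real k * (\<Sum>j<k. \<Sum>x\<in>T. (u (p j x) - u (p j x + axis i s))^2)"
    by (simp add: sum_distrib_left[symmetric] sum.swap[of _ T])
  also have "... \<le> real k * (\<Sum>j<k. grad_energy W u)"
  proof (intro mult_left_mono sum_mono)
    fix j assume j: "j \<in> {..<k}"
    have "(\<Sum>x\<in>T. (u (p j x) - u (p j x + axis i s))^2)
      \<le> (\<Sum>y\<in>{y\<in>W. y + axis i s \<in> W}. (u y - u (y + axis i s))^2)"
    proof (rule sum_le_inj[where f = "\<lambda>y. (u y - u (y + axis i s))^2" and g = "p j"])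
      show "inj_on (p j) T" by (auto simp: inj_on_def p_def)
      show "p j ` T \<subseteq> {y \<in> W. y + axis i s \<in> W}"
        using p_in[of _ j] p_in[of _ "Suc j"] j by (auto simp: p_Suc)
    qed (auto simp: W_def)
    also have "... \<le> grad_energy W u" by (rule step_energy[OF _ s]) (simp add: W_def)
    finally show "(\<Sum>x\<in>T. (u (p j x) - u (p j x + axis i s))^2) \<le> grad_energy W u" .
  qed simp
  also have "... = (real k)^2 * grad_energy W u" by (simp add: power2_eq_square)
  also have "... \<le> (real m)^2 * grad_energy W u"
    using km grad_energy_nonneg by (intro mult_right_mono power_mono) auto
  finally show ?thesis by (simp add: T_def)
qed

text \<open>The shift by \<open>v\<close> is performed one coordinate at a time; the cube contains all intermediate points.\<close>

lemma shift_energy: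
  fixes v z :: "int ^ 'd::finite" and N :: nat
  assumes v: "\<And>i. \<bar>v $ i\<bar> \<le> int m"
  defines "W \<equiv> cube z N"
  shows "(\<Sum>x\<in>{x\<in>W. x + v \<in> W}. (u x - u (x + v))^2) \<le> 2 ^ (CARD('d) + 1) * (real m)^2 * grad_energy W u"
proof -
  define T where "T = {x\<in>W. x + v \<in> W}"
  define part where "part I = (\<chi> i. if i \<in> I then v $ i else 0)" for I
  have finT: "finite T" by (simp add: T_def W_def)
  have in_W: "x + part I \<in> W" if "x \<in> T" for x I
    using that by (auto simp: T_def W_def cube_def part_def)
  \<comment> \<open>The coefficient \<open>2 ^ (card I + 1) - 2\<close> solves the recursion
    \<open>a' = 2 * a + 2\<close> that each further coordinate produces.\<close>
  have "(\<Sum>x\<in>T. (u x - u (x + part I))^2) \<le> (2 ^ (card I + 1) - 2) * (real m)^2 * grad_energy W u" if "finite I" for I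
    using that
  proof (induction I rule: finite_induct)
    case empty
    have "part {} = 0" by (simp add: part_def vec_eq_iff)
    then show ?case by simp
  next
    case (insert i I)
    have part_insert: "x + part (insert i I) = (x + part I) + axis i (v $ i)" for x
      using insert.hyps by (auto simp: part_def vec_eq_iff axis_def)
    have "(\<Sum>x\<in>T. (u x - u (x + part (insert i I)))^2) \<le>
       (\<Sum>x\<in>T. 2 * (u x - u (x + part I))^2 + 2 * (u (x + part I) - u ((x + part I) + axis i (v $ i)))^2)"
    proof (rule sum_mono)
      fix x
      have "(a - c)^2 \<le> 2 * (a - b)^2 + 2 * (b - c)^2" for a b c :: real
      proof -
        have "0 \<le> (a - 2 * b + c)^2" by simp
        then show ?thesis by (simp add: power2_eq_square algebra_simps)
      qed
      then show "(u x - u (x + part (insert i I)))^2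
        \<le> 2 * (u x - u (x + part I))^2 + 2 * (u (x + part I) - u ((x + part I) + axis i (v $ i)))^2"
        unfolding part_insert .
    qed
    also have "... = 2 * (\<Sum>x\<in>T. (u x - u (x + part I))^2)
        + 2 * (\<Sum>x\<in>T. (u (x + part I) - u ((x + part I) + axis i (v $ i)))^2)"
      by (simp add: sum.distrib sum_distrib_left)
    also have "(\<Sum>x\<in>T. (u (x + part I) - u ((x + part I) + axis i (v $ i)))^2)
      \<le> (\<Sum>y\<in>{y\<in>W. y + axis i (v $ i) \<in> W}. (u y - u (y + axis i (v $ i)))^2)"
    proof (rule sum_le_inj[where f = "\<lambda>y. (u y - u (y + axis i (v $ i)))^2" and g = "\<lambda>x. x + part I"])
      show "(\<lambda>x. x + part I) ` T \<subseteq> {y \<in> W. y + axis i (v $ i) \<in> W}"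
        using in_W[of _ I] in_W[of _ "insert i I"] part_insert by auto
    qed (auto simp: W_def inj_on_def)
    also have "... \<le> (real m)^2 * grad_energy W u"
      unfolding W_def by (rule shift_axis_energy) (rule v)
    also have "2 * (\<Sum>x\<in>T. (u x - u (x + part I))^2) + 2 * ((real m)^2 * grad_energy W u)
      \<le> 2 * ((2 ^ (card I + 1) - 2) * (real m)^2 * grad_energy W u) + 2 * ((real m)^2 * grad_energy W u)"
      using insert.IH by simp
    also have "... = (2 ^ (card (insert i I) + 1) - 2) * (real m)^2 * grad_energy W u"
      using insert.hyps by (simp add: algebra_simps)
    finally show ?case by simp
  qed
  from this[of UNIV]
  have "(\<Sum>x\<in>T. (u x - u (x + part UNIV))^2) \<le> (2 ^ (CARD('d) + 1) - 2) * (real m)^2 * grad_energy W u" by simp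
  also have "... \<le> 2 ^ (CARD('d) + 1) * (real m)^2 * grad_energy W u"
    using grad_energy_nonneg by (intro mult_right_mono) auto
  also have "part UNIV = v" by (simp add: part_def vec_eq_iff)
  finally show ?thesis by (simp add: T_def)
qed

text \<open>Substituting \<open>y = x + v\<close> turns the double sum into one shift estimate for
  each of the \<open>(4 * N + 1) ^ d\<close> possible differences.\<close>

lemma poincare_cube:
  fixes z :: "int ^ 'd::finite" and N :: nat
  defines "W \<equiv> cube z N"
  shows "(\<Sum>x\<in>W. \<Sum>y\<in>W. (u x - u y)^2)
    \<le> real ((4 * N + 1) ^ CARD('d)) * (2 ^ (CARD('d) + 1) * (real (2 * N))^2 * grad_energy W u)"
proof -
  define V where "V = cube (0 :: int ^ 'd) (2 * N)"
  have "(\<Sum>x\<in>W. \<Sum>y\<in>W. (u x - u y)^2) \<le> (\<Sum>x\<in>W. \<Sum>v\<in>V. if x + v \<in> W then (u x - u (x + v))^2 else 0)"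
  proof (rule sum_mono)
    fix x assume x: "x \<in> W"
    have "(\<Sum>y\<in>W. (u x - u y)^2) = (\<Sum>y\<in>W. (\<lambda>v. if x + v \<in> W then (u x - u (x + v))^2 else 0) (y - x))"
      by (intro sum.cong) auto
    also have "... \<le> (\<Sum>v\<in>V. if x + v \<in> W then (u x - u (x + v))^2 else 0)"
    proof (rule sum_le_inj)
      show "(\<lambda>y. y - x) ` W \<subseteq> V"
      proof (clarsimp simp: V_def cube_def)
        fix y i assume "y \<in> W"
        then have "\<bar>y $ i - z $ i\<bar> \<le> int N" "\<bar>x $ i - z $ i\<bar> \<le> int N" using x by (auto simp: W_def cube_def)
        then show "\<bar>y $ i - x $ i\<bar> \<le> 2 * int N" by linarith
      qed
    qed (auto simp: inj_on_def V_def)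
    finally show "(\<Sum>y\<in>W. (u x - u y)^2) \<le> (\<Sum>v\<in>V. if x + v \<in> W then (u x - u (x + v))^2 else 0)" .
  qed
  also have "... = (\<Sum>v\<in>V. \<Sum>x\<in>{x\<in>W. x + v \<in> W}. (u x - u (x + v))^2)"
    by (subst sum.swap) (simp add: sum.inter_filter W_def)
  also have "... \<le> (\<Sum>v\<in>V. 2 ^ (CARD('d) + 1) * (real (2 * N))^2 * grad_energy W u)"
    unfolding W_def by (intro sum_mono shift_energy) (auto simp: V_def cube_def)
  also have "... = real ((4 * N + 1) ^ CARD('d)) * (2 ^ (CARD('d) + 1) * (real (2 * N))^2 * grad_energy W u)"
    by (simp add: V_def card_cube)
  finally show ?thesis .
qed

text \<open>Comparison of \<open>f\<close> with its averages over cubes of side \<open>s\<close>, where \<open>s ^ d\<close> is about four times the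
  size of the support; the averages are then small.\<close>

lemma faber_krahn_cube:
  fixes z :: "int ^ 'd::finite"
  assumes N: "1 \<le> N" and M: "14 * N \<le> M" and S: "S \<subseteq> cube z N"
    and f0: "\<And>x. x \<in> cube z M - S \<Longrightarrow> f x = 0"
  shows "(\<Sum>x\<in>cube z M. (f x)^2) \<le> 2 ^ (CARD('d) + 9) * real (card S) powr (2 / real CARD('d)) * grad_energy (cube z M) f"
proof (cases "S = {}")
  case True
  then show ?thesis using f0 by simp
next
  case False
  define d where "d = CARD('d)"
  have d: "1 \<le> d" by (simp add: d_def Suc_leI)
  define W where "W = cube z M"
  have finS: "finite S" using S finite_subset finite_cube by blast
  have NM: "N \<le> M" using M by simp
  have SW: "S \<subseteq> W" using S cube_mono[OF NM, of z] by (auto simp: W_def)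
  have cS: "1 \<le> card S" using False finS by (simp add: Suc_leI card_gt_0_iff)
  \<comment> \<open>Since \<open>S\<close> lies in a cube of radius \<open>N\<close>, the rounded
    side is at most \<open>13 * N\<close>. This is the origin of the 14 in the hypothesis on
    \<open>M\<close>: the shifts below keep \<open>S\<close> inside the large cube.\<close>
  define r where "r = (4 * real (card S)) powr (1 / real d)"
  have r_pow: "r ^ d = 4 * real (card S)"
    using d cS by (simp add: r_def powr_realpow[symmetric] powr_powr)
  have r1: "1 \<le> r" unfolding r_def using cS by (intro ge_one_powr_ge_zero) auto
  have r_le: "r \<le> 12 * real N"
  proof -
    have "card S \<le> (2 * N + 1) ^ d" using card_mono[OF finite_cube S] by (simp add: card_cube d_def)
    also have "... \<le> (3 * N) ^ d" using N by (intro power_mono) auto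
    finally have "real (card S) \<le> real ((3 * N) ^ d)" by (simp only: of_nat_le_iff)
    then have "r ^ d \<le> 4 * (3 * real N) ^ d" by (simp add: r_pow)
    also have "... \<le> 4 ^ d * (3 * real N) ^ d"
      using d power_increasing[of 1 d "4::real"] by (intro mult_right_mono) auto
    also have "... = (12 * real N) ^ d" by (subst power_mult_distrib[symmetric]) simp
    finally show ?thesis using d by (subst (asm) power_mono_iff) (use r1 in auto)
  qed
  define s where "s = nat \<lceil>r\<rceil>"
  have s: "r \<le> real s" "real s \<le> 2 * r" "real s \<le> 13 * real N" "1 \<le> s"
  proof -
    show "r \<le> real s" using r1 by (simp add: s_def)
    have up: "real s \<le> r + 1" using r1 by (simp add: s_def)
    then show "real s \<le> 2 * r" using r1 by linarith
    show "real s \<le> 13 * real N" using up r_le N by linarith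
    show "1 \<le> s" using r1 by (simp add: s_def le_nat_iff)
  qed
  define V where "V = {v :: int ^ 'd. \<forall>i. v $ i \<in> {0..<int s}}"
  have finV: "finite V" unfolding V_def by (rule card_vec_set) simp
  have cardV: "card V = s ^ d"
    unfolding V_def d_def by (subst card_vec_set) auto
  have xv: "x + v \<in> W" if "x \<in> S" "v \<in> V" for x v
    unfolding W_def cube_def
  proof clarify
    fix i
    have "\<bar>x $ i - z $ i\<bar> \<le> int N" "0 \<le> v $ i" "v $ i < int s" using that S by (auto simp: cube_def V_def)
    moreover have "int s \<le> 13 * int N" using s(3) by linarith
    ultimately show "\<bar>(x + v) $ i - z $ i\<bar> \<le> int M" using M by auto
  qed
  define J where "J = (\<Sum>x\<in>S. (f x)^2)"
  define E where "E = grad_energy W f"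
  have J_eq: "(\<Sum>x\<in>W. (f x)^2) = J" unfolding J_def
    by (rule sum.mono_neutral_right) (use SW f0 in \<open>auto simp: W_def\<close>)
  have shift: "(\<Sum>x\<in>S. (f x - f (x + v))^2) \<le> 2 ^ (d + 1) * (real s)^2 * E" if v: "v \<in> V" for v
  proof -
    have "(\<Sum>x\<in>S. (f x - f (x + v))^2) \<le> (\<Sum>x\<in>{x\<in>W. x + v \<in> W}. (f x - f (x + v))^2)"
      by (intro sum_mono2) (use SW xv v in \<open>auto simp: W_def\<close>)
    also have "... \<le> 2 ^ (d + 1) * (real s)^2 * E" unfolding W_def E_def d_def
      by (rule shift_energy) (use v in \<open>auto simp: V_def intro: less_imp_le\<close>)
    finally show ?thesis .
  qed
  \<comment> \<open>At most \<open>card S\<close> shifts lead from \<open>x\<close> into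
    \<open>S\<close>, so Cauchy-Schwarz costs \<open>card S\<close> and not
    \<open>card V\<close>.\<close>
  have local_mass: "(\<Sum>v\<in>V. f (x + v))^2 \<le> real (card S) * (\<Sum>v\<in>V. (f (x + v))^2)" if x: "x \<in> S" for x
  proof -
    define V' where "V' = {v\<in>V. x + v \<in> S}"
    have V': "V' \<subseteq> V" by (auto simp: V'_def)
    have vanish: "f (x + v) = 0" if "v \<in> V - V'" for v
      using that xv[OF x] f0[of "x + v"] by (auto simp: V'_def W_def)
    have "(\<Sum>v\<in>V. f (x + v)) = (\<Sum>v\<in>V'. f (x + v))"
      by (rule sum.mono_neutral_right[OF finV V']) (use vanish in auto)
    then have "(\<Sum>v\<in>V. f (x + v))^2 \<le> real (card V') * (\<Sum>v\<in>V'. (f (x + v))^2)"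
      by (simp add: sum_power2_le)
    also have "... \<le> real (card S) * (\<Sum>v\<in>V. (f (x + v))^2)"
    proof (rule mult_mono)
      have "card V' \<le> card S"
        by (rule card_inj_on_le[of "\<lambda>v. x + v"]) (use finS in \<open>auto simp: V'_def inj_on_def\<close>)
      then show "real (card V') \<le> real (card S)" by simp
      show "(\<Sum>v\<in>V'. (f (x + v))^2) \<le> (\<Sum>v\<in>V. (f (x + v))^2)"
        using finV V' by (intro sum_mono2) auto
    qed (auto intro: sum_nonneg)
    finally show ?thesis .
  qed
  have mass_shift: "(\<Sum>x\<in>S. (f (x + v))^2) \<le> J" if v: "v \<in> V" for v
  proof -
    have "(\<Sum>x\<in>S. (f (x + v))^2) \<le> (\<Sum>y\<in>W. (f y)^2)"
      by (rule sum_le_inj[where f = "\<lambda>y. (f y)^2"]) (use xv v in \<open>auto simp: inj_on_def W_def\<close>)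
    then show ?thesis by (simp add: J_eq)
  qed
  define X where "X = real (s ^ d)"
  have X: "4 * real (card S) \<le> X" "0 < X"
  proof -
    have "r ^ d \<le> real s ^ d" using s r1 by (intro power_mono) auto
    then show "4 * real (card S) \<le> X" by (simp add: X_def r_pow)
    show "0 < X" using s by (simp add: X_def)
  qed
  have "X^2 * J = (\<Sum>x\<in>S. (X * f x)^2)" by (simp add: J_def power_mult_distrib sum_distrib_left)
  also have "... \<le> (\<Sum>x\<in>S. 2 * (X * (\<Sum>v\<in>V. (f x - f (x + v))^2)) + 2 * (real (card S) * (\<Sum>v\<in>V. (f (x + v))^2)))"
  proof (rule sum_mono)
    fix x assume x: "x \<in> S"
    have "X * f x = (\<Sum>v\<in>V. f x - f (x + v)) + (\<Sum>v\<in>V. f (x + v))"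
      by (simp add: sum_subtractf cardV X_def)
    then have "(X * f x)^2 \<le> 2 * (\<Sum>v\<in>V. f x - f (x + v))^2 + 2 * (\<Sum>v\<in>V. f (x + v))^2"
      using sum_squares_bound[of "\<Sum>v\<in>V. f x - f (x + v)" "\<Sum>v\<in>V. f (x + v)"]
      by (simp add: power2_sum)
    also have "(\<Sum>v\<in>V. f x - f (x + v))^2 \<le> X * (\<Sum>v\<in>V. (f x - f (x + v))^2)"
      using sum_power2_le[of "\<lambda>v. f x - f (x + v)" V] by (simp add: cardV X_def)
    finally show "(X * f x)^2 \<le> 2 * (X * (\<Sum>v\<in>V. (f x - f (x + v))^2)) + 2 * (real (card S) * (\<Sum>v\<in>V. (f (x + v))^2))"
      using local_mass[OF x] by linarith
  qed
  also have "... = 2 * X * (\<Sum>v\<in>V. \<Sum>x\<in>S. (f x - f (x + v))^2) + 2 * real (card S) * (\<Sum>v\<in>V. \<Sum>x\<in>S. (f (x + v))^2)"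
    by (simp add: sum.distrib sum_distrib_left[symmetric] sum.swap[of _ S] mult_ac)
  also have "... \<le> 2 * X * (\<Sum>v\<in>V. 2 ^ (d + 1) * (real s)^2 * E) + 2 * real (card S) * (\<Sum>v\<in>V. J)"
    using X shift mass_shift by (intro add_mono mult_left_mono sum_mono) auto
  also have "... = X^2 * (2 * 2 ^ (d + 1) * (real s)^2 * E) + 2 * real (card S) * (X * J)"
    by (simp add: cardV X_def power2_eq_square)
  \<comment> \<open>As \<open>card S \<le> X / 4\<close>, this is at most half of the left side and
    is absorbed.\<close>
  also have "2 * real (card S) * (X * J) \<le> (X / 2) * (X * J)"
    using X by (intro mult_right_mono) (auto simp: J_def sum_nonneg)
  finally have "X^2 * J \<le> X^2 * (2 ^ (d + 3) * (real s)^2 * E)"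
    by (simp add: power2_eq_square power_add algebra_simps)
  then have "J \<le> 2 ^ (d + 3) * (real s)^2 * E" using X by simp
  also have "... \<le> 2 ^ (d + 3) * (64 * real (card S) powr (2 / real d)) * E"
  proof (intro mult_right_mono mult_left_mono)
    have "(real s)^2 \<le> (2 * r)^2" using s by (intro power_mono) auto
    also have "... = 4 * (4 * real (card S)) powr (2 / real d)"
      using cS by (simp add: r_def power2_eq_square powr_add[symmetric])
    also have "... = 4 * (4 powr (2 / real d) * real (card S) powr (2 / real d))"
      by (simp add: powr_mult)
    also have "(4::real) powr (2 / real d) \<le> 4 powr 2"
      using d by (intro powr_mono) (auto simp: field_simps)
    also have "(4::real) powr 2 = 16" by (simp add: powr_numeral)
    finally show "(real s)^2 \<le> 64 * real (card S) powr (2 / real d)"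
      by (simp add: mult_right_mono)
  qed (auto simp: E_def grad_energy_nonneg)
  also have "... = 2 ^ (d + 9) * real (card S) powr (2 / real d) * E" by (simp add: power_add)
  finally show ?thesis using J_eq by (simp add: d_def W_def E_def)
qed

section \<open>Cubes of the lattice as networks\<close>

lemma conductance_sym: "conductance \<mu> x y = conductance \<mu> y x"
  by (simp add: conductance_def lattice_adj_sym insert_commute)

lemma conductance_ge:
  assumes "\<forall>e\<in>lattice_edges. 1 \<le> \<mu> e"
  shows "conductance \<mu> x y = 0 \<or> 1 \<le> conductance \<mu> x y"
    and "lattice_adj x y \<Longrightarrow> 1 \<le> conductance \<mu> x y"
  using assms by (auto simp: conductance_def lattice_edges_def)

lemma lattice_network:
  assumes "\<forall>e\<in>lattice_edges. 1 \<le> \<mu> e"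
  shows "network (cube z k) (conductance \<mu>)"
proof
  show "0 \<le> conductance \<mu> x y" for x y using conductance_ge(1)[of \<mu> x y, OF assms] by auto
qed (simp_all add: conductance_sym)

lemma generator_eq_lap:
  assumes \<mu>: "\<forall>e\<in>lattice_edges. 1 \<le> \<mu> e" and sub: "cube x 1 \<subseteq> cube z k"
  shows "network.lap (cube z k) (conductance \<mu>) h x = generator \<mu> h x"
proof -
  have "generator \<mu> h x = (\<Sum>\<^sub>\<infinity>y\<in>cube z k. conductance \<mu> x y * (h y - h x))"
    unfolding generator_def
  proof (rule infsum_cong_neutral)
    fix y assume "y \<in> UNIV - cube z k"
    then have "\<not> lattice_adj x y" using sub lattice_adj_cube by blast
    then show "conductance \<mu> x y * (h y - h x) = 0" by (simp add: conductance_def)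
  qed auto
  then show ?thesis by (simp add: network.lap_def[OF lattice_network[OF \<mu>]])
qed

lemma grad_energy_le:
  assumes \<mu>: "\<forall>e\<in>lattice_edges. 1 \<le> \<mu> e"
  shows "grad_energy W u \<le> (\<Sum>x\<in>W. \<Sum>y\<in>W. conductance \<mu> x y * (u x - u y)^2)"
  unfolding grad_energy_def
proof (intro sum_mono)
  fix x y
  show "(if lattice_adj x y then (u x - u y)^2 else 0) \<le> conductance \<mu> x y * (u x - u y)^2"
  proof (cases "lattice_adj x y")
    case True
    then show ?thesis using mult_right_mono[OF conductance_ge(2)[of \<mu>, OF \<mu> True], of "(u x - u y)^2"] by simp
  next
    case False then show ?thesis by (simp add: conductance_def)
  qed
qed

text \<open>The largest \<open>\<epsilon>\<close> permitted by the two smallness conditions: the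
  first drives the De Giorgi recursion, the second closes it at the lattice scale.\<close>

definition degiorgi_eps :: "real \<Rightarrow> real \<Rightarrow> real \<Rightarrow> nat \<Rightarrow> real" where
  "degiorgi_eps A D K d =
     min ((1 / (16 * A * D * K * 4 powr (2 / real d) * 2 ^ (d + 2))) powr (real d / 2)) (1 / (4 * sqrt K) ^ d)"

lemma degiorgi_eps:
  assumes "0 < A" "0 < D" "0 < K" "1 \<le> d"
  shows "0 < degiorgi_eps A D K d"
    and "16 * A * D * K * 4 powr (2 / real d) * degiorgi_eps A D K d powr (2 / real d) * 2 ^ (d + 2) \<le> 1"
    and "degiorgi_eps A D K d * (4 * sqrt K) ^ d \<le> 1"
proof -
  define e where "e = degiorgi_eps A D K d"
  define X where "X = 16 * A * D * K * 4 powr (2 / real d) * 2 ^ (d + 2)"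
  have X: "0 < X" using assms by (simp add: X_def)
  have e_def': "e = min ((1 / X) powr (real d / 2)) (1 / (4 * sqrt K) ^ d)"
    unfolding e_def X_def degiorgi_eps_def ..
  show pos: "0 < degiorgi_eps A D K d" unfolding e_def[symmetric] e_def' using X assms by simp
  have "e powr (2 / real d) \<le> ((1 / X) powr (real d / 2)) powr (2 / real d)"
    using pos by (intro powr_mono2) (auto simp: e_def[symmetric] e_def')
  also have "... = 1 / X" using X assms by (simp add: powr_powr)
  finally have "X * e powr (2 / real d) \<le> 1" using X by (simp add: field_simps)
  then show "16 * A * D * K * 4 powr (2 / real d) * degiorgi_eps A D K d powr (2 / real d) * 2 ^ (d + 2) \<le> 1"
    by (simp add: X_def e_def mult_ac)
  have "e * (4 * sqrt K) ^ d \<le> (1 / (4 * sqrt K) ^ d) * (4 * sqrt K) ^ d"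
    using assms by (intro mult_right_mono) (auto simp: e_def')
  then show "degiorgi_eps A D K d * (4 * sqrt K) ^ d \<le> 1" using assms by (simp add: e_def)
qed

text \<open>The gradient bound is demanded across every edge, the lower comparison only from scale
  \<open>m\<close> on: leaving a cube of radius \<open>j \<ge> m\<close> costs at least
  \<open>j / 2\<close>. The upper tail of \<mu> enters the analysis only through this
  predicate.\<close>

definition adapted_dist ::
    "((int ^ 'd::finite) set \<Rightarrow> real) \<Rightarrow> real \<Rightarrow> int ^ 'd \<Rightarrow> nat \<Rightarrow> (int ^ 'd \<Rightarrow> real) \<Rightarrow> bool" where
  "adapted_dist \<mu> K z m \<rho> \<longleftrightarrow>
     (\<forall>x y. conductance \<mu> x y * (\<rho> x - \<rho> y)^2 \<le> K) \<and>
     (\<forall>y. \<rho> y \<le> real_of_int (\<Sum>i\<in>UNIV. \<bar>z $ i - y $ i\<bar>)) \<and>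
     (\<forall>j y. m \<le> j \<longrightarrow> \<rho> y < real j / 2 \<longrightarrow> y \<in> cube z j)"

text \<open>On a cube of radius \<open>l\<close> one has \<open>\<rho> \<le> d * l\<close>, and
  \<open>\<rho> < 2 * d * l\<close> forces a vertex into the cube of radius
  \<open>4 * d * l\<close>; hence the ratio \<open>k = 4 * d\<close> of consecutive cubes. The
  factor 14 is that of \<open>faber_krahn_cube\<close>, and \<open>3 ^ d\<close>, the size of a cube
  of radius one, is a crude degree bound.\<close>

lemma lattice_harnack_scale:
  fixes z :: "int ^ 'd::finite" and \<mu> K m \<rho>
  defines "d \<equiv> CARD('d)"
  defines "k \<equiv> 4 * d"
  defines "A \<equiv> 2 ^ (d + 9) :: real" and "D \<equiv> 3 ^ d :: nat"
  assumes \<mu>: "\<forall>e\<in>lattice_edges. 1 \<le> \<mu> e" and K: "0 < K" and m: "1 \<le> m"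
    and \<rho>: "adapted_dist \<mu> K z m \<rho>"
  shows "harnack_scale (cube z (14 * k ^ 3 * m)) (conductance \<mu>) (cube z (k ^ 3 * m)) A d \<rho> K D
    (degiorgi_eps A (real D) K d) (real m) (cube z m) (cube z (k * m)) (cube z (k ^ 2 * m))
    (real (d * m)) (real (d * k * m)) (real (d * k ^ 2 * m)) (real ((29 * k ^ 3) ^ d))
    (real ((5 * k ^ 2) ^ d) * (2 ^ (d + 1) * real (4 * k ^ 4)))"
proof -
  have d: "1 \<le> d" by (simp add: d_def Suc_leI)
  have k: "1 \<le> k" using d by (simp add: k_def)
  have AD: "0 < A" "0 < real D" by (simp_all add: A_def D_def)
  define F where "F = cube z (14 * k ^ 3 * m)"
  have \<rho>_le: "\<rho> y \<le> real (d * l)" if "y \<in> cube z l" for y l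
  proof -
    have "(\<Sum>i\<in>UNIV. \<bar>z $ i - y $ i\<bar>) \<le> (\<Sum>i\<in>(UNIV :: 'd set). int l)"
      using that by (intro sum_mono) (auto simp: cube_def abs_minus_commute)
    then have "real_of_int (\<Sum>i\<in>UNIV. \<bar>z $ i - y $ i\<bar>) \<le> real_of_int (int (d * l))"
      by (simp only: of_int_le_iff) (simp add: d_def)
    moreover have "\<rho> y \<le> real_of_int (\<Sum>i\<in>UNIV. \<bar>z $ i - y $ i\<bar>)"
      using \<rho> by (simp add: adapted_dist_def)
    ultimately show ?thesis by (simp del: of_nat_mult)
  qed
  have level: "{x\<in>F. \<rho> x < 2 * real (d * l)} \<subseteq> cube z (k * l)" if l: "m \<le> k * l" for l
  proof
    fix x assume "x \<in> {x\<in>F. \<rho> x < 2 * real (d * l)}"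
    then have "\<rho> x < real (k * l) / 2" by (simp add: k_def)
    then show "x \<in> cube z (k * l)" using \<rho> l by (auto simp: adapted_dist_def)
  qed
  have cube_F: "cube z l \<subseteq> F" if "l \<le> 14 * k ^ 3 * m" for l
    unfolding F_def by (rule cube_mono[OF that])
  have kp: "k \<le> k ^ 2" "k ^ 2 \<le> k ^ 3" "k \<le> k ^ 3" "1 \<le> k ^ 3" "1 \<le> k ^ 2"
    using k by (auto intro: power_increasing[of _ _ k, simplified] self_le_power)
  have mk: "1 * m \<le> 14 * k ^ 3 * m" "k * m \<le> 14 * k ^ 3 * m" "k ^ 2 * m \<le> 14 * k ^ 3 * m" "k ^ 3 * m \<le> 14 * k ^ 3 * m"
    using kp by (intro mult_right_mono; linarith)+
  have le_mult: "real m \<le> real (a * m)" if "1 \<le> a" for a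
    using mult_le_mono1[OF that, of m] by (simp only: of_nat_le_iff nat_mult_1)
  interpret network F "conductance \<mu>" unfolding F_def by (rule lattice_network[OF \<mu>])
  have en_ge: "grad_energy F f \<le> en f f" for f
    using grad_energy_le[OF \<mu>, of F f] by (simp add: en_def power2_eq_square)
  have fk: "network_fk F (conductance \<mu>) (cube z (k ^ 3 * m)) A d"
  proof
    show "cube z (k ^ 3 * m) \<subseteq> F" by (rule cube_F[OF mk(4)])
    fix f :: "int ^ 'd \<Rightarrow> real" and S
    assume S: "S \<subseteq> cube z (k ^ 3 * m)" and f0: "\<And>x. x \<in> F - S \<Longrightarrow> f x = 0"
    have "(\<Sum>x\<in>F. (f x)^2) \<le> 2 ^ (d + 9) * real (card S) powr (2 / real d) * grad_energy F f"
      unfolding F_def d_def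
      by (rule faber_krahn_cube[where N = "k ^ 3 * m"]) (use S f0 kp m in \<open>auto simp: F_def\<close>)
    also have "... \<le> A * real (card S) powr (2 / real d) * en f f"
      unfolding A_def using en_ge by (intro mult_left_mono) auto
    finally show "(\<Sum>x\<in>F. (f x)^2) \<le> A * real (card S) powr (2 / real d) * en f f" .
  qed (use AD d in auto)
  have hn: "harnack_network F (conductance \<mu>) (cube z (k ^ 3 * m)) A d \<rho> K D (degiorgi_eps A (real D) K d)"
  proof (intro harnack_network.intro harnack_network_axioms.intro fk K)
    show "conductance \<mu> x y * (\<rho> x - \<rho> y)^2 \<le> K" for x y using \<rho> by (simp add: adapted_dist_def)
    show "conductance \<mu> x y = 0 \<or> 1 \<le> conductance \<mu> x y" for x y by (rule conductance_ge(1)[OF \<mu>])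
    show "card {y \<in> F. conductance \<mu> x y \<noteq> 0} \<le> D" for x
    proof -
      have "card {y \<in> F. conductance \<mu> x y \<noteq> 0} \<le> card (cube x 1)"
        by (intro card_mono) (auto simp: conductance_def simp del: One_nat_def intro: lattice_adj_cube split: if_splits)
      then show ?thesis by (simp add: card_cube D_def d_def)
    qed
  qed (use degiorgi_eps[OF AD K d] in auto)
  show ?thesis
    unfolding F_def[symmetric]
  proof (intro harnack_scale.intro harnack_scale_axioms.intro hn)
    show "0 < real m" using m by simp
    show "1 \<le> D" by (simp add: D_def)
    show "0 < real ((5 * k ^ 2) ^ d) * (2 ^ (d + 1) * real (4 * k ^ 4))" using k by simp
    show "0 < real ((29 * k ^ 3) ^ d)" using k by simp
    show "real m \<le> real (d * m)" "real m \<le> real (d * k * m)" "real m \<le> real (d * k ^ 2 * m)"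
      using d k kp by (auto intro!: le_mult simp del: of_nat_mult simp: Suc_le_eq)
    show "cube z m \<subseteq> {x \<in> F. \<rho> x \<le> real (d * m)}"
      using cube_F[OF mk(1)] \<rho>_le[of _ m] by auto
    show "cube z (k * m) \<subseteq> {x \<in> F. \<rho> x \<le> real (d * k * m)}"
      using cube_F[OF mk(2)] \<rho>_le[of _ "k * m"] by (auto simp: mult_ac)
    show "cube z (k ^ 2 * m) \<subseteq> {x \<in> F. \<rho> x \<le> real (d * k ^ 2 * m)}"
      using cube_F[OF mk(3)] \<rho>_le[of _ "k ^ 2 * m"] by (auto simp: mult_ac)
    show "{x \<in> F. \<rho> x < 2 * real (d * m)} \<subseteq> cube z (k * m)"
      using level[of m] k by simp
    show "{x \<in> F. \<rho> x < 2 * real (d * k * m)} \<subseteq> cube z (k ^ 2 * m)"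
      using level[of "k * m"] kp by (simp add: mult_ac power2_eq_square)
    show "{x \<in> F. \<rho> x < 2 * real (d * k ^ 2 * m)} \<subseteq> cube z (k ^ 3 * m)"
      using level[of "k ^ 2 * m"] kp by (simp add: mult_ac power2_eq_square power3_eq_cube)
    show "real (card F) \<le> real ((29 * k ^ 3) ^ d) * real m ^ d"
    proof -
      have "1 \<le> k ^ 3 * m" using kp m by (metis mult_le_mono nat_mult_1)
      then have "2 * (14 * k ^ 3 * m) + 1 \<le> 29 * k ^ 3 * m" by simp
      then have "(2 * (14 * k ^ 3 * m) + 1) ^ d \<le> (29 * k ^ 3 * m) ^ d" by (rule power_mono) simp
      then have "card F \<le> (29 * k ^ 3) ^ d * m ^ d"
        by (simp add: F_def card_cube d_def power_mult_distrib)
      then have "real (card F) \<le> real ((29 * k ^ 3) ^ d * m ^ d)" by (simp only: of_nat_le_iff)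
      then show ?thesis by simp
    qed
    show "real m ^ d \<le> real (card (cube z (k * m)))"
    proof -
      have "m \<le> k * m" using k by simp
      then have "m \<le> 2 * (k * m) + 1" by linarith
      then have "m ^ d \<le> (2 * (k * m) + 1) ^ d" by (rule power_mono) simp
      then have "m ^ d \<le> card (cube z (k * m))" by (simp add: card_cube d_def)
      then have "real (m ^ d) \<le> real (card (cube z (k * m)))" by (simp only: of_nat_le_iff)
      then show ?thesis by simp
    qed
    fix u :: "int ^ 'd \<Rightarrow> real"
    let ?W = "cube z (k ^ 2 * m)"
    have "(\<Sum>x\<in>?W. \<Sum>y\<in>?W. (u x - u y)^2)
      \<le> real ((4 * (k ^ 2 * m) + 1) ^ d) * (2 ^ (d + 1) * (real (2 * (k ^ 2 * m)))^2 * grad_energy ?W u)"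
      unfolding d_def by (rule poincare_cube)
    also have "... \<le> real ((5 * k ^ 2 * m) ^ d) * (2 ^ (d + 1) * (real (2 * (k ^ 2 * m)))^2 *
        (\<Sum>x\<in>?W. \<Sum>y\<in>?W. conductance \<mu> x y * (u x - u y)^2))"
    proof (intro mult_mono mult_left_mono grad_energy_le[OF \<mu>])
      have "1 \<le> k ^ 2 * m" using kp m by (metis mult_le_mono nat_mult_1)
      then have "4 * (k ^ 2 * m) + 1 \<le> 5 * k ^ 2 * m" by simp
      then have "(4 * (k ^ 2 * m) + 1) ^ d \<le> (5 * k ^ 2 * m) ^ d" by (rule power_mono) simp
      then show "real ((4 * (k ^ 2 * m) + 1) ^ d) \<le> real ((5 * k ^ 2 * m) ^ d)" by (simp only: of_nat_le_iff)
    qed (auto simp: grad_energy_nonneg)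
    also have "... = real ((5 * k ^ 2) ^ d) * (2 ^ (d + 1) * real (4 * k ^ 4)) * real m ^ (d + 2) *
        (\<Sum>x\<in>?W. \<Sum>y\<in>?W. conductance \<mu> x y * (u x - u y)^2)"
    proof -
      have "real ((5 * k ^ 2 * m) ^ d) = real ((5 * k ^ 2) ^ d) * real m ^ d"
        by (simp add: power_mult_distrib)
      moreover have "(real (2 * (k ^ 2 * m)))^2 = real (4 * k ^ 4) * real m ^ 2"
        by (simp add: power2_eq_square power4_eq_xxxx)
      ultimately show ?thesis by (simp only: power_add mult_ac)
    qed
    finally show "(\<Sum>x\<in>?W. \<Sum>y\<in>?W. (u x - u y)^2) \<le>
      real ((5 * k ^ 2) ^ d) * (2 ^ (d + 1) * real (4 * k ^ 4)) * real m ^ (d + 2) *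
        (\<Sum>x\<in>?W. \<Sum>y\<in>?W. conductance \<mu> x y * (u x - u y)^2)" .
  qed
qed

text \<open>The order of quantifiers matters: \<open>C_harnack\<close> depends only on
  \<open>K\<close> and the dimension, so \<open>C\<close> is fixed before \<mu>, \<open>z\<close>,
  \<open>m\<close>, \<rho> and \<open>h\<close>. It is raised to at least one so that its powers
  along chains increase.\<close>

lemma lattice_harnack:
  fixes K :: real
  assumes K: "0 < K"
  shows "\<exists>C\<ge>1. \<forall>(\<mu> :: (int ^ 'd::finite) set \<Rightarrow> real) z m \<rho> h.
    (\<forall>e\<in>lattice_edges. 1 \<le> \<mu> e) \<longrightarrow> 1 \<le> m \<longrightarrow> adapted_dist \<mu> K z m \<rho> \<longrightarrow>
    (\<forall>x\<in>cube z (14 * (4 * CARD('d)) ^ 3 * m). 0 \<le> h x) \<longrightarrow>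
    (\<forall>x\<in>cube z ((4 * CARD('d)) ^ 3 * m). generator \<mu> h x = 0) \<longrightarrow>
    (\<forall>x\<in>cube z m. \<forall>y\<in>cube z m. h x \<le> C * h y)"
proof -
  define d where "d = CARD('d)"
  define k where "k = 4 * d"
  define A :: real where "A = 2 ^ (d + 9)"
  define D :: nat where "D = 3 ^ d"
  define C where "C = harnack_scale.C_harnack A d K D (degiorgi_eps A (real D) K d)
      (real ((29 * k ^ 3) ^ d)) (real ((5 * k ^ 2) ^ d) * (2 ^ (d + 1) * real (4 * k ^ 4)))"
  have main: "\<forall>x\<in>cube z m. \<forall>y\<in>cube z m. h x \<le> max C 1 * h y"
    if \<mu>: "\<forall>e\<in>lattice_edges. 1 \<le> \<mu> e" and m: "1 \<le> m" and \<rho>: "adapted_dist \<mu> K z m \<rho>"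
      and h: "\<forall>x\<in>cube z (14 * k ^ 3 * m). 0 \<le> h x"
      and harm: "\<forall>x\<in>cube z (k ^ 3 * m). generator \<mu> h x = 0"
    for \<mu> :: "(int ^ 'd) set \<Rightarrow> real" and z m \<rho> h
  proof -
    interpret harnack_scale "cube z (14 * k ^ 3 * m)" "conductance \<mu>" "cube z (k ^ 3 * m)" A d \<rho> K D
      "degiorgi_eps A (real D) K d" "real m" "cube z m" "cube z (k * m)" "cube z (k ^ 2 * m)"
      "real (d * m)" "real (d * k * m)" "real (d * k ^ 2 * m)" "real ((29 * k ^ 3) ^ d)"
      "real ((5 * k ^ 2) ^ d) * (2 ^ (d + 1) * real (4 * k ^ 4))"
      unfolding k_def A_def D_def d_def
      by (rule lattice_harnack_scale[OF \<mu> K m \<rho>])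
    have C: "C = C_harnack" by (simp add: C_def)
    have harm': "lap h x = 0" if x: "x \<in> cube z (k ^ 3 * m)" for x
    proof -
      have "1 \<le> k ^ 3 * m" using m by (simp add: k_def d_def)
      then have "k ^ 3 * m + 1 \<le> 14 * k ^ 3 * m" by simp
      then have "cube x 1 \<subseteq> cube z (14 * k ^ 3 * m)"
        using cube_shift[OF x] cube_mono by blast
      then show ?thesis using generator_eq_lap[OF \<mu>, of x z] harm x by simp
    qed
    have sub: "cube z m \<subseteq> cube z (14 * k ^ 3 * m)" using W_subs by blast
    have "h x \<le> max C 1 * h y" if "x \<in> cube z m" "y \<in> cube z m" for x y
    proof -
      have "h x \<le> C * h y" unfolding C using h harm' that W_subs(1) by (intro harnack) auto
      also have "... \<le> max C 1 * h y" using h that sub by (intro mult_right_mono) auto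
      finally show ?thesis .
    qed
    then show ?thesis by blast
  qed
  show ?thesis
    by (rule exI[of _ "max C 1"]) (use main in \<open>auto simp: k_def d_def\<close>)
qed

section \<open>First passage percolation\<close>

definition l1_dist :: "int ^ 'd::finite \<Rightarrow> int ^ 'd \<Rightarrow> nat" where
  "l1_dist x y = nat (\<Sum>i\<in>UNIV. \<bar>x $ i - y $ i\<bar>)"

lemma int_l1_dist: "int (l1_dist x y) = (\<Sum>i\<in>UNIV. \<bar>x $ i - y $ i\<bar>)"
  by (simp add: l1_dist_def sum_nonneg)

lemma l1_dist_triangle: "l1_dist x z \<le> l1_dist x y + l1_dist y z"
proof -
  have "(\<Sum>i\<in>UNIV. \<bar>x $ i - z $ i\<bar>) \<le> (\<Sum>i\<in>UNIV. \<bar>x $ i - y $ i\<bar> + \<bar>y $ i - z $ i\<bar>)"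
    by (intro sum_mono) linarith
  then have "int (l1_dist x z) \<le> int (l1_dist x y + l1_dist y z)"
    by (simp only: int_l1_dist of_nat_add sum.distrib)
  then show ?thesis by (simp only: of_nat_le_iff)
qed

lemma lattice_adj_l1: "lattice_adj x y \<longleftrightarrow> l1_dist x y = 1"
  unfolding lattice_adj_def int_l1_dist[symmetric] by linarith

lemma l1_dist_0 [simp]: "l1_dist x x = 0" by (simp add: l1_dist_def)

lemma l1_dist_eq_0: "l1_dist x y = 0 \<Longrightarrow> x = y"
proof -
  assume "l1_dist x y = 0"
  then have "(\<Sum>i\<in>UNIV. \<bar>x $ i - y $ i\<bar>) = 0" using int_l1_dist[of x y] by simp
  then show ?thesis by (subst (asm) sum_nonneg_eq_0_iff) (auto simp: vec_eq_iff)
qed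

lemma l1_dist_cube: "l1_dist x y \<le> k \<Longrightarrow> y \<in> cube x k"
  unfolding cube_def
proof clarify
  fix i assume "l1_dist x y \<le> k"
  then have "(\<Sum>i\<in>UNIV. \<bar>x $ i - y $ i\<bar>) \<le> int k" using int_l1_dist[of x y] by linarith
  moreover have "\<bar>x $ i - y $ i\<bar> \<le> (\<Sum>i\<in>UNIV. \<bar>x $ i - y $ i\<bar>)" by (rule member_le_sum) auto
  ultimately show "\<bar>y $ i - x $ i\<bar> \<le> int k" by (simp add: abs_minus_commute)
qed

lemma cube_l1_dist:
  assumes "y \<in> cube (x :: int ^ 'd::finite) k" shows "l1_dist x y \<le> CARD('d) * k"
proof -
  have "(\<Sum>i\<in>UNIV. \<bar>x $ i - y $ i\<bar>) \<le> (\<Sum>i\<in>(UNIV :: 'd set). int k)"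
    using assms by (intro sum_mono) (auto simp: cube_def abs_minus_commute)
  then have "int (l1_dist x y) \<le> int (CARD('d) * k)" by (simp add: int_l1_dist)
  then show ?thesis by (simp only: of_nat_le_iff)
qed

lemma l1_dist_step:
  assumes "l1_dist x y = Suc n"
  shows "\<exists>w. lattice_adj w y \<and> l1_dist x w = n"
proof -
  have "\<exists>i. x $ i \<noteq> y $ i" using assms by (metis l1_dist_0 nat.distinct(1) vec_eq_iff)
  then obtain i where i: "x $ i \<noteq> y $ i" by blast
  define s where "s = sgn (x $ i - y $ i)"
  have s: "\<bar>s\<bar> = 1" using i by (simp add: s_def abs_sgn_eq)
  define w where "w = y + axis i s"
  have "\<bar>x $ j - w $ j\<bar> = \<bar>x $ j - y $ j\<bar> - (if j = i then 1 else 0)" for j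
    using i by (auto simp: w_def axis_def s_def sgn_if)
  then have "int (l1_dist x w) = int (l1_dist x y) - 1"
    by (simp add: int_l1_dist sum_subtractf)
  then have "l1_dist x w = n" using assms by simp
  moreover have "lattice_adj w y" using lattice_adj_axis[OF s, of y i] by (simp add: w_def lattice_adj_sym)
  ultimately show ?thesis by blast
qed

lemma graph_dist_l1: "graph_dist x y = l1_dist x y"
  unfolding graph_dist_def
proof (rule Least_equality)
  show "(lattice_adj ^^ l1_dist x y) x y"
  proof (induction "l1_dist x y" arbitrary: y)
    case 0 then show ?case using l1_dist_eq_0[of x y] by simp
  next
    case (Suc n)
    then obtain w where "lattice_adj w y" "l1_dist x w = n" using l1_dist_step[of x y n] by auto
    then show ?case using Suc(1)[of w] Suc(2) by (metis relpowp_Suc_I)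
  qed
  show "l1_dist x y \<le> n" if "(lattice_adj ^^ n) x y" for n
    using that
  proof (induction n arbitrary: y)
    case 0 then show ?case by simp
  next
    case (Suc n)
    then obtain w where w: "(lattice_adj ^^ n) x w" "lattice_adj w y" by (auto elim: relpowp_Suc_E)
    then show ?case using Suc.IH[OF w(1)] l1_dist_triangle[of x y w] by (simp add: lattice_adj_l1)
  qed
qed

lemma l1_dist_split:
  assumes "l1_dist x y \<le> a + b"
  shows "\<exists>w. l1_dist x w \<le> a \<and> l1_dist w y \<le> b"
  using assms
proof (induction b arbitrary: y)
  case 0 then show ?case by (intro exI[of _ y]) simp
next
  case (Suc b)
  show ?case
  proof (cases "l1_dist x y")
    case 0 then show ?thesis by (intro exI[of _ x]) simp
  next
    case (Suc n)
    then obtain v where v: "lattice_adj v y" "l1_dist x v = n" using l1_dist_step by blast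
    then have "l1_dist x v \<le> a + b" using Suc.prems \<open>l1_dist x y = Suc n\<close> by simp
    then obtain w where "l1_dist x w \<le> a" "l1_dist w v \<le> b" using Suc.IH by blast
    then show ?thesis using l1_dist_triangle[of w y v] v(1) by (intro exI[of _ w]) (simp add: lattice_adj_l1)
  qed
qed

text \<open>Self-avoiding paths are lists whose last element is the starting point.\<close>

fun path_edges :: "'v list \<Rightarrow> 'v set set" where
  "path_edges (x # y # xs) = insert {x, y} (path_edges (y # xs))"
| "path_edges _ = {}"

definition paths_from :: "int ^ 'd::finite \<Rightarrow> (int ^ 'd) list set" where
  "paths_from z = {xs. xs \<noteq> [] \<and> distinct xs \<and> successively lattice_adj xs \<and> last xs = z}"

lemma finite_path_edges [simp]: "finite (path_edges xs)"
  by (induction xs rule: path_edges.induct) auto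

lemma path_edges_subset: "e \<in> path_edges xs \<Longrightarrow> e \<subseteq> set xs"
  by (induction xs rule: path_edges.induct) auto

lemma path_edges_append: "path_edges ys \<subseteq> path_edges (xs @ ys)"
proof (induction xs)
  case (Cons x xs)
  then show ?case by (cases "xs @ ys") auto
qed simp

lemma path_edges_lattice: "successively lattice_adj xs \<Longrightarrow> path_edges xs \<subseteq> lattice_edges"
  by (induction xs rule: path_edges.induct) (auto simp: lattice_edges_def)

lemma card_path_edges: "distinct xs \<Longrightarrow> card (path_edges xs) = length xs - 1"
proof (induction xs rule: path_edges.induct)
  case (1 x y xs)
  have "{x, y} \<notin> path_edges (y # xs)" using path_edges_subset[of "{x, y}" "y # xs"] 1(2) by auto
  then show ?case using 1 by simp
qed auto

text \<open>Suffixes of the list are initial segments of the path.\<close>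

lemma paths_from_suffix: "xs @ ys \<in> paths_from z \<Longrightarrow> ys \<noteq> [] \<Longrightarrow> ys \<in> paths_from z"
  by (auto simp: paths_from_def successively_append_iff)

lemma paths_from_hd_cube: "xs \<in> paths_from z \<Longrightarrow> hd xs \<in> cube z (length xs - 1)"
proof (induction xs)
  case (Cons x xs)
  show ?case
  proof (cases xs)
    case Nil then show ?thesis using Cons.prems by (simp add: paths_from_def)
  next
    case (Cons y ys)
    then have "xs \<in> paths_from z" using paths_from_suffix[of "[x]" xs z] Cons.prems by simp
    then have "y \<in> cube z (length xs - 1)" using Cons.IH Cons by simp
    moreover have "lattice_adj y x" using Cons.prems Cons by (simp add: paths_from_def lattice_adj_sym)
    ultimately show ?thesis using cube_shift[OF _ lattice_adj_cube, of y z "length xs - 1" x] Cons by simp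
  qed
qed (simp add: paths_from_def)

definition bad_edges :: "((int ^ 'd::finite) set \<Rightarrow> real) \<Rightarrow> real \<Rightarrow> (int ^ 'd) list \<Rightarrow> (int ^ 'd) set set" where
  "bad_edges \<mu> K xs = {e \<in> path_edges xs. K < \<mu> e}"

definition path_cost :: "((int ^ 'd::finite) set \<Rightarrow> real) \<Rightarrow> real \<Rightarrow> (int ^ 'd) list \<Rightarrow> nat" where
  "path_cost \<mu> K xs = card {e \<in> path_edges xs. \<mu> e \<le> K}"

text \<open>First passage distance with edge lengths 0 and 1. Along a self-avoiding path the edges
  are distinct, so their conductances are independent, as the union bound requires.\<close>

definition fpp_dist :: "((int ^ 'd::finite) set \<Rightarrow> real) \<Rightarrow> real \<Rightarrow> int ^ 'd \<Rightarrow> int ^ 'd \<Rightarrow> nat" where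
  "fpp_dist \<mu> K z y = (LEAST k. \<exists>xs\<in>paths_from z. hd xs = y \<and> path_cost \<mu> K xs \<le> k)"

lemma path_cost_add_bad: "distinct xs \<Longrightarrow> path_cost \<mu> K xs + card (bad_edges \<mu> K xs) = length xs - 1"
proof -
  assume "distinct xs"
  have "path_edges xs = {e \<in> path_edges xs. \<mu> e \<le> K} \<union> bad_edges \<mu> K xs" by (auto simp: bad_edges_def)
  then have "card (path_edges xs) = path_cost \<mu> K xs + card (bad_edges \<mu> K xs)"
    unfolding path_cost_def bad_edges_def
    by (subst card_Un_disjoint[symmetric]) (auto intro: arg_cong[where f = card])
  then show ?thesis using card_path_edges[OF \<open>distinct xs\<close>] by simp
qed

lemma path_cost_suffix: "path_cost \<mu> K ys \<le> path_cost \<mu> K (xs @ ys)"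
  unfolding path_cost_def using path_edges_append[of ys xs] by (intro card_mono) auto

text \<open>If \<open>y\<close> was visited before, the path is cut there, which cannot raise its
  cost; this keeps paths self-avoiding.\<close>

lemma path_extend:
  assumes xs: "xs \<in> paths_from z" and adj: "lattice_adj (hd xs) y"
  shows "\<exists>ys\<in>paths_from z. hd ys = y \<and>
    path_cost \<mu> K ys \<le> path_cost \<mu> K xs + (if \<mu> {hd xs, y} \<le> K then 1 else 0)"
proof (cases "y \<in> set xs")
  case True
  then obtain as bs where xs_eq: "xs = as @ y # bs" by (meson split_list)
  then have "y # bs \<in> paths_from z" using xs paths_from_suffix[of as "y # bs"] by simp
  moreover have "path_cost \<mu> K (y # bs) \<le> path_cost \<mu> K xs" unfolding xs_eq by (rule path_cost_suffix)
  ultimately show ?thesis by (intro bexI[of _ "y # bs"]) auto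
next
  case False
  obtain x xs' where xs_eq: "xs = x # xs'" using xs by (cases xs) (auto simp: paths_from_def)
  have p: "y # xs \<in> paths_from z" using xs adj False by (auto simp: paths_from_def xs_eq lattice_adj_sym)
  have "{e \<in> path_edges (y # xs). \<mu> e \<le> K} \<subseteq> {e \<in> path_edges xs. \<mu> e \<le> K} \<union> (if \<mu> {x, y} \<le> K then {{x, y}} else {})"
    by (auto simp: xs_eq insert_commute)
  then have "path_cost \<mu> K (y # xs) \<le> card ({e \<in> path_edges xs. \<mu> e \<le> K} \<union> (if \<mu> {x, y} \<le> K then {{x, y}} else {}))"
    unfolding path_cost_def by (intro card_mono) auto
  also have "... \<le> path_cost \<mu> K xs + card (if \<mu> {x, y} \<le> K then {{x, y}} else {})"
    unfolding path_cost_def by (rule card_Un_le)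
  finally show ?thesis using p by (intro bexI[of _ "y # xs"]) (auto simp: xs_eq)
qed

lemma fpp_dist_path:
  shows fpp_dist_ex: "\<exists>xs\<in>paths_from z. hd xs = y \<and> path_cost \<mu> K xs \<le> fpp_dist \<mu> K z y"
    and fpp_dist_le_l1: "fpp_dist \<mu> K z y \<le> l1_dist z y"
proof -
  have ex: "\<exists>xs\<in>paths_from z. hd xs = y \<and> path_cost \<mu> K xs \<le> l1_dist z y"
  proof (induction "l1_dist z y" arbitrary: y)
    case 0
    then have "z = y" using l1_dist_eq_0[of z y] by simp
    then show ?case by (intro bexI[of _ "[z]"]) (auto simp: paths_from_def path_cost_def)
  next
    case (Suc n)
    then obtain w where w: "lattice_adj w y" "l1_dist z w = n" using l1_dist_step[of z y n] by auto
    then obtain xs where "xs \<in> paths_from z" "hd xs = w" "path_cost \<mu> K xs \<le> n" using Suc(1)[of w] by auto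
    then show ?case using path_extend[of xs z y \<mu> K] w Suc(2) by (force split: if_splits)
  qed
  show "\<exists>xs\<in>paths_from z. hd xs = y \<and> path_cost \<mu> K xs \<le> fpp_dist \<mu> K z y"
    unfolding fpp_dist_def
    by (rule LeastI[where P = "\<lambda>k. \<exists>xs\<in>paths_from z. hd xs = y \<and> path_cost \<mu> K xs \<le> k", OF ex])
  show "fpp_dist \<mu> K z y \<le> l1_dist z y" unfolding fpp_dist_def
    by (rule Least_le[where P = "\<lambda>k. \<exists>xs\<in>paths_from z. hd xs = y \<and> path_cost \<mu> K xs \<le> k", OF ex])
qed

lemma fpp_dist_step:
  assumes "lattice_adj x y"
  shows "fpp_dist \<mu> K z y \<le> fpp_dist \<mu> K z x + (if \<mu> {x, y} \<le> K then 1 else 0)"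
proof -
  obtain xs where xs: "xs \<in> paths_from z" "hd xs = x" "path_cost \<mu> K xs \<le> fpp_dist \<mu> K z x"
    using fpp_dist_ex by blast
  obtain ys where ys: "ys \<in> paths_from z" "hd ys = y"
      "path_cost \<mu> K ys \<le> path_cost \<mu> K xs + (if \<mu> {x, y} \<le> K then 1 else 0)"
    using path_extend[OF xs(1), of y \<mu> K] assms xs(2) by auto
  have "path_cost \<mu> K ys \<le> fpp_dist \<mu> K z x + (if \<mu> {x, y} \<le> K then 1 else 0)"
    using ys(3) xs(3) by linarith
  then show ?thesis using ys unfolding fpp_dist_def[of \<mu> K z y] by (intro Least_le) blast
qed

text \<open>A bad edge leaves the distance unchanged, a good one has conductance at most
  \<open>K\<close> and changes it by at most one. For the lower comparison, a path with more than
  \<open>j\<close> edges has an initial segment of \<open>j\<close> edges, at least half of them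
  good, and so costs at least \<open>j / 2\<close>; a cheaper path has at most \<open>j\<close>
  edges and stays in the cube.\<close>

lemma adapted_fpp_dist:
  fixes z :: "int ^ 'd::finite"
  assumes \<mu>: "\<forall>e\<in>lattice_edges. 1 \<le> \<mu> e" and K: "0 < K"
    and good: "\<And>j xs. m \<le> j \<Longrightarrow> xs \<in> paths_from z \<Longrightarrow> length xs = j + 1 \<Longrightarrow> 2 * card (bad_edges \<mu> K xs) \<le> j"
  shows "adapted_dist \<mu> K z m (\<lambda>y. real (fpp_dist \<mu> K z y))"
  unfolding adapted_dist_def
proof (intro conjI allI impI)
  fix x y
  let ?\<rho> = "fpp_dist \<mu> K z"
  show "conductance \<mu> x y * (real (?\<rho> x) - real (?\<rho> y))^2 \<le> K"
  proof (cases "lattice_adj x y")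
    case True
    have "?\<rho> y \<le> ?\<rho> x + (if \<mu> {x, y} \<le> K then 1 else 0)" "?\<rho> x \<le> ?\<rho> y + (if \<mu> {x, y} \<le> K then 1 else 0)"
      using fpp_dist_step[OF True] fpp_dist_step[of y x \<mu> K z] True
      by (auto simp: lattice_adj_sym insert_commute)
    then have "\<bar>real (?\<rho> x) - real (?\<rho> y)\<bar> \<le> (if \<mu> {x, y} \<le> K then 1 else 0)" by (auto split: if_splits)
    then have sq: "(real (?\<rho> x) - real (?\<rho> y))^2 \<le> (if \<mu> {x, y} \<le> K then 1 else 0)"
      by (auto simp: abs_square_le_1 split: if_splits)
    have c: "0 \<le> conductance \<mu> x y" using conductance_ge(1)[OF \<mu>, of x y] by auto
    show ?thesis
    proof (cases "\<mu> {x, y} \<le> K")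
      case good: True
      have "conductance \<mu> x y * (real (?\<rho> x) - real (?\<rho> y))^2 \<le> conductance \<mu> x y * 1"
        using sq good c by (intro mult_left_mono) auto
      then show ?thesis using good True by (simp add: conductance_def)
    next
      case False
      then show ?thesis using sq K by simp
    qed
  next
    case False then show ?thesis using K by (simp add: conductance_def)
  qed
next
  fix y
  have "real (fpp_dist \<mu> K z y) \<le> real_of_int (int (l1_dist z y))"
    using fpp_dist_le_l1[of \<mu> K z y] by simp
  then show "real (fpp_dist \<mu> K z y) \<le> real_of_int (\<Sum>i\<in>UNIV. \<bar>z $ i - y $ i\<bar>)"
    by (simp only: int_l1_dist)
next
  fix j y assume j: "m \<le> j" and less: "real (fpp_dist \<mu> K z y) < real j / 2"
  obtain xs where xs: "xs \<in> paths_from z" "hd xs = y" "path_cost \<mu> K xs \<le> fpp_dist \<mu> K z y"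
    using fpp_dist_ex by blast
  have "length xs - 1 \<le> j"
  proof (rule ccontr)
    assume "\<not> length xs - 1 \<le> j"
    define ys where "ys = drop (length xs - (j + 1)) xs"
    have len: "length ys = j + 1" using \<open>\<not> length xs - 1 \<le> j\<close> by (simp add: ys_def)
    have split: "xs = take (length xs - (j + 1)) xs @ ys" by (simp add: ys_def)
    have "ys \<noteq> []" using len by auto
    moreover have "take (length xs - (j + 1)) xs @ ys \<in> paths_from z" using xs(1) split by simp
    ultimately have ys: "ys \<in> paths_from z" using paths_from_suffix by blast
    have "path_cost \<mu> K ys \<le> path_cost \<mu> K xs" by (subst split) (rule path_cost_suffix)
    moreover have "path_cost \<mu> K ys + card (bad_edges \<mu> K ys) = j"
      using path_cost_add_bad[of ys \<mu> K] ys len by (simp add: paths_from_def)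
    ultimately have "j \<le> 2 * fpp_dist \<mu> K z y" using good[OF j ys len] xs(3) by linarith
    then have "real j \<le> real (2 * fpp_dist \<mu> K z y)" by (simp only: of_nat_le_iff)
    then show False using less by simp
  qed
  then show "y \<in> cube z j" using paths_from_hd_cube[OF xs(1)] xs(2) cube_mono by blast
qed

section \<open>From cubes to graph balls\<close>

lemma graph_ball_iff: "y \<in> graph_ball x r \<longleftrightarrow> real (l1_dist x y) < r"
  by (simp add: graph_ball_def graph_dist_l1)

text \<open>Every vertex within \<open>R / 2\<close> of \<open>x\<close> is reached in
  \<open>l\<close> steps of length \<open>m\<close>, because
  \<open>R / 2 < l * (m + 1) / 2 \<le> l * m\<close>. Two such chains through \<open>x\<close> join
  any two vertices, whence the exponent \<open>2 * l\<close>.\<close>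

lemma elliptic_harnack_chain:
  fixes x :: "int ^ 'd::finite"
  assumes C: "1 \<le> C" and m: "1 \<le> m" and R: "real (l * m) \<le> R" "R < real (l * (m + 1))"
    and l: "2 * CARD('d) * b \<le> l"
    and loc: "\<And>z h. real (l1_dist x z) < R / 2 \<Longrightarrow> \<forall>y\<in>cube z (b * m). 0 \<le> h y \<Longrightarrow>
        \<forall>y\<in>cube z (b * m). generator \<mu> h y = 0 \<Longrightarrow> \<forall>y\<in>cube z m. \<forall>y'\<in>cube z m. h y \<le> C * h y'"
  shows "elliptic_harnack \<mu> (C ^ (2 * l)) x R"
  unfolding elliptic_harnack_def
proof (intro allI impI)
  fix h assume h: "\<forall>y\<in>graph_closure (graph_ball x R). 0 \<le> h y" and harm: "harmonic_in \<mu> (graph_ball x R) h"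
  have h_nn: "0 \<le> h y" if "real (l1_dist x y) < R" for y
    using h that by (auto simp: graph_closure_def graph_ball_iff)
  have R_pos: "0 < R"
  proof -
    have "l \<noteq> 0" using R by (intro notI) simp
    then have "0 < real (l * m)" using m by simp
    then show ?thesis using R(1) by linarith
  qed
  have step: "h y \<le> C * h z \<and> h z \<le> C * h y"
    if z: "real (l1_dist x z) < R / 2" and y: "l1_dist z y \<le> m" for y z
  proof -
    have in_ball: "real (l1_dist x w) < R" if w: "w \<in> cube z (b * m)" for w
    proof -
      have "2 * l1_dist z w \<le> 2 * CARD('d) * b * m" using cube_l1_dist[OF w] by simp
      also have "... \<le> l * m" using l by (rule mult_right_mono) simp
      finally have "real (2 * l1_dist z w) \<le> real (l * m)" by (simp only: of_nat_le_iff)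
      moreover have "real (l1_dist x w) \<le> real (l1_dist x z + l1_dist z w)"
        using l1_dist_triangle by (simp only: of_nat_le_iff)
      ultimately show ?thesis using R(1) z by simp
    qed
    have "\<forall>y\<in>cube z m. \<forall>y'\<in>cube z m. h y \<le> C * h y'"
      using in_ball h_nn harm by (intro loc z) (auto simp: harmonic_in_def graph_ball_iff)
    then show ?thesis using l1_dist_cube[OF y] by auto
  qed
  have chain: "h y \<le> C ^ i * h x \<and> h x \<le> C ^ i * h y"
    if "l1_dist x y \<le> i * m" "real (l1_dist x y) < R / 2" for i y
    using that
  proof (induction i arbitrary: y)
    case 0
    then show ?case using l1_dist_eq_0[of x y] by simp
  next
    case (Suc i)
    show ?case
    proof (cases "l1_dist x y \<le> i * m")
      case True
      have "0 \<le> h x" "0 \<le> h y" using h_nn Suc.prems(2) R_pos by auto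
      then have "C ^ i * h x \<le> C ^ Suc i * h x" "C ^ i * h y \<le> C ^ Suc i * h y"
        using C by (intro mult_right_mono power_increasing; simp)+
      then show ?thesis using Suc.IH[OF True Suc.prems(2)] by linarith
    next
      case False
      obtain w where w: "l1_dist x w \<le> i * m" "l1_dist w y \<le> m"
        using l1_dist_split[of x y "i * m" m] Suc.prems(1) by (auto simp: add.commute)
      \<comment> \<open>\<open>w\<close> is closer to \<open>x\<close> than \<open>y\<close>, so the
        centres of the chain do not leave the ball of radius \<open>R / 2\<close>.\<close>
      then have wR: "real (l1_dist x w) < R / 2" using False Suc.prems(2) by linarith
      have IH: "h w \<le> C ^ i * h x" "h x \<le> C ^ i * h w" using Suc.IH[OF w(1) wR] by auto
      have st: "h y \<le> C * h w" "h w \<le> C * h y" using step[OF wR w(2)] by auto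
      have "h y \<le> C * (C ^ i * h x)" using st(1) mult_left_mono[OF IH(1), of C] C by linarith
      moreover have "h x \<le> C ^ i * (C * h y)"
        by (rule order_trans[OF IH(2) mult_left_mono[OF st(2)]]) (use C in simp)
      ultimately show ?thesis by (simp add: mult_ac)
    qed
  qed
  have near: "h y \<le> C ^ l * h x \<and> h x \<le> C ^ l * h y" if y: "real (l1_dist x y) < R / 2" for y
  proof (rule chain[OF _ y])
    have "real (2 * l1_dist x y) < real (l * (m + 1))" using y R(2) by simp
    then have "2 * l1_dist x y < l * (m + 1)" by (simp only: of_nat_less_iff)
    also have "... \<le> l * (2 * m)" using m by (intro mult_left_mono) auto
    finally show "l1_dist x y \<le> l * m" by simp
  qed
  have pair: "h y \<le> C ^ (2 * l) * h y'"
    if "real (l1_dist x y) < R / 2" "real (l1_dist x y') < R / 2" for y y'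
  proof -
    have "h y \<le> C ^ l * h x" using near that by blast
    also have "... \<le> C ^ l * (C ^ l * h y')" using near[OF that(2)] C by (intro mult_left_mono) auto
    finally show ?thesis by (simp only: mult_2 power_add mult.assoc)
  qed
  let ?B = "graph_ball x (R / 2)"
  have xB: "x \<in> ?B" using R_pos by (simp add: graph_ball_iff)
  have C': "0 < C ^ (2 * l)" using C by simp
  show "(SUP y\<in>?B. h y) \<le> C ^ (2 * l) * (INF y\<in>?B. h y)"
  proof (rule cSUP_least)
    fix y assume y: "y \<in> ?B"
    have "h y / C ^ (2 * l) \<le> (INF y\<in>?B. h y)"
      using xB y pair C' by (intro cINF_greatest) (auto simp: graph_ball_iff field_simps)
    then show "h y \<le> C ^ (2 * l) * (INF y\<in>?B. h y)" using C' by (simp add: field_simps)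
  qed (use xB in auto)
qed

section \<open>Probability of many large conductances along a path\<close>

definition paths_of_length :: "int ^ 'd::finite \<Rightarrow> nat \<Rightarrow> (int ^ 'd) list set" where
  "paths_of_length z j = {xs \<in> paths_from z. length xs = j + 1}"

lemma card_paths_of_length:
  fixes z :: "int ^ 'd::finite"
  shows "finite (paths_of_length z j) \<and> card (paths_of_length z j) \<le> (3 ^ CARD('d)) ^ j"
proof (induction j)
  case 0
  have "paths_of_length z 0 \<subseteq> {[z]}"
    by (auto simp: paths_of_length_def paths_from_def length_Suc_conv)
  then show ?case using card_mono[of "{[z]}"] finite_subset by fastforce
next
  case (Suc j)
  let ?P = "SIGMA xs:paths_of_length z j. cube (hd xs) 1"
  have fin: "finite ?P" using Suc by (intro finite_SigmaI) auto
  have sub: "paths_of_length z (Suc j) \<subseteq> (\<lambda>(xs, y). y # xs) ` ?P"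
  proof
    fix ys assume ys: "ys \<in> paths_of_length z (Suc j)"
    then obtain y xs where ys_eq: "ys = y # xs" "length xs = j + 1"
      by (cases ys) (auto simp: paths_of_length_def)
    then have "xs \<noteq> []" by auto
    then have "xs \<in> paths_of_length z j"
      using paths_from_suffix[of "[y]" xs z] ys ys_eq by (simp add: paths_of_length_def)
    moreover have "lattice_adj (hd xs) y"
      using ys ys_eq \<open>xs \<noteq> []\<close> by (cases xs) (auto simp: paths_of_length_def paths_from_def lattice_adj_sym)
    ultimately show "ys \<in> (\<lambda>(xs, y). y # xs) ` ?P"
      using lattice_adj_cube[of "hd xs" y] by (auto simp: ys_eq simp del: One_nat_def intro!: image_eqI[of _ _ "(xs, y)"])
  qed
  have "card (paths_of_length z (Suc j)) \<le> card ((\<lambda>(xs, y). y # xs) ` ?P)"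
    using fin sub by (intro card_mono) auto
  also have "... \<le> card ?P" using fin by (rule card_image_le)
  also have "... = card (paths_of_length z j) * 3 ^ CARD('d)"
    using Suc by (simp add: card_SigmaI card_cube del: One_nat_def)
  also have "... \<le> (3 ^ CARD('d)) ^ j * 3 ^ CARD('d)" using Suc by (intro mult_right_mono) auto
  finally show ?case using fin sub finite_subset by (auto simp: mult.commute)
qed

locale iid_conductances = prob_space M
  for M :: "'w measure" +
  fixes \<mu> :: "(int ^ 'd::finite) set \<Rightarrow> 'w \<Rightarrow> real"
  assumes indep: "indep_vars (\<lambda>_. borel) \<mu> lattice_edges"
    and ident: "\<And>e e'. e \<in> lattice_edges \<Longrightarrow> e' \<in> lattice_edges \<Longrightarrow> distr M borel (\<mu> e) = distr M borel (\<mu> e')"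
    and lower: "\<And>e \<omega>. e \<in> lattice_edges \<Longrightarrow> \<omega> \<in> space M \<Longrightarrow> 1 \<le> \<mu> e \<omega>"
begin

lemma measurable_\<mu>: "e \<in> lattice_edges \<Longrightarrow> \<mu> e \<in> borel_measurable M"
  using indep by (auto simp: indep_vars_def)

lemma level_set_eq: "{\<omega>\<in>space M. K < \<mu> e \<omega>} = \<mu> e -` {K<..} \<inter> space M" by auto

lemma sets_large: "e \<in> lattice_edges \<Longrightarrow> {\<omega>\<in>space M. K < \<mu> e \<omega>} \<in> sets M"
  unfolding level_set_eq by (rule measurable_sets[OF measurable_\<mu>]) (simp_all add: borel_open)

text \<open>Continuity from above for one edge; equality in law lets the same \<open>K\<close> serve
  all edges.\<close>

lemma ex_threshold:
  assumes p: "0 < p"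
  shows "\<exists>K>0. \<forall>e\<in>lattice_edges. prob {\<omega>\<in>space M. K < \<mu> e \<omega>} \<le> p"
proof (cases "lattice_edges = ({} :: (int ^ 'd) set set)")
  case True then show ?thesis by (intro exI[of _ 1]) simp
next
  case False
  then obtain e where e: "e \<in> (lattice_edges :: (int ^ 'd) set set)" by blast
  have same: "prob {\<omega>\<in>space M. K < \<mu> e' \<omega>} = measure (distr M borel (\<mu> e)) {K<..}" if "e' \<in> lattice_edges" for e' K
    unfolding ident[OF e that] level_set_eq using measurable_\<mu>[OF that] by (simp add: measure_distr borel_open)
  have "(\<lambda>n. prob {\<omega>\<in>space M. real n < \<mu> e \<omega>}) \<longlonglongrightarrow> prob (\<Inter>n. {\<omega>\<in>space M. real n < \<mu> e \<omega>})"
    by (intro finite_Lim_measure_decseq) (use sets_large[OF e] in \<open>auto simp: decseq_def\<close>)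
  also have "(\<Inter>n. {\<omega>\<in>space M. real n < \<mu> e \<omega>}) = {}"
  proof -
    have "\<exists>n. \<not> real n < \<mu> e \<omega>" for \<omega> using reals_Archimedean2[of "\<mu> e \<omega>"] by (meson less_asym)
    then show ?thesis by auto
  qed
  finally have "(\<lambda>n. prob {\<omega>\<in>space M. real n < \<mu> e \<omega>}) \<longlonglongrightarrow> 0" by simp
  then have "\<forall>\<^sub>F n in sequentially. prob {\<omega>\<in>space M. real n < \<mu> e \<omega>} < p"
    using p by (rule order_tendstoD)
  then obtain n where n: "\<forall>k\<ge>n. prob {\<omega>\<in>space M. real k < \<mu> e \<omega>} < p"
    by (auto simp: eventually_sequentially)
  have "prob {\<omega>\<in>space M. real (Suc n) < \<mu> e' \<omega>} \<le> p" if "e' \<in> lattice_edges" for e'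
    using n[rule_format, of "Suc n"] same[OF that] same[OF e] by simp
  then show ?thesis by (intro exI[of _ "real (Suc n)"]) simp
qed

lemma prob_all_large:
  assumes T: "finite T" "T \<subseteq> lattice_edges" and p: "\<And>e. e \<in> lattice_edges \<Longrightarrow> prob {\<omega>\<in>space M. K < \<mu> e \<omega>} \<le> p"
  shows "prob {\<omega>\<in>space M. \<forall>e\<in>T. K < \<mu> e \<omega>} \<le> p ^ card T"
proof (cases "T = {}")
  case True then show ?thesis by simp
next
  case False
  have "{\<omega>\<in>space M. \<forall>e\<in>T. K < \<mu> e \<omega>} = (\<Inter>e\<in>T. \<mu> e -` {K<..} \<inter> space M)" using False by auto
  also have "prob ... = (\<Prod>e\<in>T. prob (\<mu> e -` {K<..} \<inter> space M))"
    using indep_varsD[OF indep False T] by (simp add: borel_open)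
  also have "... \<le> (\<Prod>e\<in>T. p)" using p T by (intro prod_mono) (auto simp: level_set_eq[symmetric])
  finally show ?thesis by simp
qed

text \<open>Union over the at most \<open>2 ^ j\<close> sets of more than \<open>j / 2\<close>
  edges. With the bound \<open>q^2\<close> for a single edge, each such set costs at most
  \<open>q ^ j\<close>.\<close>

lemma prob_many_large:
  assumes E: "finite E" "E \<subseteq> lattice_edges" "card E = j"
    and q: "0 \<le> q" "q \<le> 1" and p: "\<And>e. e \<in> lattice_edges \<Longrightarrow> prob {\<omega>\<in>space M. K < \<mu> e \<omega>} \<le> q^2"
  shows "{\<omega>\<in>space M. j < 2 * card {e\<in>E. K < \<mu> e \<omega>}} \<in> sets M"
    and "prob {\<omega>\<in>space M. j < 2 * card {e\<in>E. K < \<mu> e \<omega>}} \<le> (2 * q) ^ j"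
proof -
  define S where "S = {T. T \<subseteq> E \<and> j < 2 * card T}"
  define ev where "ev T = {\<omega>\<in>space M. \<forall>e\<in>T. K < \<mu> e \<omega>}" for T
  have finS: "finite S" unfolding S_def by (rule finite_subset[of _ "Pow E"]) (use E in auto)
  have finT: "finite T" "T \<subseteq> lattice_edges" if "T \<in> S" for T
    using that E(1,2) finite_subset[of T E] by (auto simp: S_def)
  have ev_sets: "ev T \<in> sets M" if "T \<in> S" for T
  proof -
    have "ev T = (\<Inter>e\<in>T. {\<omega>\<in>space M. K < \<mu> e \<omega>}) \<inter> space M" by (auto simp: ev_def)
    then show ?thesis using finT[OF that] sets_large
      by (cases "T = {}") (auto intro!: sets.Int sets.finite_INT)
  qed
  have eq: "{\<omega>\<in>space M. j < 2 * card {e\<in>E. K < \<mu> e \<omega>}} = (\<Union>T\<in>S. ev T)"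
  proof (intro set_eqI iffI)
    fix \<omega> assume "\<omega> \<in> {\<omega>\<in>space M. j < 2 * card {e\<in>E. K < \<mu> e \<omega>}}"
    then show "\<omega> \<in> (\<Union>T\<in>S. ev T)"
      by (intro UN_I[of "{e\<in>E. K < \<mu> e \<omega>}"]) (auto simp: S_def ev_def)
  next
    fix \<omega> assume "\<omega> \<in> (\<Union>T\<in>S. ev T)"
    then obtain T where T: "T \<in> S" "\<omega> \<in> ev T" by blast
    then have "card T \<le> card {e\<in>E. K < \<mu> e \<omega>}"
      using E by (intro card_mono) (auto simp: S_def ev_def)
    then show "\<omega> \<in> {\<omega>\<in>space M. j < 2 * card {e\<in>E. K < \<mu> e \<omega>}}" using T by (auto simp: S_def ev_def)
  qed
  show "{\<omega>\<in>space M. j < 2 * card {e\<in>E. K < \<mu> e \<omega>}} \<in> sets M"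
    unfolding eq using finS ev_sets by (intro sets.finite_UN) auto
  have "prob (\<Union>T\<in>S. ev T) \<le> (\<Sum>T\<in>S. prob (ev T))"
    using finS ev_sets by (intro finite_measure_subadditive_finite) auto
  also have "... \<le> (\<Sum>T\<in>S. q ^ j)"
  proof (rule sum_mono)
    fix T assume T: "T \<in> S"
    have "prob (ev T) \<le> (q^2) ^ card T" unfolding ev_def by (intro prob_all_large finT[OF T] p)
    also have "... = q ^ (2 * card T)" by (simp add: power_mult)
    also have "... \<le> q ^ j" using T q by (intro power_decreasing) (auto simp: S_def)
    finally show "prob (ev T) \<le> q ^ j" .
  qed
  also have "... = real (card S) * q ^ j" by simp
  also have "... \<le> real (2 ^ j) * q ^ j"
  proof (rule mult_right_mono)
    have "card S \<le> card (Pow E)" unfolding S_def using E by (intro card_mono) auto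
    then show "real (card S) \<le> real (2 ^ j)" using E by (simp only: card_Pow of_nat_le_iff)
  qed (use q in auto)
  also have "... = (2 * q) ^ j" by (simp add: power_mult_distrib)
  finally show "prob {\<omega>\<in>space M. j < 2 * card {e\<in>E. K < \<mu> e \<omega>}} \<le> (2 * q) ^ j" by (simp only: eq)
qed

text \<open>The centres fill a cube of radius \<open>l * (j + 1)\<close> because local estimates are
  needed about all \<open>z\<close> in a ball of radius below \<open>l * (m + 1)\<close>, with paths
  of every length \<open>j \<ge> m\<close>.\<close>

definition bad_event :: "real \<Rightarrow> nat \<Rightarrow> int ^ 'd \<Rightarrow> nat \<Rightarrow> 'w set" where
  "bad_event K l x j = (\<Union>z\<in>cube x (l * (j + 1)). \<Union>xs\<in>paths_of_length z j.
     {\<omega>\<in>space M. j < 2 * card {e\<in>path_edges xs. K < \<mu> e \<omega>}})"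

lemma poly_le_exp: "1 \<le> d \<Longrightarrow> (real (j + 1)) ^ d \<le> real d ^ d * exp (real j)"
proof -
  assume d: "1 \<le> d"
  have "real (j + 1) \<le> real d * (1 + real j / real d)" using d by (simp add: field_simps)
  also have "... \<le> real d * exp (real j / real d)" by (intro mult_left_mono exp_ge_add_one_self) auto
  finally have "(real (j + 1)) ^ d \<le> (real d * exp (real j / real d)) ^ d" by (rule power_mono) simp
  also have "... = real d ^ d * exp (real j)"
    using d by (simp add: power_mult_distrib exp_of_nat_mult[symmetric])
  finally show ?thesis .
qed

text \<open>The choice of \<open>q\<close> makes the union over paths from one centre at most
  \<open>exp (- 2 * j)\<close>; one factor \<open>exp (- j)\<close> is spent on the polynomial
  number of centres.\<close>

lemma bad_event_bound:
  fixes x :: "int ^ 'd"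
  defines "q \<equiv> exp (- 2) / (2 * 3 ^ CARD('d))"
  assumes p: "\<And>e. e \<in> lattice_edges \<Longrightarrow> prob {\<omega>\<in>space M. K < \<mu> e \<omega>} \<le> q^2" and l: "1 \<le> l"
  shows "bad_event K l x j \<in> sets M"
    and "prob (bad_event K l x j) \<le> (real (3 * l * CARD('d))) ^ CARD('d) * exp (- real j)"
proof -
  define d where "d = CARD('d)"
  have d: "1 \<le> d" by (simp add: d_def Suc_leI)
  have q: "0 \<le> q" "q \<le> 1"
  proof -
    have "exp (- 2 :: real) \<le> 1" by simp
    also have "(1::real) \<le> 2 * 3 ^ CARD('d)" using one_le_power[of "3::real" "CARD('d)"] by linarith
    finally show "q \<le> 1" unfolding q_def by (simp add: divide_le_eq_1)
    show "0 \<le> q" by (simp add: q_def)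
  qed
  define ev where "ev xs = {\<omega>\<in>space M. j < 2 * card {e\<in>path_edges xs. K < \<mu> e \<omega>}}" for xs :: "(int ^ 'd) list"
  define Z where "Z = cube x (l * (j + 1))"
  have ev: "ev xs \<in> sets M" "prob (ev xs) \<le> (2 * q) ^ j" if "xs \<in> paths_of_length z j" for z xs
  proof -
    have "distinct xs" "successively lattice_adj xs" "length xs = j + 1"
      using that by (auto simp: paths_of_length_def paths_from_def)
    then have E: "card (path_edges xs) = j" "path_edges xs \<subseteq> lattice_edges"
      using card_path_edges[of xs] path_edges_lattice[of xs] by auto
    show "ev xs \<in> sets M"
      unfolding ev_def by (rule prob_many_large(1)[where q = q]) (use E q p in auto)
    show "prob (ev xs) \<le> (2 * q) ^ j"
      unfolding ev_def by (rule prob_many_large(2)) (use E q p in auto)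
  qed
  have fin: "finite (paths_of_length z j)" for z :: "int ^ 'd" using card_paths_of_length by blast
  have inner: "(\<Union>xs\<in>paths_of_length z j. ev xs) \<in> sets M" for z
    using ev fin by (intro sets.finite_UN) auto
  have eq: "bad_event K l x j = (\<Union>z\<in>Z. \<Union>xs\<in>paths_of_length z j. ev xs)"
    by (simp add: bad_event_def ev_def Z_def)
  show "bad_event K l x j \<in> sets M" unfolding eq Z_def by (rule sets.finite_UN) (use inner in auto)
  have "prob (bad_event K l x j) \<le> (\<Sum>z\<in>Z. prob (\<Union>xs\<in>paths_of_length z j. ev xs))"
    unfolding eq using inner by (intro finite_measure_subadditive_finite) (auto simp: Z_def)
  also have "... \<le> (\<Sum>z\<in>Z. (real (3 ^ d) * (2 * q)) ^ j)"
  proof (rule sum_mono)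
    fix z
    have "prob (\<Union>xs\<in>paths_of_length z j. ev xs) \<le> (\<Sum>xs\<in>paths_of_length z j. prob (ev xs))"
      using fin ev by (intro finite_measure_subadditive_finite) auto
    also have "... \<le> (\<Sum>xs\<in>paths_of_length z j. (2 * q) ^ j)" by (intro sum_mono ev)
    also have "... = real (card (paths_of_length z j)) * (2 * q) ^ j" by simp
    also have "... \<le> real ((3 ^ d) ^ j) * (2 * q) ^ j"
    proof (rule mult_right_mono)
      show "real (card (paths_of_length z j)) \<le> real ((3 ^ d) ^ j)"
        using card_paths_of_length[of z j] unfolding d_def by (simp only: of_nat_le_iff)
    qed (use q in auto)
    also have "... = (real (3 ^ d) * (2 * q)) ^ j" by (simp add: power_mult_distrib)
    finally show "prob (\<Union>xs\<in>paths_of_length z j. ev xs) \<le> (real (3 ^ d) * (2 * q)) ^ j" .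
  qed
  also have "... = real (card Z) * exp (- 2 * real j)"
  proof -
    have "real (3 ^ d) * (2 * q) = exp (- 2)" by (simp add: q_def d_def)
    then show ?thesis by (simp add: exp_of_nat_mult[symmetric] mult.commute)
  qed
  also have "... \<le> (real (3 * l) ^ d * (real d ^ d * exp (real j))) * exp (- 2 * real j)"
  proof (rule mult_right_mono)
    have "1 \<le> l * (j + 1)" using l by simp
    then have "2 * (l * (j + 1)) + 1 \<le> 3 * l * (j + 1)" by (simp add: algebra_simps)
    then have "card Z \<le> (3 * l * (j + 1)) ^ d" unfolding Z_def card_cube d_def by (rule power_mono) simp
    then have "real (card Z) \<le> real ((3 * l * (j + 1)) ^ d)" by (simp only: of_nat_le_iff)
    also have "... = real (3 * l) ^ d * real (j + 1) ^ d" by (simp only: of_nat_power of_nat_mult power_mult_distrib)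
    also have "... \<le> real (3 * l) ^ d * (real d ^ d * exp (real j))"
      by (intro mult_left_mono poly_le_exp d) auto
    finally show "real (card Z) \<le> real (3 * l) ^ d * (real d ^ d * exp (real j))" .
  qed simp
  also have "... = real (3 * l * d) ^ d * (exp (real j) * exp (- 2 * real j))"
    by (simp add: power_mult_distrib)
  also have "exp (real j) * exp (- 2 * real j) = exp (- real j)" by (simp add: exp_add[symmetric])
  finally show "prob (bad_event K l x j) \<le> (real (3 * l * CARD('d))) ^ CARD('d) * exp (- real j)"
    by (simp only: d_def)
qed

definition bad_from :: "real \<Rightarrow> nat \<Rightarrow> int ^ 'd \<Rightarrow> nat \<Rightarrow> 'w set" where
  "bad_from K l x N = (\<Union>i. bad_event K l x (N + i))"

lemma bad_from_bound:
  fixes x :: "int ^ 'd"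
  assumes p: "\<And>e. e \<in> lattice_edges \<Longrightarrow> prob {\<omega>\<in>space M. K < \<mu> e \<omega>} \<le> (exp (- 2) / (2 * 3 ^ CARD('d)))^2"
    and l: "1 \<le> l"
  shows "bad_from K l x N \<in> sets M"
    and "prob (bad_from K l x N) \<le> (real (3 * l * CARD('d))) ^ CARD('d) / (1 - exp (- 1)) * exp (- real N)"
proof -
  define b where "b = (real (3 * l * CARD('d))) ^ CARD('d)"
  have ev: "bad_event K l x j \<in> sets M" "prob (bad_event K l x j) \<le> b * exp (- real j)" for j
    using bad_event_bound[OF p l] by (auto simp: b_def)
  show "bad_from K l x N \<in> sets M" unfolding bad_from_def using ev by auto
  have geo: "(\<lambda>i. b * exp (- real N) * exp (- 1) ^ i) sums (b * exp (- real N) * (1 / (1 - exp (- 1))))"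
    by (intro sums_mult geometric_sums) simp
  have le: "prob (bad_event K l x (N + i)) \<le> b * exp (- real N) * exp (- 1) ^ i" for i
  proof -
    have "exp (- real (N + i)) = exp (- real N) * exp (- 1 :: real) ^ i"
      by (simp add: exp_of_nat_mult[symmetric] exp_add[symmetric])
    then show ?thesis using ev(2)[of "N + i"] by simp
  qed
  have summ: "summable (\<lambda>i. prob (bad_event K l x (N + i)))"
    by (rule summable_comparison_test[OF _ sums_summable[OF geo]]) (use le in auto)
  have "prob (bad_from K l x N) \<le> (\<Sum>i. prob (bad_event K l x (N + i)))"
    unfolding bad_from_def using ev summ by (intro finite_measure_subadditive_countably) auto
  also have "... \<le> (\<Sum>i. b * exp (- real N) * exp (- 1) ^ i)"
    by (intro suminf_le le summ sums_summable[OF geo])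
  also have "... = b / (1 - exp (- 1)) * exp (- real N)" using sums_unique[OF geo] by simp
  finally show "prob (bad_from K l x N) \<le> (real (3 * l * CARD('d))) ^ CARD('d) / (1 - exp (- 1)) * exp (- real N)"
    by (simp only: b_def)
qed

text \<open>Ensures that the \<open>LEAST\<close> in \<open>harnack_radius\<close> almost surely has
  a witness.\<close>

lemma AE_eventually_good:
  fixes x :: "int ^ 'd"
  assumes p: "\<And>e. e \<in> lattice_edges \<Longrightarrow> prob {\<omega>\<in>space M. K < \<mu> e \<omega>} \<le> (exp (- 2) / (2 * 3 ^ CARD('d)))^2"
    and l: "1 \<le> l"
  shows "AE \<omega> in M. \<exists>N. \<omega> \<notin> bad_from K l x N"
proof -
  define b where "b = (real (3 * l * CARD('d))) ^ CARD('d) / (1 - exp (- 1))"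
  have "(\<lambda>N. b * exp (- 1) ^ N) \<longlonglongrightarrow> b * 0"
    by (intro tendsto_intros LIMSEQ_realpow_zero) auto
  moreover have "prob (\<Inter>N. bad_from K l x N) \<le> b * exp (- 1) ^ N" for N
  proof -
    have "prob (\<Inter>N. bad_from K l x N) \<le> prob (bad_from K l x N)"
      by (intro finite_measure_mono bad_from_bound(1)[OF p l]) auto
    also have "... \<le> b * exp (- real N)" using bad_from_bound(2)[OF p l] by (simp add: b_def)
    finally show ?thesis by (simp add: exp_of_nat_mult[symmetric])
  qed
  ultimately have "prob (\<Inter>N. bad_from K l x N) \<le> 0"
    by (intro LIMSEQ_le_const[where X = "\<lambda>N. b * exp (- 1) ^ N"]) auto
  then have "prob (\<Inter>N. bad_from K l x N) = 0" using measure_nonneg by (rule antisym)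
  moreover have "(\<Inter>N. bad_from K l x N) \<in> sets M" using bad_from_bound(1)[OF p l] by auto
  ultimately have "(\<Inter>N. bad_from K l x N) \<in> null_sets M" by (auto simp: null_sets_def emeasure_eq_measure)
  from AE_not_in[OF this] show ?thesis by (rule AE_mp) auto
qed

text \<open>The summand 2 ensures that for \<open>R\<close> above this radius the integer part of
  \<open>R / l\<close>, which serves as scale \<open>m\<close>, is positive and at least the good
  index.\<close>

definition harnack_radius :: "real \<Rightarrow> nat \<Rightarrow> int ^ 'd \<Rightarrow> 'w \<Rightarrow> real" where
  "harnack_radius K l x \<omega> = real l * (2 + real (LEAST N. \<omega> \<notin> bad_from K l x N))"

lemma harnack_radius_measurable:
  fixes x :: "int ^ 'd"
  assumes p: "\<And>e. e \<in> lattice_edges \<Longrightarrow> prob {\<omega>\<in>space M. K < \<mu> e \<omega>} \<le> (exp (- 2) / (2 * 3 ^ CARD('d)))^2"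
    and l: "1 \<le> l"
  shows "harnack_radius K l x \<in> borel_measurable M"
proof -
  have [measurable]: "Measurable.pred M (\<lambda>\<omega>. \<omega> \<notin> bad_from K l x N)" for N
    using bad_from_bound(1)[OF p l, of x N] by simp
  show ?thesis unfolding harnack_radius_def by measurable
qed

lemma harnack_radius_tail:
  fixes x :: "int ^ 'd"
  assumes p: "\<And>e. e \<in> lattice_edges \<Longrightarrow> prob {\<omega>\<in>space M. K < \<mu> e \<omega>} \<le> (exp (- 2) / (2 * 3 ^ CARD('d)))^2"
    and l: "1 \<le> l"
  shows "prob {\<omega>\<in>space M. real n \<le> harnack_radius K l x \<omega>}
    \<le> ((real (3 * l * CARD('d))) ^ CARD('d) / (1 - exp (- 1)) + 1) * exp 4 * exp (- (real n / real l))"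
proof -
  define b where "b = (real (3 * l * CARD('d))) ^ CARD('d) / (1 - exp (- 1))"
  have b: "0 \<le> b" by (simp add: b_def)
  define t where "t = real n / real l"
  have t: "0 \<le> t" by (simp add: t_def)
  show ?thesis
  proof (cases "t \<le> 3")
    case True
    have "prob {\<omega>\<in>space M. real n \<le> harnack_radius K l x \<omega>} \<le> 1" by simp
    also have "1 \<le> exp (4 - t)" using True by simp
    also have "... \<le> (b + 1) * exp (4 - t)" using b by simp
    also have "... = (b + 1) * exp 4 * exp (- t)" by (simp add: exp_add[symmetric])
    finally show ?thesis by (simp add: b_def t_def)
  next
    case False
    \<comment> \<open>The inclusion below needs \<open>N < t - 2\<close>, and rounding may cost one
      more; the resulting \<open>N \<ge> t - 4\<close> is the origin of
      \<open>exp 4\<close>.\<close>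
    define N where "N = nat \<lfloor>t\<rfloor> - 3"
    have N: "real N \<le> t - 3" "t - 4 \<le> real N"
    proof -
      have "3 \<le> nat \<lfloor>t\<rfloor>" using False by (simp add: le_nat_iff le_floor_iff)
      then have "real N = real (nat \<lfloor>t\<rfloor>) - 3" by (simp add: N_def)
      moreover have "real (nat \<lfloor>t\<rfloor>) = of_int \<lfloor>t\<rfloor>" using t by simp
      ultimately show "real N \<le> t - 3" "t - 4 \<le> real N" by linarith+
    qed
    have "{\<omega>\<in>space M. real n \<le> harnack_radius K l x \<omega>} \<subseteq> bad_from K l x N"
    proof
      fix \<omega> assume "\<omega> \<in> {\<omega>\<in>space M. real n \<le> harnack_radius K l x \<omega>}"
      then have "t \<le> 2 + real (LEAST N. \<omega> \<notin> bad_from K l x N)"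
        using l by (simp add: t_def harnack_radius_def field_simps)
      then have "real N < real (LEAST N. \<omega> \<notin> bad_from K l x N)" using N by linarith
      then have "N < (LEAST N. \<omega> \<notin> bad_from K l x N)" by simp
      \<comment> \<open>Indices below the \<open>LEAST\<close> are bad even when no good index
        exists, so the inclusion also holds on the exceptional null set.\<close>
      from not_less_Least[OF this] show "\<omega> \<in> bad_from K l x N" by simp
    qed
    then have "prob {\<omega>\<in>space M. real n \<le> harnack_radius K l x \<omega>} \<le> prob (bad_from K l x N)"
      by (intro finite_measure_mono bad_from_bound(1)[OF p l])
    also have "... \<le> b * exp (- real N)" using bad_from_bound(2)[OF p l] by (simp add: b_def)
    also have "... \<le> b * exp (4 - t)" using b N by (intro mult_left_mono) auto
    also have "... \<le> (b + 1) * exp (4 - t)" by simp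
    also have "... = (b + 1) * exp 4 * exp (- t)" by (simp add: exp_add[symmetric])
    finally show ?thesis by (simp add: b_def t_def)
  qed
qed

lemma good_paths:
  assumes \<omega>: "\<omega> \<in> space M" "\<omega> \<notin> bad_from K l x N" and j: "N \<le> j" and z: "z \<in> cube x (l * (j + 1))"
    and xs: "xs \<in> paths_from z" "length xs = j + 1"
  shows "2 * card (bad_edges (\<lambda>e. \<mu> e \<omega>) K xs) \<le> j"
proof (rule ccontr)
  assume "\<not> ?thesis"
  then have "\<omega> \<in> {\<omega>\<in>space M. j < 2 * card {e\<in>path_edges xs. K < \<mu> e \<omega>}}"
    using \<omega> by (simp add: bad_edges_def)
  moreover have "xs \<in> paths_of_length z j" using xs by (simp add: paths_of_length_def)
  ultimately have "\<omega> \<in> bad_event K l x j" unfolding bad_event_def using z by blast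
  then have "\<omega> \<in> bad_event K l x (N + (j - N))" using j by simp
  then show False using \<omega> by (auto simp: bad_from_def)
qed

lemma AE_elliptic_harnack:
  assumes C: "1 \<le> C" "\<forall>(\<mu> :: (int ^ 'd::finite) set \<Rightarrow> real) z m \<rho> h.
      (\<forall>e\<in>lattice_edges. 1 \<le> \<mu> e) \<longrightarrow> 1 \<le> m \<longrightarrow> adapted_dist \<mu> K z m \<rho> \<longrightarrow>
      (\<forall>x\<in>cube z (14 * (4 * CARD('d)) ^ 3 * m). 0 \<le> h x) \<longrightarrow>
      (\<forall>x\<in>cube z ((4 * CARD('d)) ^ 3 * m). generator \<mu> h x = 0) \<longrightarrow>
      (\<forall>x\<in>cube z m. \<forall>y\<in>cube z m. h x \<le> C * h y)"
    and p: "\<And>e. e \<in> lattice_edges \<Longrightarrow> prob {\<omega>\<in>space M. K < \<mu> e \<omega>} \<le> (exp (- 2) / (2 * 3 ^ CARD('d)))^2"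
    and K: "0 < K" and l: "l = 2 * CARD('d) * (14 * (4 * CARD('d)) ^ 3)"
  shows "AE \<omega> in M. \<forall>x R. harnack_radius K l x \<omega> \<le> R \<longrightarrow> elliptic_harnack (\<lambda>e. \<mu> e \<omega>) (C ^ (2 * l)) x R"
proof -
  have l1: "1 \<le> l" by (simp add: l)
  \<comment> \<open>The lattice is countable, so one null set serves all centres.\<close>
  have "AE \<omega> in M. \<forall>x. \<exists>N. \<omega> \<notin> bad_from K l x N"
    unfolding AE_all_countable by (intro allI AE_eventually_good[OF _ l1] p)
  with AE_space have "AE \<omega> in M. \<omega> \<in> space M \<and> (\<forall>x. \<exists>N. \<omega> \<notin> bad_from K l x N)" by eventually_elim simp
  then show ?thesis
  proof (rule eventually_mono, intro allI impI)
    fix \<omega> x R assume "\<omega> \<in> space M \<and> (\<forall>x. \<exists>N. \<omega> \<notin> bad_from K l x N)"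
      and R: "harnack_radius K l x \<omega> \<le> R"
    then have \<omega>: "\<omega> \<in> space M" and ex: "\<forall>x. \<exists>N. \<omega> \<notin> bad_from K l x N" by auto
    define N where "N = (LEAST N. \<omega> \<notin> bad_from K l x N)"
    have N: "\<omega> \<notin> bad_from K l x N" unfolding N_def
      by (rule LeastI_ex[where P = "\<lambda>N. \<omega> \<notin> bad_from K l x N"]) (use ex in blast)
    define m where "m = nat \<lfloor>R / real l\<rfloor>"
    have Rl: "2 + real N \<le> R / real l"
      using R l1 by (simp add: harnack_radius_def N_def field_simps)
    then have m_real: "real m = of_int \<lfloor>R / real l\<rfloor>" by (simp add: m_def)
    have m: "N \<le> m" "1 \<le> m" using Rl unfolding m_def by (simp_all add: le_nat_iff le_floor_iff)
    have "real m \<le> R / real l" "R / real l < real m + 1" unfolding m_real by linarith+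
    then have mR: "real (l * m) \<le> R" "R < real (l * (m + 1))" using l1 by (simp_all add: field_simps)
    have ge1: "\<forall>e\<in>lattice_edges. 1 \<le> \<mu> e \<omega>" using lower \<omega> by blast
    show "elliptic_harnack (\<lambda>e. \<mu> e \<omega>) (C ^ (2 * l)) x R"
    proof (rule elliptic_harnack_chain[OF C(1) m(2) mR, where b = "14 * (4 * CARD('d)) ^ 3"])
      show "2 * CARD('d) * (14 * (4 * CARD('d)) ^ 3) \<le> l" by (simp add: l)
      fix z h assume z: "real (l1_dist x z) < R / 2"
        and h: "\<forall>y\<in>cube z (14 * (4 * CARD('d)) ^ 3 * m). 0 \<le> h y"
        and harm: "\<forall>y\<in>cube z (14 * (4 * CARD('d)) ^ 3 * m). generator (\<lambda>e. \<mu> e \<omega>) h y = 0"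
      have "real (l1_dist x z) < real (l * (m + 1))" using z mR(2) by linarith
      then have "l1_dist x z < l * (m + 1)" by (simp only: of_nat_less_iff)
      then have z_in: "z \<in> cube x (l * (m + 1))" by (intro l1_dist_cube less_imp_le)
      have ad: "adapted_dist (\<lambda>e. \<mu> e \<omega>) K z m (\<lambda>y. real (fpp_dist (\<lambda>e. \<mu> e \<omega>) K z y))"
      proof (rule adapted_fpp_dist[OF ge1 K])
        fix j xs assume j: "m \<le> j" and xs: "xs \<in> paths_from z" "length xs = j + 1"
        have "l * (m + 1) \<le> l * (j + 1)" using j by simp
        then have "z \<in> cube x (l * (j + 1))" using z_in cube_mono by blast
        then show "2 * card (bad_edges (\<lambda>e. \<mu> e \<omega>) K xs) \<le> j"
          using good_paths[OF \<omega> N _ _ xs] j m(1) by simp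
      qed
      have "cube z ((4 * CARD('d)) ^ 3 * m) \<subseteq> cube z (14 * (4 * CARD('d)) ^ 3 * m)"
        by (rule cube_mono) simp
      then show "\<forall>y\<in>cube z m. \<forall>y'\<in>cube z m. h y \<le> C * h y'"
        using C(2)[rule_format, OF ge1[rule_format] m(2) ad] h harm by blast
    qed
  qed
qed

end

theorem corollary4p8:
  fixes M :: "'w measure"
    and \<mu> :: "(int ^ 'd::finite) set \<Rightarrow> 'w \<Rightarrow> real"
    and \<eta> :: real
  assumes "CARD('d) \<ge> 2"
    and "prob_space M"
    and "prob_space.indep_vars M (\<lambda>_. borel) \<mu> lattice_edges"
    and "\<And>e e'. e \<in> lattice_edges \<Longrightarrow> e' \<in> lattice_edges \<Longrightarrow>
           distr M borel (\<mu> e) = distr M borel (\<mu> e')"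
    and "\<And>e \<omega>. e \<in> lattice_edges \<Longrightarrow> \<omega> \<in> space M \<Longrightarrow> 1 \<le> \<mu> e \<omega>"
    and "0 < \<eta>" and "\<eta> < 1"
  shows "\<exists>(C\<^sub>H::real) (c\<^sub>1::real) (c\<^sub>2::real) (U :: int ^ 'd \<Rightarrow> 'w \<Rightarrow> real).
           0 < c\<^sub>1 \<and> 0 < c\<^sub>2 \<and>
           (\<forall>x. U x \<in> borel_measurable M) \<and>
           (\<forall>x (n::nat). measure M {\<omega> \<in> space M. real n \<le> U x \<omega>}
                           \<le> c\<^sub>1 * exp (- c\<^sub>2 * real n powr \<eta>)) \<and>
           (AE \<omega> in M. \<forall>x R. U x \<omega> \<le> R \<longrightarrow> elliptic_harnack (\<lambda>e. \<mu> e \<omega>) C\<^sub>H x R)"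
proof -
  interpret prob_space M by fact
  interpret iid_conductances M \<mu> by unfold_locales fact+
  \<comment> \<open>For \<open>l * m \<le> R\<close> the cube of radius
    \<open>14 * (4 * d) ^ 3 * m\<close> about a vertex within \<open>R / 2\<close> of
    \<open>x\<close> lies in the ball of radius \<open>R\<close>: passing from the sup norm to the
    graph distance costs the factor \<open>d\<close>, the halving of \<open>R\<close> the factor
    2.\<close>
  define l where "l = 2 * CARD('d) * (14 * (4 * CARD('d)) ^ 3)"
  have l: "1 \<le> l" by (simp add: l_def)
  obtain K where K: "0 < K"
    "\<forall>e\<in>lattice_edges. prob {\<omega>\<in>space M. K < \<mu> e \<omega>} \<le> (exp (- 2) / (2 * 3 ^ CARD('d)))^2"
    using ex_threshold[of "(exp (- 2) / (2 * 3 ^ CARD('d)))^2"] by auto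
  then have p: "\<And>e. e \<in> lattice_edges \<Longrightarrow> prob {\<omega>\<in>space M. K < \<mu> e \<omega>} \<le> (exp (- 2) / (2 * 3 ^ CARD('d)))^2"
    by blast
  obtain C where C: "1 \<le> C" "\<forall>(\<mu> :: (int ^ 'd::finite) set \<Rightarrow> real) z m \<rho> h.
      (\<forall>e\<in>lattice_edges. 1 \<le> \<mu> e) \<longrightarrow> 1 \<le> m \<longrightarrow> adapted_dist \<mu> K z m \<rho> \<longrightarrow>
      (\<forall>x\<in>cube z (14 * (4 * CARD('d)) ^ 3 * m). 0 \<le> h x) \<longrightarrow>
      (\<forall>x\<in>cube z ((4 * CARD('d)) ^ 3 * m). generator \<mu> h x = 0) \<longrightarrow>
      (\<forall>x\<in>cube z m. \<forall>y\<in>cube z m. h x \<le> C * h y)"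
    using lattice_harnack[OF K(1), where 'd = 'd] by blast
  define a where "a = ((real (3 * l * CARD('d))) ^ CARD('d) / (1 - exp (- 1)) + 1) * exp 4"
  have a: "0 < a" unfolding a_def by (intro mult_pos_pos add_nonneg_pos divide_nonneg_nonneg) auto
  have tail: "prob {\<omega>\<in>space M. real n \<le> harnack_radius K l x \<omega>} \<le> a * exp (- (1 / real l) * real n powr \<eta>)"
    for x n
  proof -
    \<comment> \<open>True for integers, which are zero or at least one; at zero it uses the
      convention \<open>0 powr \<eta> = 0\<close>.\<close>
    have "real n powr \<eta> \<le> real n"
    proof (cases "n = 0")
      case False
      then have "real n powr \<eta> \<le> real n powr 1" using assms(7) by (intro powr_mono) auto
      then show ?thesis using False by simp
    qed simp
    then have "exp (- (real n / real l)) \<le> exp (- (1 / real l) * real n powr \<eta>)"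
      using l by (simp add: divide_right_mono)
    then have "a * exp (- (real n / real l)) \<le> a * exp (- (1 / real l) * real n powr \<eta>)"
      using a by (intro mult_left_mono) auto
    then show ?thesis using harnack_radius_tail[OF p l, of n x] unfolding a_def by linarith
  qed
  show ?thesis
  proof (intro exI conjI allI)
    show "0 < a" by (rule a)
    show "0 < 1 / real l" using l by simp
    show "harnack_radius K l x \<in> borel_measurable M" for x by (rule harnack_radius_measurable[OF p l])
    show "prob {\<omega>\<in>space M. real n \<le> harnack_radius K l x \<omega>} \<le> a * exp (- (1 / real l) * real n powr \<eta>)"
      for x n by (rule tail)
    show "AE \<omega> in M. \<forall>x R. harnack_radius K l x \<omega> \<le> R \<longrightarrow> elliptic_harnack (\<lambda>e. \<mu> e \<omega>) (C ^ (2 * l)) x R"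
      by (rule AE_elliptic_harnack[OF C p K(1) l_def])
  qed
qed

end
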